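(* Let $y\ge2$ be an integer. For $k\ge1$ let $$f_{k,y}=\sum_{\substack{\Omega(n)=k\\ p\mid n\Rightarrow p>y}}\frac{1}{n\log n},$$ where $\Omega(n)$ is the number of prime factors of $n$ counted with multiplicity. Define $$c_y=\gamma+\sum_{p\le y}\frac{\log p}{p-1}-\sum_{p>y}\frac{\log p}{(p-1)(p-2)},\qquad d_y=d\prod_{2<p\le y}\Big(1-\frac2p\Big),$$ where $\gamma$ is the Euler--Mascheroni constant and $d=\frac14\prod_{p>2}(1-\frac2p)^{-1}(1-\frac1p)^2$. Then, uniformly for $k\ge1$, $$f_{k,y}=\prod_{p\le y}\Big(1-\frac1p\Big)+\frac{c_yd_y}{2^k}+O_y\Big(\frac{k^3}{3^k}\Big).$$
   Context: $p$ ranges over primes. $O_y$ means the implied constant may depend on $y$ only. *)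

theory Defs
  imports
    "HOL-Analysis.Analysis"
    "HOL-Computational_Algebra.Primes"
    "HOL-Real_Asymp.Real_Asymp"
begin

definition big_omega :: "nat \<Rightarrow> nat" where
  "big_omega n = size (prime_factorization n)"

definition rough_numbers :: "nat \<Rightarrow> nat \<Rightarrow> nat set" where
  "rough_numbers k y =
     {n. n > 0 \<and> big_omega n = k \<and> (\<forall>p. prime p \<and> p dvd n \<longrightarrow> p > y)}"

definition f_sum :: "nat \<Rightarrow> nat \<Rightarrow> real" where
  "f_sum k y = (\<Sum>\<^sub>\<infinity>n\<in>rough_numbers k y. 1 / (real n * ln (real n)))"

definition c_const :: "nat \<Rightarrow> real" where
  "c_const y = euler_mascheroni
     + (\<Sum>p | prime p \<and> p \<le> y. ln (real p) / (real p - 1))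
     - (\<Sum>\<^sub>\<infinity>p | prime p \<and> p > y. ln (real p) / ((real p - 1) * (real p - 2)))"

text \<open>The product over the primes $p > 2$ is written as a product over all natural numbers,
  with factor $1$ at the other indices.\<close>

definition d_factor :: "nat \<Rightarrow> real" where
  "d_factor p = (if prime p \<and> p > 2 then inverse (1 - 2 / real p) * (1 - 1 / real p)\<^sup>2 else 1)"

definition d_base :: real where
  "d_base = 1 / 4 * (\<Prod>p. d_factor p)"

definition d_const :: "nat \<Rightarrow> real" where
  "d_const y = d_base * (\<Prod>p | prime p \<and> 2 < p \<and> p \<le> y. 1 - 2 / real p)"

text \<open>Convergence of the infinite series in \<^const>\<open>c_const\<close> and of the infinite product in
  \<^const>\<open>d_base\<close>, so that neither takes the default value of a divergent expression.\<close>

lemma c_const_series_summable: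
  "(\<lambda>p. ln (real p) / ((real p - 1) * (real p - 2))) summable_on {p. prime p \<and> p > y}"
proof -
  let ?g = "\<lambda>p. ln (real p) / ((real p - 1) * (real p - 2))"
  have "summable (\<lambda>n. norm (real n powr (-3/2)))"
    by (simp add: summable_real_powr_iff)
  moreover have "(\<lambda>n. norm (?g n)) \<in> O(\<lambda>n. real n powr (-3/2))"
    unfolding real_norm_def by real_asymp
  ultimately have "summable (\<lambda>n. norm (?g n))"
    by (rule summable_comparison_test_bigo)
  hence "?g summable_on UNIV"
    by (rule norm_summable_imp_summable_on)
  thus ?thesis
    by (rule summable_on_subset_banach) simp
qed

lemma d_base_product_convergent: "convergent_prod d_factor"
proof -
  have eq: "d_factor p - 1 = (if prime p \<and> p > 2 then 1 / (real p * (real p - 2)) else 0)" for p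
    unfolding d_factor_def by (auto simp: field_simps power2_eq_square)
  have "summable (\<lambda>n. norm (real n powr (-2)))"
    by (simp add: summable_real_powr_iff)
  moreover have "(\<lambda>p. norm (1 / (real p * (real p - 2)))) \<in> O(\<lambda>n. real n powr (-2))"
    unfolding real_norm_def by real_asymp
  ultimately have s: "summable (\<lambda>p. norm (1 / (real p * (real p - 2))))"
    by (rule summable_comparison_test_bigo)
  have "summable (\<lambda>p. norm (d_factor p - 1))"
    by (rule summable_comparison_test'[OF s, of 0]) (auto simp: eq)
  thus ?thesis
    by (intro abs_convergent_prod_imp_convergent_prod) (simp add: abs_convergent_prod_conv_summable)
qed

end

theory Submission
  imports Defs "HOL-Complex_Analysis.Complex_Analysis"
begin

text \<open>
  Let $P_k(s)$ be the sum of $n^{-s}$ over the $y$-rough $n$ with $\Omega(n) = k$. Since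
  $1/(n \log n) = \int_1^\infty n^{-s}\,ds$, the sum $f_{k,y}$ is $\int_1^\infty P_k(s)\,ds$. The generating
  function $\sum_k P_k(s) z^k$ is the Euler product $\prod_{p>y} (1 - z p^{-s})^{-1}$, and with $s = 1 + u$
  it equals $u^{-z} K_u(z)$ where
  $$K_u(z) = \exp\Big(z \log(u \zeta(1+u)) + z \sum_{p\le y} \log(1-p^{-s}) +
    \sum_{p>y} \big(z \log(1-p^{-s}) - \log(1-zp^{-s})\big)\Big).$$
  For $y \ge 3$ this is holomorphic in $|z| < 4$ and $K_u(z) = A(z) + B(z) u + O(u^2)$ there, so by Cauchy's
  inequality the coefficients satisfy $\kappa_m(u) = a_m + b_m u + O(u^2 (2/7)^m)$. For $y = 2$ the factor
  $(1 - z 3^{-s})^{-1}$ is multiplied in separately, which costs $(m+1)^2 3^{-m}$ instead of $(2/7)^m$.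
  As $\int_0^1 u^i (-\log u)^j / j!\,du = (i+1)^{-j-1}$, integrating
  $P_k(1+u) = \sum_j (-\log u)^j / j! \cdot \kappa_{k-j}(u)$ over $0 < u < 1$ yields
  $\sum_{m\le k} a_m + 2^{-k-1} \sum_{m\le k} b_m 2^m + O(k^3 3^{-k})$, where the two sums converge
  geometrically to $A(1) = \prod_{p\le y} (1 - 1/p)$ and $B(2) = 2 c_y d_y$. The part $s \ge 2$ is
  $O(P_k(2))$ and hence negligible.
\<close>

text \<open>The factor u^(-z) is singular at u = 0, so only K_u is expanded in u. Its term of order
  u^i lives on the scale (i+1)^(-k) after integration, and the coefficient sums become values at z =
  i+1. This is why the constants are read off at z = 1 and z = 2 and why a remainder of order u^2
  matches 3^(-k). Adding z log(1 - p^(-s)) for each p > y cancels the part linear in p^(-s). The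
  remaining sum over primes converges absolutely down to s = 1, and all divergence sits in z log
  zeta, where it is known explicitly. The z-coefficients of the remainder must be as small as
  3^(-m), so K_u has to be bounded on a disc of radius above 3, uniformly as u tends to 0. At u = 0
  its singularities are the primes z = p > y. For y >= 3 they start at 5 or later. For y = 2 the
  first lies at 3, on the critical circle itself, which forces the separate treatment. The
  coefficients 3^(-i(1+u)) of that factor have second-order remainder i^2 u^2, the source of the
  square; the k + 1 terms of the final convolution raise it to k^3.\<close>

section \<open>Almost primes composed of primes from a given set\<close>

text \<open>An arbitrary set \<open>S\<close> is allowed because several are needed: finite sets for
  induction, all primes for the zeta function, the primes above y, and the primes above 3 with 3
  adjoined.\<close>

definition almost_primes :: "nat set \<Rightarrow> nat \<Rightarrow> nat set" where
  "almost_primes S k = {n. n > 0 \<and> big_omega n = k \<and> (\<forall>p. prime p \<and> p dvd n \<longrightarrow> p \<in> S)}"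

lemma big_omega_eq_0_iff: "n > 0 \<Longrightarrow> big_omega n = 0 \<longleftrightarrow> n = 1"
  by (auto simp: big_omega_def prime_factorization_empty_iff)

lemma big_omega_prime_mult: "prime p \<Longrightarrow> n > 0 \<Longrightarrow> big_omega (p * n) = Suc (big_omega n)"
  by (simp add: big_omega_def prime_factorization_mult prime_factorization_prime)

lemma almost_primes_0: "almost_primes S 0 = {1}"
  by (auto simp: almost_primes_def big_omega_eq_0_iff)

lemma almost_primes_empty: "almost_primes {} (Suc k) = {}"
proof -
  have False if "n \<in> almost_primes {} (Suc k)" for n
  proof -
    from that have "n \<noteq> 1" by (auto simp: almost_primes_def big_omega_def)
    then obtain p where "prime p" "p dvd n" using prime_factor_nat by blast
    with that show False by (auto simp: almost_primes_def)
  qed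
  thus ?thesis by blast
qed

text \<open>Split by whether p divides n. The quotient in the second part may still contain p, so it
  stays over \<open>insert p S\<close>; this is the recursion of the geometric series 1/(1 - p^s
  X).\<close>

lemma almost_primes_insert:
  assumes p: "prime p"
  shows "almost_primes (insert p S) (Suc k) = almost_primes S (Suc k) \<union> (*) p ` almost_primes (insert p S) k"
proof (intro equalityI subsetI)
  fix n assume n: "n \<in> almost_primes (insert p S) (Suc k)"
  show "n \<in> almost_primes S (Suc k) \<union> (*) p ` almost_primes (insert p S) k"
  proof (cases "p dvd n")
    case True
    then obtain m where m: "n = p * m" by auto
    with n p have "m \<in> almost_primes (insert p S) k"
      by (auto simp: almost_primes_def big_omega_prime_mult)
    thus ?thesis using m by auto
  next
    case False
    with n have "n \<in> almost_primes S (Suc k)" by (auto simp: almost_primes_def)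
    thus ?thesis by auto
  qed
next
  fix n assume "n \<in> almost_primes S (Suc k) \<union> (*) p ` almost_primes (insert p S) k"
  thus "n \<in> almost_primes (insert p S) (Suc k)"
    using p by (auto simp: almost_primes_def big_omega_prime_mult prime_dvd_mult_iff prime_gt_0_nat
                           primes_dvd_imp_eq)
qed

lemma almost_primes_insert_disjoint:
  assumes "prime p" "p \<notin> S"
  shows "almost_primes S (Suc k) \<inter> (*) p ` almost_primes (insert p S) k = {}"
  using assms by (auto simp: almost_primes_def)

lemma finite_almost_primes:
  assumes "finite S" "\<And>p. p \<in> S \<Longrightarrow> prime p"
  shows "finite (almost_primes S k)"
  using assms
proof (induction S arbitrary: k rule: finite_induct)
  case empty
  show ?case by (cases k) (simp_all add: almost_primes_0 almost_primes_empty)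
next
  case (insert p S)
  show ?case
    by (induction k) (use insert in \<open>simp_all add: almost_primes_0 almost_primes_insert\<close>)
qed

lemma inj_on_mult_nat: "(p::nat) > 0 \<Longrightarrow> inj_on ((*) p) A"
  by (auto simp: inj_on_def)

lemma sum_almost_primes_insert:
  fixes s :: real
  assumes "finite S" "\<And>p. p \<in> S \<Longrightarrow> prime p" "prime p" "p \<notin> S"
  shows "(\<Sum>n\<in>almost_primes (insert p S) (Suc k). real n powr s) =
         (\<Sum>n\<in>almost_primes S (Suc k). real n powr s) +
         real p powr s * (\<Sum>n\<in>almost_primes (insert p S) k. real n powr s)"
proof -
  have fin: "finite (almost_primes S (Suc k))" "finite (almost_primes (insert p S) k)"
    using assms by (auto intro!: finite_almost_primes)
  have "(\<Sum>n\<in>almost_primes (insert p S) (Suc k). real n powr s) =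
        (\<Sum>n\<in>almost_primes S (Suc k). real n powr s) + (\<Sum>n\<in>(*) p ` almost_primes (insert p S) k. real n powr s)"
    unfolding almost_primes_insert[OF assms(3)]
    by (rule sum.union_disjoint) (use fin assms almost_primes_insert_disjoint in auto)
  also have "(\<Sum>n\<in>(*) p ` almost_primes (insert p S) k. real n powr s) =
             real p powr s * (\<Sum>n\<in>almost_primes (insert p S) k. real n powr s)"
    using assms(3)
    by (subst sum.reindex) (auto simp: inj_on_mult_nat prime_gt_0_nat powr_mult sum_distrib_left)
  finally show ?thesis .
qed

text \<open>The exponent of \<open>fps_X\<close> counts prime factors, and multiplying by 1 - p^s X
  undoes the insertion of p. Complex coefficients prepare the comparison with derivatives of
  holomorphic functions.\<close>

lemma Abs_fps_almost_primes:
  fixes s :: real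
  assumes "finite S" "\<And>p. p \<in> S \<Longrightarrow> prime p"
  shows "Abs_fps (\<lambda>k. complex_of_real (\<Sum>n\<in>almost_primes S k. real n powr s)) =
         (\<Prod>p\<in>S. inverse (1 - fps_const (complex_of_real (real p powr s)) * fps_X))"
  using assms
proof (induction S rule: finite_induct)
  case empty
  show ?case
    by (rule fps_ext, case_tac n) (simp_all add: almost_primes_0 almost_primes_empty)
next
  case (insert p S)
  let ?H = "\<lambda>S. Abs_fps (\<lambda>k. complex_of_real (\<Sum>n\<in>almost_primes S k. real n powr s))"
  let ?G = "1 - fps_const (complex_of_real (real p powr s)) * fps_X"
  have "?H (insert p S) * ?G = ?H S"
  proof (rule fps_ext)
    fix k
    show "fps_nth (?H (insert p S) * ?G) k = fps_nth (?H S) k"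
    proof (cases k)
      case 0
      thus ?thesis by (simp add: almost_primes_0)
    next
      case (Suc k')
      have "?H (insert p S) * ?G = ?H (insert p S) - fps_const (complex_of_real (real p powr s)) * (fps_X * ?H (insert p S))"
        by (simp add: algebra_simps)
      thus ?thesis using insert.hyps insert.prems Suc
        by (simp add: sum_almost_primes_insert del: of_real_sum)
    qed
  qed
  moreover have "inverse ?G * ?G = 1"
    by (rule inverse_mult_eq_1) simp
  ultimately have "?H (insert p S) = ?H S * inverse ?G"
    by (metis (no_types, lifting) mult.assoc mult.commute mult.right_neutral)
  thus ?case using insert by (simp add: mult.commute)
qed

section \<open>Infinite sums over almost primes as limits over finite sets of primes\<close>

lemma summable_on_powr_nat:
  assumes "s > 1" shows "(\<lambda>n::nat. real n powr (-s)) summable_on A"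
proof -
  have "summable (\<lambda>n::nat. norm (real n powr (-s)))"
    using assms by (simp add: summable_real_powr_iff)
  hence "(\<lambda>n::nat. real n powr (-s)) summable_on UNIV"
    by (rule norm_summable_imp_summable_on)
  thus ?thesis by (rule summable_on_subset_banach) simp
qed

definition almost_prime_sum :: "nat set \<Rightarrow> nat \<Rightarrow> real \<Rightarrow> real" where
  "almost_prime_sum S k s = (\<Sum>\<^sub>\<infinity>n\<in>almost_primes S k. real n powr (-s))"

lemma almost_prime_sum_insert:
  assumes "prime p" "p \<notin> S" "s > 1"
  shows "almost_prime_sum (insert p S) (Suc k) s =
         almost_prime_sum S (Suc k) s + real p powr (-s) * almost_prime_sum (insert p S) k s"
proof -
  have "(\<Sum>\<^sub>\<infinity>n\<in>(*) p ` almost_primes (insert p S) k. real n powr (-s)) =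
        (\<Sum>\<^sub>\<infinity>n\<in>almost_primes (insert p S) k. real p powr (-s) * real n powr (-s))"
    using assms
    by (subst infsum_reindex) (auto simp: inj_on_mult_nat prime_gt_0_nat o_def powr_mult)
  moreover have "almost_prime_sum (insert p S) (Suc k) s = almost_prime_sum S (Suc k) s +
     (\<Sum>\<^sub>\<infinity>n\<in>(*) p ` almost_primes (insert p S) k. real n powr (-s))"
    unfolding almost_prime_sum_def almost_primes_insert[OF assms(1)]
    by (intro infsum_Un_disjoint summable_on_powr_nat assms almost_primes_insert_disjoint)
  ultimately show ?thesis by (simp add: almost_prime_sum_def infsum_cmult_right')
qed

lemma almost_prime_sum_0: "almost_prime_sum S 0 s = 1"
  by (simp add: almost_prime_sum_def almost_primes_0)

text \<open>Finitely many almost primes involve only finitely many primes. This turns convergence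
  along finite sets of integers into convergence along finite sets of primes, the form in which the
  Euler product converges.\<close>

lemma filterlim_almost_primes:
  assumes "\<And>p. p \<in> S \<Longrightarrow> prime p"
  shows "filterlim (\<lambda>X. almost_primes X k) (finite_subsets_at_top (almost_primes S k)) (finite_subsets_at_top S)"
  unfolding filterlim_iff
proof safe
  fix P assume "eventually P (finite_subsets_at_top (almost_primes S k))"
  then obtain T where T: "finite T" "T \<subseteq> almost_primes S k"
    "\<And>Y. finite Y \<Longrightarrow> T \<subseteq> Y \<Longrightarrow> Y \<subseteq> almost_primes S k \<Longrightarrow> P Y"
    by (auto simp: eventually_finite_subsets_at_top)
  define X0 where "X0 = {p. prime p \<and> (\<exists>n\<in>T. p dvd n)}"
  have "X0 \<subseteq> (\<Union>n\<in>T. {p. p dvd n})" by (auto simp: X0_def)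
  moreover have "finite (\<Union>n\<in>T. {p. p dvd n})"
    using T by (auto simp: almost_primes_def intro!: finite_divisors_nat)
  ultimately have fin: "finite X0" by (rule finite_subset)
  have "X0 \<subseteq> S" using T(2) by (auto simp: X0_def almost_primes_def)
  moreover have "P (almost_primes X k)" if X: "finite X" "X0 \<subseteq> X" "X \<subseteq> S" for X
  proof (rule T(3))
    show "finite (almost_primes X k)" using X assms by (intro finite_almost_primes) auto
    show "T \<subseteq> almost_primes X k" proof
      fix n assume n: "n \<in> T"
      hence "p \<in> X" if "prime p" "p dvd n" for p
        using that X(2) by (auto simp: X0_def)
      with n T(2) show "n \<in> almost_primes X k" unfolding almost_primes_def by auto
    qed
    show "almost_primes X k \<subseteq> almost_primes S k" using X(3) by (auto simp: almost_primes_def)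
  qed
  ultimately show "eventually (\<lambda>X. P (almost_primes X k)) (finite_subsets_at_top S)"
    using fin by (auto simp: eventually_finite_subsets_at_top)
qed

lemma almost_prime_sum_tendsto:
  assumes "\<And>p. p \<in> S \<Longrightarrow> prime p" "s > 1"
  shows "((\<lambda>X. \<Sum>n\<in>almost_primes X k. real n powr (-s)) \<longlongrightarrow> almost_prime_sum S k s) (finite_subsets_at_top S)"
proof -
  have "((\<lambda>n::nat. real n powr (-s)) has_sum almost_prime_sum S k s) (almost_primes S k)"
    unfolding almost_prime_sum_def by (intro has_sum_infsum summable_on_powr_nat assms)
  hence "(sum (\<lambda>n::nat. real n powr (-s)) \<longlongrightarrow> almost_prime_sum S k s) (finite_subsets_at_top (almost_primes S k))"
    by (simp add: has_sum_def)
  from filterlim_compose[OF this filterlim_almost_primes[OF assms(1)]] show ?thesis by simp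
qed

section \<open>The Euler product as a generating function\<close>

lemma complex_one_minus_notin_nonpos_Reals:
  fixes w :: complex
  assumes "norm w < 1" shows "1 - w \<notin> \<real>\<^sub>\<le>\<^sub>0"
proof -
  have "Re (1 - w) > 0" using assms complex_Re_le_cmod[of w] by simp
  thus ?thesis by (auto simp: complex_nonpos_Reals_iff simp del: minus_complex.simps)
qed

text \<open>A bound linear in w, so that the logarithms of the Euler factors are dominated by a
  multiple of p^(-s).\<close>

lemma norm_Ln_one_minus_le:
  fixes w :: complex
  assumes "norm w \<le> r" "r < 1"
  shows "norm (Ln (1 - w)) \<le> (1 + 1 / (1 - r)) * norm w"
proof -
  have w: "norm w < 1" using assms by simp
  have "norm (Ln (1 + (-w)) - (-w)) \<le> norm (-w) ^ 2 / (1 - norm (-w))"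
    by (rule Ln_approx_linear) (use w in simp)
  also have "\<dots> = norm w * (norm w / (1 - norm w))"
    by (simp add: power2_eq_square)
  also have "\<dots> \<le> norm w * (1 / (1 - r))"
    by (intro mult_left_mono frac_le) (use assms w in auto)
  finally have "norm (Ln (1 - w) + w) \<le> norm w * (1 / (1 - r))" by simp
  moreover have "norm (Ln (1 - w)) \<le> norm (Ln (1 - w) + w) + norm w"
    by (metis add_diff_cancel norm_triangle_ineq4)
  ultimately show ?thesis by (simp add: algebra_simps)
qed

text \<open>The M-test gives uniform convergence along the finite subsets of \<open>X\<close>, and a
  uniform limit on a closed ball inside \<open>A\<close> is holomorphic in its interior.\<close>

lemma holomorphic_on_infsum:
  fixes f :: "'a \<Rightarrow> complex \<Rightarrow> complex"
  assumes "open A" "\<And>x. x \<in> X \<Longrightarrow> f x holomorphic_on A"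
    and "\<And>x z. x \<in> X \<Longrightarrow> z \<in> A \<Longrightarrow> norm (f x z) \<le> M x" "M summable_on X"
  shows "(\<lambda>z. \<Sum>\<^sub>\<infinity>x\<in>X. f x z) holomorphic_on A"
proof -
  let ?g = "\<lambda>z. \<Sum>\<^sub>\<infinity>x\<in>X. f x z"
  have lim: "uniform_limit A (\<lambda>Y z. \<Sum>x\<in>Y. f x z) ?g (finite_subsets_at_top X)"
    by (rule Weierstrass_m_test_general) (use assms in auto)
  have "\<exists>r>0. ?g holomorphic_on ball z r" if "z \<in> A" for z
  proof -
    obtain r where r: "r > 0" "cball z r \<subseteq> A" using assms(1) \<open>z \<in> A\<close> by (meson open_contains_cball)
    have hol: "(\<lambda>z. \<Sum>x\<in>Y. f x z) holomorphic_on A" if "Y \<subseteq> X" for Y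
      using that by (intro holomorphic_intros assms) auto
    have "eventually (\<lambda>Y. Y \<subseteq> X) (finite_subsets_at_top X)"
      by (simp add: eventually_finite_subsets_at_top_weakI)
    hence "eventually (\<lambda>Y. continuous_on (cball z r) (\<lambda>z. \<Sum>x\<in>Y. f x z) \<and>
                           (\<lambda>z. \<Sum>x\<in>Y. f x z) holomorphic_on ball z r) (finite_subsets_at_top X)"
    proof eventually_elim
      case (elim Y)
      have "(\<lambda>z. \<Sum>x\<in>Y. f x z) holomorphic_on cball z r"
        by (rule holomorphic_on_subset[OF hol[OF elim] r(2)])
      thus ?case
        by (auto intro: holomorphic_on_imp_continuous_on holomorphic_on_subset[OF _ ball_subset_cball])
    qed
    from holomorphic_uniform_limit[OF this uniform_limit_on_subset[OF lim r(2)] finite_subsets_at_top_neq_bot]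
    have "?g holomorphic_on ball z r" by blast
    thus ?thesis using r(1) by blast
  qed
  hence "?g field_differentiable (at z)" if "z \<in> A" for z
    using that by (meson centre_in_ball holomorphic_on_imp_differentiable_at open_ball)
  thus ?thesis by (auto simp: holomorphic_on_def intro: field_differentiable_at_within)
qed

text \<open>The Euler product of (1 - z p^(-s))^(-1) over \<open>S\<close>, written through
  logarithms so that its convergence reduces to absolute summability of a series.\<close>

definition euler_fun :: "nat set \<Rightarrow> real \<Rightarrow> complex \<Rightarrow> complex" where
  "euler_fun S s z = exp (- (\<Sum>\<^sub>\<infinity>p\<in>S. Ln (1 - z * of_real (real p powr (-s)))))"

lemma powr_neg_le_inverse:
  assumes "p \<ge> q" "q \<ge> 1" "s \<ge> 1"
  shows "p powr (-s) \<le> 1 / (q::real)"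
proof -
  have "p powr (-s) \<le> p powr (-1)" using assms by (intro powr_mono) auto
  also have "\<dots> \<le> 1 / q" using assms by (simp add: powr_minus_divide frac_le)
  finally show ?thesis .
qed

text \<open>Here q is a lower bound for the primes and R the radius of the disc for z. With R < q
  every |z p^(-s)| is at most R/q < 1, even at s = 1. The pairs (q, R) used later are (2, 3/2) and
  (5, 4).\<close>

context
  fixes S :: "nat set" and q R :: real
  assumes S: "\<And>p. p \<in> S \<Longrightarrow> prime p" "\<And>p. p \<in> S \<Longrightarrow> real p \<ge> q" and R: "0 < R" "R < q" "1 \<le> q"
begin

lemma euler_factor_small:
  assumes "p \<in> S" "norm z \<le> R" "s \<ge> 1"
  shows "norm (z * complex_of_real (real p powr (-s))) \<le> R / q"
proof -
  have "norm z * real p powr (-s) \<le> R * (1 / q)"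
    by (intro mult_mono powr_neg_le_inverse) (use assms S R in auto)
  thus ?thesis by (simp add: norm_mult)
qed

lemma norm_Ln_euler_factor_le:
  assumes "p \<in> S" "norm z \<le> R" "s \<ge> 1"
  shows "norm (Ln (1 - z * complex_of_real (real p powr (-s)))) \<le> (1 + 1 / (1 - R / q)) * R * real p powr (-s)"
proof -
  let ?w = "z * complex_of_real (real p powr (-s))"
  have "norm (Ln (1 - ?w)) \<le> (1 + 1 / (1 - R / q)) * norm ?w"
    by (rule norm_Ln_one_minus_le[OF euler_factor_small]) (use assms R in auto)
  also have "norm ?w \<le> R * real p powr (-s)"
    using assms by (simp add: norm_mult mult_right_mono)
  finally show ?thesis using R by (simp add: mult_left_mono mult.assoc)
qed

lemma Ln_euler_factor_holomorphic:
  assumes "p \<in> S" "s \<ge> 1"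
  shows "(\<lambda>z. Ln (1 - z * complex_of_real (real p powr (-s)))) holomorphic_on ball 0 R"
proof -
  have "1 - z * complex_of_real (real p powr (-s)) \<notin> \<real>\<^sub>\<le>\<^sub>0" if "z \<in> ball 0 R" for z
  proof -
    let ?w = "z * complex_of_real (real p powr (-s))"
    have "norm ?w < 1" using euler_factor_small[of p z s] that assms R
      by (smt (verit) divide_less_eq_1 mem_ball_0)
    thus ?thesis by (rule complex_one_minus_notin_nonpos_Reals)
  qed
  thus ?thesis by (intro holomorphic_intros) auto
qed

lemma summable_on_Ln_euler_factor_bound:
  assumes "s > 1"
  shows "(\<lambda>p. (1 + 1 / (1 - R / q)) * R * real p powr (-s)) summable_on S"
  by (intro summable_on_cmult_right summable_on_powr_nat assms)

lemma euler_fun_holomorphic: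
  assumes "s > 1"
  shows "euler_fun S s holomorphic_on ball 0 R"
  unfolding euler_fun_def
  by (intro holomorphic_intros holomorphic_on_infsum[OF open_ball Ln_euler_factor_holomorphic
        _ summable_on_Ln_euler_factor_bound[OF assms]] norm_Ln_euler_factor_le)
     (use assms in auto)

text \<open>\<open>exp\<close> is not uniformly continuous on the whole plane, so the majorant
  series is first used to confine all partial sums to one disc \<open>cball 0 B\<close>. On this
  compact set \<open>exp\<close> is uniformly continuous and carries the convergence from sums to
  products.\<close>

lemma euler_fun_uniform_limit:
  assumes s: "s > 1"
  shows "uniform_limit (ball 0 R) (\<lambda>X z. \<Prod>p\<in>X. inverse (1 - z * of_real (real p powr (-s))))
           (euler_fun S s) (finite_subsets_at_top S)"
proof -
  let ?l = "\<lambda>p z. Ln (1 - z * complex_of_real (real p powr (-s)))"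
  let ?M = "\<lambda>p. (1 + 1 / (1 - R / q)) * R * real p powr (-s)"
  define B where "B = infsum ?M S"
  have lim: "uniform_limit (ball 0 R) (\<lambda>X z. \<Sum>p\<in>X. - ?l p z) (\<lambda>z. \<Sum>\<^sub>\<infinity>p\<in>S. - ?l p z) (finite_subsets_at_top S)"
    by (rule Weierstrass_m_test_general[OF _ summable_on_Ln_euler_factor_bound[OF s]])
       (use norm_Ln_euler_factor_le s in auto)
  have M0: "?M p \<ge> 0" for p using R by auto
  have bound: "norm (\<Sum>p\<in>X. - ?l p z) \<le> B" if "finite X" "X \<subseteq> S" "z \<in> ball 0 R" for X z
  proof -
    have "norm (\<Sum>p\<in>X. - ?l p z) \<le> sum ?M X"
      by (rule sum_norm_le) (use norm_Ln_euler_factor_le[of _ z s] that s in auto)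
    also have "\<dots> \<le> B" unfolding B_def
      by (rule finite_sum_le_infsum) (use summable_on_Ln_euler_factor_bound[OF s] that M0 in auto)
    finally show ?thesis .
  qed
  have ev: "eventually (\<lambda>X. \<forall>z\<in>ball 0 R. (\<Sum>p\<in>X. - ?l p z) \<in> cball 0 B) (finite_subsets_at_top S)"
    by (rule eventually_finite_subsets_at_top_weakI) (use bound in auto)
  have "uniformly_continuous_on (cball 0 B) (exp :: complex \<Rightarrow> complex)"
    by (intro compact_uniformly_continuous continuous_intros) auto
  from uniform_limit_compose_uniformly_continuous_on[OF lim this ev]
  have *: "uniform_limit (ball 0 R) (\<lambda>X z. exp (\<Sum>p\<in>X. - ?l p z)) (\<lambda>z. exp (\<Sum>\<^sub>\<infinity>p\<in>S. - ?l p z)) (finite_subsets_at_top S)"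
    by simp
  have e: "exp (\<Sum>p\<in>X. - ?l p z) = (\<Prod>p\<in>X. inverse (1 - z * of_real (real p powr (-s))))"
    if "finite X" "X \<subseteq> S" "z \<in> ball 0 R" for X z
  proof -
    have "1 - z * complex_of_real (real p powr (-s)) \<noteq> 0" if "p \<in> X" for p
    proof -
      have "norm (z * complex_of_real (real p powr (-s))) < 1"
        using euler_factor_small[of p z s] \<open>p \<in> X\<close> \<open>X \<subseteq> S\<close> \<open>z \<in> ball 0 R\<close> s R
        by (smt (verit) divide_less_eq_1 mem_ball_0 subset_eq)
      thus ?thesis by (metis eq_iff_diff_eq_0 less_irrefl norm_one)
    qed
    thus ?thesis using that by (auto simp: exp_sum exp_minus intro!: prod.cong)
  qed
  have "uniform_limit (ball 0 R) (\<lambda>X z. \<Prod>p\<in>X. inverse (1 - z * of_real (real p powr (-s))))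
           (\<lambda>z. exp (\<Sum>\<^sub>\<infinity>p\<in>S. - ?l p z)) (finite_subsets_at_top S)"
  proof (rule uniform_limit_cong[THEN iffD1, OF _ _ *])
    show "\<forall>\<^sub>F X in finite_subsets_at_top S. \<forall>z\<in>ball 0 R. exp (\<Sum>p\<in>X. - ?l p z) =
            (\<Prod>p\<in>X. inverse (1 - z * of_real (real p powr (-s))))"
      by (rule eventually_finite_subsets_at_top_weakI) (use e in auto)
  qed auto
  thus ?thesis by (simp add: euler_fun_def[abs_def] infsum_uminus)
qed

text \<open>Uniform convergence on a disc makes the Taylor coefficients converge. Those of the
  finite products are sums over the almost primes of X, which tend to the sum over the almost primes
  of \<open>S\<close>.\<close>

lemma euler_fun_coeff:
  assumes s: "s > 1"
  shows "(deriv ^^ k) (euler_fun S s) 0 / fact k = of_real (almost_prime_sum S k s)"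
proof -
  let ?f = "\<lambda>X z. \<Prod>p\<in>X. inverse (1 - z * complex_of_real (real p powr (-s)))"
  let ?F = "finite_subsets_at_top S"
  have fps: "?f X has_fps_expansion Abs_fps (\<lambda>k. complex_of_real (\<Sum>n\<in>almost_primes X k. real n powr (-s)))"
    if "finite X" "X \<subseteq> S" for X
  proof -
    have "?f X has_fps_expansion (\<Prod>p\<in>X. inverse (1 - fps_const (complex_of_real (real p powr (-s))) * fps_X))"
    proof (intro has_fps_expansion_prod has_fps_expansion_inverse)
      fix p
      have "(\<lambda>z. 1 - complex_of_real (real p powr (-s)) * z) has_fps_expansion
              1 - fps_const (complex_of_real (real p powr (-s))) * fps_X"
        by (intro fps_expansion_intros)
      thus "(\<lambda>z. 1 - z * complex_of_real (real p powr (-s))) has_fps_expansion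
              1 - fps_const (complex_of_real (real p powr (-s))) * fps_X"
        by (simp add: mult.commute)
    qed auto
    thus ?thesis using that S(1) by (subst Abs_fps_almost_primes) auto
  qed
  have "((\<lambda>X. (deriv ^^ k) (?f X) 0) \<longlongrightarrow> (deriv ^^ k) (euler_fun S s) 0) ?F"
  proof (rule higher_deriv_complex_uniform_limit[OF euler_fun_uniform_limit[OF s]])
    show "\<forall>\<^sub>F X in ?F. ?f X holomorphic_on ball 0 R"
    proof (rule eventually_finite_subsets_at_top_weakI)
      fix X assume X: "finite X" "X \<subseteq> S"
      have "1 - z * complex_of_real (real p powr (-s)) \<noteq> 0" if "p \<in> X" "z \<in> ball 0 R" for p z
      proof -
        have "norm (z * complex_of_real (real p powr (-s))) < 1"
          using euler_factor_small[of p z s] \<open>p \<in> X\<close> \<open>X \<subseteq> S\<close> \<open>z \<in> ball 0 R\<close> s R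
          by (smt (verit) divide_less_eq_1 mem_ball_0 subset_eq)
        thus ?thesis by (metis eq_iff_diff_eq_0 less_irrefl norm_one)
      qed
      thus "?f X holomorphic_on ball 0 R" by (intro holomorphic_intros) auto
    qed
  qed (use R in auto)
  hence "((\<lambda>X. (deriv ^^ k) (?f X) 0 / fact k) \<longlongrightarrow> (deriv ^^ k) (euler_fun S s) 0 / fact k) ?F"
    by (rule tendsto_divide[OF _ tendsto_const]) simp
  moreover have "\<forall>\<^sub>F X in ?F. (deriv ^^ k) (?f X) 0 / fact k = complex_of_real (\<Sum>n\<in>almost_primes X k. real n powr (-s))"
    by (rule eventually_finite_subsets_at_top_weakI) (simp only: fps_nth_fps_expansion[OF fps, symmetric] fps_nth_Abs_fps)
  ultimately have "((\<lambda>X. complex_of_real (\<Sum>n\<in>almost_primes X k. real n powr (-s))) \<longlongrightarrow> (deriv ^^ k) (euler_fun S s) 0 / fact k) ?F"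
    by (rule Lim_transform_eventually)
  moreover have "((\<lambda>X. complex_of_real (\<Sum>n\<in>almost_primes X k. real n powr (-s))) \<longlongrightarrow> of_real (almost_prime_sum S k s)) ?F"
    using S(1) s by (intro tendsto_of_real almost_prime_sum_tendsto) auto
  ultimately show ?thesis
    by (intro tendsto_unique[OF finite_subsets_at_top_neq_bot])
qed

end

section \<open>The zeta function near 1\<close>

definition real_zeta :: "real \<Rightarrow> real" where
  "real_zeta s = (\<Sum>\<^sub>\<infinity>n\<in>{0<..}. real n powr (-s))"

lemma real_zeta_sums:
  assumes "s > 1"
  shows "(\<lambda>n. real (Suc n) powr (-s)) sums real_zeta s"
proof -
  have "((\<lambda>n::nat. real n powr (-s)) has_sum real_zeta s) {0<..}"
    unfolding real_zeta_def by (intro has_sum_infsum summable_on_powr_nat assms)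
  also have "{0<..} = range Suc"
    by (auto simp: greaterThan_0)
  finally have "((\<lambda>n. real (Suc n) powr (-s)) has_sum real_zeta s) UNIV"
    by (subst (asm) has_sum_reindex) (auto simp: o_def)
  thus ?thesis by (rule has_sum_imp_sums)
qed

text \<open>The positive integers are partitioned by their number of prime factors, and an unordered
  sum may be regrouped along this partition.\<close>

lemma almost_prime_sum_sums_zeta:
  assumes "s > 1"
  shows "(\<lambda>k. almost_prime_sum {p. prime p} k s) sums real_zeta s"
proof -
  let ?A = "almost_primes {p. prime p}"
  have bij: "snd ` Sigma UNIV ?A = {0<..}" "inj_on snd (Sigma UNIV ?A)"
    by (auto simp: almost_primes_def inj_on_def image_iff)
  have "((\<lambda>n::nat. real n powr (-s)) has_sum real_zeta s) (snd ` Sigma UNIV ?A)"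
    unfolding real_zeta_def bij by (intro has_sum_infsum summable_on_powr_nat assms)
  hence "((\<lambda>(k,n). real n powr (-s)) has_sum real_zeta s) (Sigma UNIV ?A)"
    by (subst (asm) has_sum_reindex[OF bij(2)]) (simp add: o_def case_prod_unfold)
  from has_sum_SigmaD[OF this, of "\<lambda>k. almost_prime_sum {p. prime p} k s"]
  have "((\<lambda>k. almost_prime_sum {p. prime p} k s) has_sum real_zeta s) UNIV"
    by (auto simp: almost_prime_sum_def intro!: has_sum_infsum summable_on_powr_nat assms)
  thus ?thesis by (rule has_sum_imp_sums)
qed

lemma summable_on_ln_euler_factor:
  assumes "s > 1" "\<And>p. p \<in> S \<Longrightarrow> prime p"
  shows "(\<lambda>p. ln (1 - real p powr (-s))) summable_on S"
proof (rule abs_summable_summable[OF Infinite_Sum.abs_summable_on_comparison_test'])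
  show "(\<lambda>p. 4 * real p powr (-s)) summable_on S"
    by (intro summable_on_cmult_right summable_on_powr_nat assms)
  fix p assume p: "p \<in> S"
  have "real p powr (-s) \<le> 1 / 2"
    by (rule powr_neg_le_inverse) (use assms(2)[OF p] assms(1) prime_ge_2_nat in auto)
  moreover have "real p powr (-s) \<ge> 0" by simp
  ultimately have "\<bar>ln (1 - real p powr (-s)) - (- (real p powr (-s)))\<bar> \<le> 2 * (real p powr (-s))\<^sup>2"
    using abs_ln_one_plus_x_minus_x_bound[of "- (real p powr (-s))"] by simp
  moreover have "(real p powr (-s))\<^sup>2 \<le> real p powr (-s) * 1"
    unfolding power2_eq_square by (rule mult_left_mono) (use \<open>real p powr (-s) \<le> 1 / 2\<close> in auto)
  ultimately show "norm (ln (1 - real p powr (-s))) \<le> 4 * real p powr (-s)"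
    using \<open>real p powr (-s) \<ge> 0\<close> by simp
qed

text \<open>Euler's product for zeta. The generating function over all primes, evaluated at z = 1,
  is zeta by regrouping and the exponential of the sum of logarithms by definition.\<close>

lemma ln_real_zeta:
  assumes "s > 1"
  shows "ln (real_zeta s) = - (\<Sum>\<^sub>\<infinity>p\<in>{p. prime p}. ln (1 - real p powr (-s)))"
proof -
  let ?S = "{p :: nat. prime p}"
  \<comment> \<open>The disc must contain z = 1, while its radius must stay below the smallest prime
    2.\<close>
  have prem: "0 < (3/2::real)" "(3/2::real) < 2" "1 \<le> (2::real)" by auto
  have p2: "real p \<ge> 2" if "p \<in> ?S" for p using that prime_ge_2_nat by auto
  have "(\<lambda>n. (deriv ^^ n) (euler_fun ?S s) 0 / fact n * (1 - 0) ^ n) sums euler_fun ?S s 1"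
    by (rule holomorphic_power_series[OF euler_fun_holomorphic[OF _ p2 prem assms]]) auto
  hence "(\<lambda>n. complex_of_real (almost_prime_sum ?S n s)) sums euler_fun ?S s 1"
    by (subst (asm) euler_fun_coeff[OF _ p2 prem assms]) auto
  moreover have "(\<lambda>n. complex_of_real (almost_prime_sum ?S n s)) sums of_real (real_zeta s)"
    using almost_prime_sum_sums_zeta[OF assms] by (simp add: sums_of_real_iff)
  ultimately have "euler_fun ?S s 1 = of_real (real_zeta s)" by (metis sums_unique2)
  moreover have "euler_fun ?S s 1 = of_real (exp (- (\<Sum>\<^sub>\<infinity>p\<in>?S. ln (1 - real p powr (-s)))))"
  proof -
    have "(\<Sum>\<^sub>\<infinity>p\<in>?S. Ln (1 - 1 * of_real (real p powr (-s)))) =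
          (\<Sum>\<^sub>\<infinity>p\<in>?S. complex_of_real (ln (1 - real p powr (-s))))"
    proof (rule infsum_cong)
      fix p assume "p \<in> ?S"
      hence "real p powr (-s) \<le> 1 / 2"
        by (intro powr_neg_le_inverse) (use assms prime_ge_2_nat in auto)
      hence "Ln (complex_of_real (1 - real p powr (-s))) = complex_of_real (ln (1 - real p powr (-s)))"
        by (intro Ln_of_real) auto
      thus "Ln (1 - 1 * of_real (real p powr (-s))) = complex_of_real (ln (1 - real p powr (-s)))"
        by simp
    qed
    also have "\<dots> = of_real (\<Sum>\<^sub>\<infinity>p\<in>?S. ln (1 - real p powr (-s)))"
      by (intro infsumI has_sum_of_real_iff[THEN iffD2] has_sum_infsum summable_on_ln_euler_factor assms) auto
    finally show ?thesis by (simp add: euler_fun_def exp_of_real[symmetric])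
  qed
  ultimately have "real_zeta s = exp (- (\<Sum>\<^sub>\<infinity>p\<in>?S. ln (1 - real p powr (-s))))"
    using of_real_eq_iff by metis
  thus ?thesis by simp
qed

text \<open>The subtracted quotient is $\int_{n+1}^{n+2} t^{-1-u}\,dt$.\<close>

definition zeta_defect :: "real \<Rightarrow> nat \<Rightarrow> real" where
  "zeta_defect u n = real (n+1) powr (-1-u) - (real (n+1) powr (-u) - real (n+2) powr (-u)) / u"

lemma zeta_defect_sums:
  assumes "u > 0"
  shows "zeta_defect u sums (real_zeta (1 + u) - 1 / u)"
proof -
  have "(\<lambda>n. real (n+1) powr (-u)) \<longlonglongrightarrow> 0" using assms by real_asymp
  from telescope_sums'[OF this]
  have "(\<lambda>n. real (n+1) powr (-u) - real (n+2) powr (-u)) sums 1" by simp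
  hence "(\<lambda>n. (real (n+1) powr (-u) - real (n+2) powr (-u)) / u) sums (1 / u)" by (rule sums_divide)
  moreover have "(\<lambda>n. real (n+1) powr (-1-u)) sums real_zeta (1 + u)"
    using real_zeta_sums[of "1 + u"] assms by (simp add: algebra_simps)
  ultimately show ?thesis unfolding zeta_defect_def[abs_def] by (intro sums_diff)
qed

text \<open>By the mean value theorem the subtracted quotient is a value of the decreasing function
  t^(-1-u) to the right of n+1. The sign gives zeta(1+u) >= 1/u, so u zeta(1+u) - 1 is nonnegative
  when its logarithm is expanded.\<close>

lemma zeta_defect_nonneg:
  assumes "u > 0" shows "zeta_defect u n \<ge> 0"
proof -
  define x where "x = real (n+1)"
  have x: "x \<ge> 1" by (simp add: x_def)
  have "\<exists>\<xi>>x. \<xi> < x + 1 \<and> - ((x+1) powr (-u)) / u - (- (x powr (-u)) / u) = (x + 1 - x) * \<xi> powr (-1-u)"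
  proof (rule MVT2)
    fix t assume t: "x \<le> t" "t \<le> x + 1"
    have "((\<lambda>t. - (t powr (-u)) / u) has_real_derivative - (-u * t powr (-u-1)) / u) (at t)"
      using t x by (auto intro!: derivative_eq_intros)
    moreover have "-u - 1 = -1-u" by simp
    ultimately show "((\<lambda>t. - (t powr (-u)) / u) has_real_derivative t powr (-1-u)) (at t)"
      using assms by simp
  qed auto
  then obtain \<xi> where \<xi>: "\<xi> > x" "(x powr (-u) - (x+1) powr (-u)) / u = \<xi> powr (-1-u)"
    by (auto simp: diff_divide_distrib)
  have "\<xi> powr (-1-u) \<le> x powr (-1-u)"
    using \<xi> x assms by (intro powr_mono2') auto
  thus ?thesis using \<xi> by (simp add: zeta_defect_def x_def add.commute add.left_commute)
qed

text \<open>As u tends to 0 the defect tends to 1/(n+1) - ln((n+2)/(n+1)), and these numbers sum to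
  Euler's constant. The error is linear in u and summable in n.\<close>

lemma zeta_defect_approx:
  assumes u: "u > 0"
  shows "\<bar>zeta_defect u n - (inverse (real (n+1)) + ln (real (n+1)) - ln (real (n+2)))\<bar>
           \<le> u * ((ln (real (n+2)) + 1) / (real (n+1))\<^sup>2)"
proof -
  define x where "x = real (n+1)"
  have x: "x \<ge> 1" by (simp add: x_def)
  \<comment> \<open>The quantity to bound is the integral of \<open>\<psi> x - \<psi> t\<close> over
    x <= t <= x + 1, realised as the increment of the antiderivative \<open>\<Psi>\<close>. One mean
    value theorem removes the integral, a second one bounds the variation of
    \<open>\<psi>\<close>.\<close>
  define \<psi> where "\<psi> = (\<lambda>t. t powr (-1-u) - 1 / t)"
  define \<Psi> where "\<Psi> = (\<lambda>t. \<psi> x * (t - x) + t powr (-u) / u + ln t)"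
  have "\<exists>\<xi>>x. \<xi> < x + 1 \<and> \<Psi> (x+1) - \<Psi> x = (x + 1 - x) * (\<psi> x - \<psi> \<xi>)"
  proof (rule MVT2)
    fix t assume t: "x \<le> t" "t \<le> x + 1"
    have "(\<Psi> has_real_derivative \<psi> x + (-u * t powr (-u-1)) / u + 1 / t) (at t)"
      unfolding \<Psi>_def using t x by (auto intro!: derivative_eq_intros)
    moreover have "-u - 1 = -1-u" by simp
    ultimately show "(\<Psi> has_real_derivative \<psi> x - \<psi> t) (at t)"
      using u by (simp add: \<psi>_def algebra_simps)
  qed auto
  then obtain \<xi> where \<xi>: "\<xi> > x" "\<xi> < x + 1" "\<Psi> (x+1) - \<Psi> x = \<psi> x - \<psi> \<xi>" by auto
  have "\<exists>\<eta>>x. \<eta> < \<xi> \<and> \<psi> \<xi> - \<psi> x = (\<xi> - x) * (1 / \<eta>\<^sup>2 - (1 + u) * \<eta> powr (-2-u))"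
  proof (rule MVT2)
    fix t assume t: "x \<le> t" "t \<le> \<xi>"
    have "(\<psi> has_real_derivative (-1-u) * t powr (-1-u-1) + 1 / t\<^sup>2) (at t)"
      unfolding \<psi>_def using t x by (auto intro!: derivative_eq_intros simp: power2_eq_square)
    moreover have "-1-u-1 = -2-u" by simp
    moreover have "(-1-u) * t powr (-2-u) + 1 / t\<^sup>2 = 1 / t\<^sup>2 - (1 + u) * t powr (-2-u)"
      by (simp add: algebra_simps)
    ultimately show "(\<psi> has_real_derivative 1 / t\<^sup>2 - (1 + u) * t powr (-2-u)) (at t)" by metis
  qed (use \<xi> in auto)
  then obtain \<eta> where \<eta>: "\<eta> > x" "\<eta> < \<xi>" "\<psi> \<xi> - \<psi> x = (\<xi> - x) * (1 / \<eta>\<^sup>2 - (1 + u) * \<eta> powr (-2-u))" by auto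
  have \<eta>0: "\<eta> > 1" using \<eta> x by simp
  \<comment> \<open>With 1/\<eta>^2 factored out, what remains is 1 - (1 + u) \<eta>^(-u), which is
    at most u (ln \<eta> + 1) in absolute value. This is the source of the factor u.\<close>
  have split: "1 / \<eta>\<^sup>2 - (1 + u) * \<eta> powr (-2-u) = (1 - (1 + u) * \<eta> powr (-u)) / \<eta>\<^sup>2"
  proof -
    have "\<eta> powr (-2-u) = \<eta> powr (-u) / \<eta>\<^sup>2"
      using \<eta>0 by (simp add: powr_diff powr_minus_divide powr_numeral)
    thus ?thesis by (simp add: diff_divide_distrib)
  qed
  have "\<eta> powr (-u) \<le> 1" using \<eta>0 u powr_mono[of "-u" 0 \<eta>] by simp
  moreover have "\<eta> powr (-u) \<ge> 1 - u * ln \<eta>"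
    using exp_ge_add_one_self[of "- (u * ln \<eta>)"] \<eta>0 by (simp add: powr_def)
  moreover have "u * \<eta> powr (-u) \<le> u * 1" by (rule mult_left_mono) (use calculation u in auto)
  moreover have "u * \<eta> powr (-u) \<ge> 0" "u * ln \<eta> \<ge> 0" using u \<eta>0 by auto
  moreover have "(1 + u) * \<eta> powr (-u) = \<eta> powr (-u) + u * \<eta> powr (-u)" by (simp add: algebra_simps)
  ultimately have "\<bar>1 - (1 + u) * \<eta> powr (-u)\<bar> \<le> u * ln \<eta> + u" by linarith
  also have "\<dots> = u * (ln \<eta> + 1)" by (simp add: algebra_simps)
  also have "\<dots> \<le> u * (ln (x + 1) + 1)"
    using u \<eta> \<xi> \<eta>0 by (intro mult_left_mono add_right_mono) auto
  finally have "\<bar>1 - (1 + u) * \<eta> powr (-u)\<bar> / \<eta>\<^sup>2 \<le> u * (ln (x + 1) + 1) / x\<^sup>2"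
    using \<eta> x u by (intro frac_le power_mono) auto
  moreover have "\<bar>\<psi> x - \<psi> \<xi>\<bar> \<le> 1 * (\<bar>1 - (1 + u) * \<eta> powr (-u)\<bar> / \<eta>\<^sup>2)"
  proof -
    have "\<bar>\<psi> x - \<psi> \<xi>\<bar> = \<bar>\<psi> \<xi> - \<psi> x\<bar>" by (rule abs_minus_commute)
    also have "\<dots> = (\<xi> - x) * (\<bar>1 - (1 + u) * \<eta> powr (-u)\<bar> / \<eta>\<^sup>2)"
      unfolding \<eta>(3) split using \<xi> by (simp add: abs_mult)
    also have "\<dots> \<le> 1 * (\<bar>1 - (1 + u) * \<eta> powr (-u)\<bar> / \<eta>\<^sup>2)"
      using \<xi> by (intro mult_right_mono) auto
    finally show ?thesis .
  qed
  moreover have "zeta_defect u n - (inverse (real (n+1)) + ln (real (n+1)) - ln (real (n+2))) = \<Psi> (x+1) - \<Psi> x"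
  proof -
    have e: "real (n+2) = x + 1" "real (n+1) = x" by (simp_all add: x_def)
    show ?thesis unfolding zeta_defect_def e \<Psi>_def \<psi>_def
      by (simp add: inverse_eq_divide diff_divide_distrib)
  qed
  moreover have "real (n+2) = x + 1" "real (n+1) = x" by (simp_all add: x_def)
  ultimately show ?thesis using \<xi>(3) by (simp only: mult_1 times_divide_eq_right)
qed

lemma real_zeta_expansion:
  obtains C where "C \<ge> 0"
    "\<And>u. u > 0 \<Longrightarrow> \<bar>real_zeta (1 + u) - 1 / u - euler_mascheroni\<bar> \<le> C * u"
    "\<And>u. u > 0 \<Longrightarrow> real_zeta (1 + u) \<ge> 1 / u"
proof
  let ?b = "\<lambda>n. (ln (real (n+2)) + 1) / (real (n+1))\<^sup>2"
  let ?e = "\<lambda>n. inverse (real (n+1)) + ln (real (n+1)) - ln (real (n+2))"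
  have sb: "summable ?b"
  proof (rule summable_comparison_test_bigo)
    show "summable (\<lambda>n. norm (real n powr (-3/2)))" by (simp add: summable_real_powr_iff)
    show "?b \<in> O(\<lambda>n. real n powr (-3/2))" by real_asymp
  qed
  show "suminf ?b \<ge> 0" by (rule suminf_nonneg[OF sb]) simp
  fix u :: real assume u: "u > 0"
  have d: "(\<lambda>n. zeta_defect u n - ?e n) sums (real_zeta (1 + u) - 1 / u - euler_mascheroni)"
    by (intro sums_diff zeta_defect_sums u) (use euler_mascheroni_sum_real in simp)
  have s: "(\<lambda>n. u * ?b n) sums (u * suminf ?b)"
    using sb by (intro sums_mult summable_sums)
  have "norm (\<Sum>n. zeta_defect u n - ?e n) \<le> (\<Sum>n. u * ?b n)"
  proof (rule norm_suminf_le)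
    show "norm (zeta_defect u n - ?e n) \<le> u * ?b n" for n
      using zeta_defect_approx[OF u, of n] by simp
    show "summable (\<lambda>n. u * ?b n)" using s by (rule sums_summable)
  qed
  thus "\<bar>real_zeta (1 + u) - 1 / u - euler_mascheroni\<bar> \<le> suminf ?b * u"
    using sums_unique[OF d] sums_unique[OF s] by (simp add: mult.commute)
  have "0 \<le> real_zeta (1 + u) - 1 / u"
    using sums_unique[OF zeta_defect_sums[OF u]] suminf_nonneg[OF sums_summable[OF zeta_defect_sums[OF u]] zeta_defect_nonneg[OF u]] by simp
  thus "real_zeta (1 + u) \<ge> 1 / u" by simp
qed

lemma ln_real_zeta_expansion:
  obtains C where "\<And>u. 0 < u \<Longrightarrow> u \<le> 1 \<Longrightarrow> \<bar>ln (u * real_zeta (1 + u)) - euler_mascheroni * u\<bar> \<le> C * u\<^sup>2"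
proof -
  obtain C where C: "C \<ge> 0"
    "\<And>u. u > 0 \<Longrightarrow> \<bar>real_zeta (1 + u) - 1 / u - euler_mascheroni\<bar> \<le> C * u"
    "\<And>u. u > 0 \<Longrightarrow> real_zeta (1 + u) \<ge> 1 / u" using real_zeta_expansion by blast
  \<comment> \<open>D u will bound x = u zeta(1+u) - 1, since x differs from gamma u by at most C
    u^2 <= C u.\<close>
  define D where "D = \<bar>euler_mascheroni :: real\<bar> + C"
  show ?thesis
  proof (rule that[of "C + D\<^sup>2"])
    fix u :: real assume u: "0 < u" "u \<le> 1"
    define x where "x = u * real_zeta (1 + u) - 1"
    have x0: "x \<ge> 0" using C(3)[of u] u by (simp add: x_def field_simps)
    have "x - euler_mascheroni * u = u * (real_zeta (1 + u) - 1 / u - euler_mascheroni)"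
      using u by (simp add: x_def algebra_simps)
    hence "\<bar>x - euler_mascheroni * u\<bar> = u * \<bar>real_zeta (1 + u) - 1 / u - euler_mascheroni\<bar>"
      using u by (simp add: abs_mult)
    also have "\<dots> \<le> u * (C * u)" using C(2)[of u] u by (intro mult_left_mono) auto
    finally have 1: "\<bar>x - euler_mascheroni * u\<bar> \<le> C * u\<^sup>2" by (simp add: power2_eq_square algebra_simps)
    have "C * u\<^sup>2 \<le> C * u" using u C(1) by (intro mult_left_mono) (auto simp: power2_eq_square mult_left_le)
    moreover have "\<bar>euler_mascheroni * u\<bar> = \<bar>euler_mascheroni\<bar> * u" using u by (simp add: abs_mult)
    moreover have "D * u = \<bar>euler_mascheroni\<bar> * u + C * u" by (simp add: D_def algebra_simps)
    ultimately have "x \<le> D * u" using 1 by linarith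
    hence x2: "x\<^sup>2 \<le> (D * u)\<^sup>2" using x0 by (intro power_mono) auto
    have "ln (1 + x) \<le> x" using x0 by (intro ln_add_one_self_le_self)
    moreover have "x - x\<^sup>2 \<le> ln (1 + x)"
    \<comment> \<open>The quadratic lower bound for the logarithm is available for x <= 1. Beyond
      that x - x^2 is negative while ln (1 + x) is nonnegative.\<close>
    proof (cases "x \<le> 1")
      case True thus ?thesis using x0 by (intro ln_one_plus_pos_lower_bound)
    next
      case False
      hence "x * 1 \<le> x * x" using x0 by (intro mult_left_mono) auto
      moreover have "ln (1 + x) \<ge> 0" using x0 by simp
      ultimately show ?thesis by (simp add: power2_eq_square)
    qed
    ultimately have "\<bar>ln (1 + x) - x\<bar> \<le> D\<^sup>2 * u\<^sup>2" using x2 by (simp add: power_mult_distrib)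
    hence "\<bar>ln (1 + x) - euler_mascheroni * u\<bar> \<le> D\<^sup>2 * u\<^sup>2 + C * u\<^sup>2" using 1 by linarith
    thus "\<bar>ln (u * real_zeta (1 + u)) - euler_mascheroni * u\<bar> \<le> (C + D\<^sup>2) * u\<^sup>2"
      by (simp add: x_def algebra_simps)
  qed
qed

section \<open>Expansion of the Euler factors\<close>

text \<open>Only real t between 0 and 1 occur, but the functions are complex. Taylor's theorem on
  the convex segment from 0 to 1 asks for the bound on the second derivative at these real points
  only.\<close>

lemma complex_Taylor2:
  fixes f f' f'' :: "complex \<Rightarrow> complex"
  assumes "\<And>t. 0 \<le> t \<Longrightarrow> t \<le> 1 \<Longrightarrow> (f has_field_derivative f' (of_real t)) (at (of_real t))"
    and "\<And>t. 0 \<le> t \<Longrightarrow> t \<le> 1 \<Longrightarrow> (f' has_field_derivative f'' (of_real t)) (at (of_real t))"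
    and "\<And>t. 0 \<le> t \<Longrightarrow> t \<le> 1 \<Longrightarrow> norm (f'' (of_real t)) \<le> B"
    and t: "0 \<le> t" "t \<le> 1"
  shows "norm (f (of_real t) - f 0 - of_real t * f' 0) \<le> B * t\<^sup>2"
proof -
  define g where "g = (\<lambda>i::nat. if i = 0 then f else if i = 1 then f' else f'')"
  let ?S = "complex_of_real ` {0..1}"
  have S: "?S = closed_segment 0 1"
    using closed_segment_of_real[of 0 1, where 'a = complex] by (simp add: closed_segment_eq_real_ivl)
  have "norm (g 0 (of_real t) - (\<Sum>i\<le>1. g i 0 * (of_real t - 0) ^ i / fact i)) \<le> B * norm (of_real t - 0 :: complex) ^ Suc 1 / fact 1"
  proof (rule complex_Taylor)
    show "convex ?S" unfolding S by simp
    fix i x assume x: "x \<in> ?S"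
    show "cmod (g (Suc 1) x) \<le> B" using x assms(3) by (auto simp: g_def)
    assume i: "i \<le> (1::nat)"
    hence "i = 0 \<or> i = 1" by auto
    thus "(g i has_field_derivative g (Suc i) x) (at x within ?S)"
    proof
      assume "i = 0"
      thus ?thesis using x assms(1) by (auto simp: g_def intro: has_field_derivative_at_within)
    next
      assume "i = 1"
      thus ?thesis using x assms(2) by (auto simp: g_def intro: has_field_derivative_at_within)
    qed
  qed (use t in auto)
  thus ?thesis using t by (simp add: g_def algebra_simps power2_eq_square)
qed

text \<open>\<open>X\<close> continues p^(-(1+u)) to complex u, so that complex derivatives in u are
  available. All estimates are made at real u >= 0, where |z X| <= |z|/p < 1.\<close>

context
  fixes p :: real and z :: complex and X :: "complex \<Rightarrow> complex"
  assumes p: "p > 1" and z: "norm z < p"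
  defines "X \<equiv> \<lambda>u. exp (- (1 + u) * of_real (ln p))"
begin

lemma euler_exp_of_real: "X (of_real t) = of_real (p powr (-(1 + t)))"
proof -
  have "- (1 + complex_of_real t) * of_real (ln p) = of_real (- (1 + t) * ln p)" by simp
  thus ?thesis using p unfolding X_def by (simp only: exp_of_real) (simp add: powr_def)
qed

lemma one_minus_euler_exp:
  assumes "t \<ge> 0"
  shows "norm (z * X (of_real t)) \<le> norm z / p" "1 - z * X (of_real t) \<noteq> 0"
    "1 - z * X (of_real t) \<notin> \<real>\<^sub>\<le>\<^sub>0"
proof -
  have "p powr (-(1 + t)) \<le> p powr (-1)" using assms p by (intro powr_mono) auto
  hence x: "p powr (-(1 + t)) \<le> 1 / p" using p by (simp add: powr_minus_divide)
  have "norm (z * X (of_real t)) = norm z * p powr (-(1 + t))"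
    by (simp add: euler_exp_of_real norm_mult)
  also have "\<dots> \<le> norm z * (1 / p)" by (intro mult_left_mono x) auto
  finally show 1: "norm (z * X (of_real t)) \<le> norm z / p" by simp
  also have "\<dots> < 1" using z p by simp
  finally have 2: "norm (z * X (of_real t)) < 1" .
  thus "1 - z * X (of_real t) \<noteq> 0" by (metis eq_iff_diff_eq_0 less_irrefl norm_one)
  show "1 - z * X (of_real t) \<notin> \<real>\<^sub>\<le>\<^sub>0" using 2 by (rule complex_one_minus_notin_nonpos_Reals)
qed

lemma Ln_euler_deriv1:
  assumes "t \<ge> 0"
  shows "((\<lambda>u. Ln (1 - z * X u)) has_field_derivative
           z * of_real (ln p) * X (of_real t) / (1 - z * X (of_real t))) (at (of_real t))"
proof -
  have X': "(X has_field_derivative - of_real (ln p) * X (of_real t)) (at (of_real t))"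
    unfolding X_def by (auto intro!: derivative_eq_intros)
  have "((\<lambda>u. 1 - z * X u) has_field_derivative - (z * (- of_real (ln p) * X (of_real t)))) (at (of_real t))"
    by (rule derivative_eq_intros X' refl | simp)+
  from DERIV_chain2[OF has_field_derivative_Ln[OF one_minus_euler_exp(3)[OF assms]] this]
  show ?thesis by (rule DERIV_cong) (simp add: divide_inverse algebra_simps)
qed

lemma Ln_euler_deriv2:
  assumes "t \<ge> 0"
  shows "((\<lambda>u. z * of_real (ln p) * X u / (1 - z * X u)) has_field_derivative
           - z * of_real (ln p) ^ 2 * X (of_real t) / (1 - z * X (of_real t))\<^sup>2) (at (of_real t))"
proof -
  have X': "(X has_field_derivative - of_real (ln p) * X (of_real t)) (at (of_real t))"
    unfolding X_def by (auto intro!: derivative_eq_intros)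
  have "((\<lambda>u. z * of_real (ln p) * X u / (1 - z * X u)) has_field_derivative
     ((z * of_real (ln p) * (- of_real (ln p) * X (of_real t))) * (1 - z * X (of_real t)) -
      z * of_real (ln p) * X (of_real t) * (- (z * (- of_real (ln p) * X (of_real t))))) /
     ((1 - z * X (of_real t)) * (1 - z * X (of_real t)))) (at (of_real t))"
    by (rule derivative_eq_intros X' one_minus_euler_exp(2)[OF assms] refl | simp)+
  thus ?thesis
    by (rule DERIV_cong) (simp add: power2_eq_square algebra_simps)
qed

end

text \<open>The contribution of one prime above y to log K_u(z). The parts linear in p^(-(1+u))
  cancel, which leaves a term of size p^(-2) even at u = 0. Its u-derivative at u = 0 is
  \<open>prime_term_deriv\<close>.\<close>

definition prime_term :: "real \<Rightarrow> real \<Rightarrow> complex \<Rightarrow> complex" where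
  "prime_term p u z = - Ln (1 - z * of_real (p powr (-(1 + u)))) + z * Ln (1 - of_real (p powr (-(1 + u))))"

definition prime_term_deriv :: "real \<Rightarrow> complex \<Rightarrow> complex" where
  "prime_term_deriv p z = z * of_real (ln p) * (1 / (of_real p - 1) - 1 / (of_real p - z))"

lemma euler_exp_0: "(p::real) > 0 \<Longrightarrow> exp (- (1 + 0) * complex_of_real (ln p)) = 1 / of_real p"
  by (simp add: exp_minus exp_of_real inverse_eq_divide)

text \<open>The case z = 1 of the complex derivatives above, read on the reals. The constant 4 is
  (1/2)^(-2), from |1 - p^(-(1+u))| >= 1/2 for p >= 2.\<close>

lemma ln_euler_expansion:
  fixes p u :: real
  assumes p: "p \<ge> 2" and u: "0 \<le> u" "u \<le> 1"
  shows "\<bar>ln (1 - p powr (-(1 + u))) - ln (1 - 1 / p) - u * (ln p / (p - 1))\<bar> \<le> 4 * (ln p)\<^sup>2 * u\<^sup>2"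
proof -
  define X where "X = (\<lambda>u. exp (- (1 + u) * complex_of_real (ln p)))"
  have p1: "p > 1" "norm (1::complex) < p" using p by auto
  have X_real: "X (of_real t) = of_real (p powr (-(1 + t)))" for t
    unfolding X_def by (rule euler_exp_of_real[OF p1])
  have "norm (Ln (1 - 1 * X (of_real u)) - Ln (1 - 1 * X 0) -
          of_real u * (1 * of_real (ln p) * X 0 / (1 - 1 * X 0))) \<le> 4 * (ln p)\<^sup>2 * u\<^sup>2"
  proof (rule complex_Taylor2)
    fix t :: real assume t: "0 \<le> t" "t \<le> 1"
    have "norm (1 * X (of_real t)) \<le> norm (1::complex) / p"
      unfolding X_def by (rule one_minus_euler_exp(1)[OF p1 t(1)])
    also have "\<dots> \<le> 1 / 2" using p by simp
    finally have n: "norm (X (of_real t)) \<le> 1 / 2" by simp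
    have "norm (1 - X (of_real t)) \<ge> 1 / 2"
      using n norm_triangle_ineq2[of 1 "X (of_real t)"] by simp
    hence "norm (1 - X (of_real t)) ^ 2 \<ge> (1 / 2) ^ 2" by (intro power_mono) auto
    hence "(ln p)\<^sup>2 * norm (X (of_real t)) / norm (1 - X (of_real t)) ^ 2 \<le> (ln p)\<^sup>2 * 1 / (1 / 2) ^ 2"
      using n by (intro frac_le mult_left_mono) auto
    thus "norm (- 1 * of_real (ln p) ^ 2 * X (of_real t) / (1 - 1 * X (of_real t))\<^sup>2) \<le> 4 * (ln p)\<^sup>2"
      by (simp add: norm_divide norm_mult norm_power power_divide)
    show "((\<lambda>u. Ln (1 - 1 * X u)) has_field_derivative
           1 * of_real (ln p) * X (of_real t) / (1 - 1 * X (of_real t))) (at (of_real t))"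
      unfolding X_def by (rule Ln_euler_deriv1[OF p1 t(1)])
    show "((\<lambda>u. 1 * of_real (ln p) * X u / (1 - 1 * X u)) has_field_derivative
           - 1 * of_real (ln p) ^ 2 * X (of_real t) / (1 - 1 * X (of_real t))\<^sup>2) (at (of_real t))"
      unfolding X_def by (rule Ln_euler_deriv2[OF p1 t(1)])
  qed (use u in auto)
  moreover have "Ln (1 - 1 * X (of_real u)) = of_real (ln (1 - p powr (-(1 + u))))"
  proof -
    have "p powr (-(1 + u)) \<le> p powr (-1)" using u p by (intro powr_mono) auto
    also have "\<dots> < 1" using p by (simp add: powr_minus_divide)
    finally have "Ln (of_real (1 - p powr (-(1 + u)))) = complex_of_real (ln (1 - p powr (-(1 + u))))"
      by (intro Ln_of_real) auto
    thus ?thesis by (simp only: of_real_diff of_real_1 mult_1 X_real)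
  qed
  moreover have X0: "X 0 = 1 / of_real p" unfolding X_def by (rule euler_exp_0) (use p in auto)
  moreover have "Ln (1 - 1 * (1 / of_real p)) = of_real (ln (1 - 1 / p))"
    using p by (subst Ln_of_real[symmetric]) auto
  moreover have "1 * of_real (ln p) * (1 / of_real p) / (1 - 1 * (1 / of_real p)) = complex_of_real (ln p / (p - 1))"
    using p by (simp add: divide_simps)
  ultimately have "norm (of_real (ln (1 - p powr (-(1 + u)))) - complex_of_real (ln (1 - 1 / p)) -
      of_real u * of_real (ln p / (p - 1))) \<le> 4 * (ln p)\<^sup>2 * u\<^sup>2"
    by (simp only:)
  hence "norm (complex_of_real (ln (1 - p powr (-(1 + u))) - ln (1 - 1 / p) - u * (ln p / (p - 1)))) \<le> 4 * (ln p)\<^sup>2 * u\<^sup>2"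
    by (simp only: of_real_diff of_real_mult)
  thus ?thesis by (simp only: norm_of_real)
qed

context
  fixes p :: real and z :: complex
  assumes p: "p \<ge> 5" and z: "norm z \<le> 4"
begin

text \<open>The second u-derivative of each single logarithm has size (ln p)^2 / p, too large to be
  summed over primes. Their combination gains a further factor 1/p.\<close>

lemma prime_term_expansion:
  assumes u: "0 \<le> u" "u \<le> 1"
  shows "norm (prime_term p u z - prime_term p 0 z - of_real u * prime_term_deriv p z) \<le> 4000 * (ln p)\<^sup>2 / p\<^sup>2 * u\<^sup>2"
proof -
  define X where "X = (\<lambda>u. exp (- (1 + u) * complex_of_real (ln p)))"
  have p1: "p > 1" "norm (1::complex) < p" "norm z < p" using p z by auto
  have X_real: "X (of_real t) = of_real (p powr (-(1 + t)))" for t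
    unfolding X_def by (rule euler_exp_of_real[OF p1(1,2)])
  let ?f = "\<lambda>u. - Ln (1 - z * X u) + z * Ln (1 - 1 * X u)"
  let ?f' = "\<lambda>u. - (z * of_real (ln p) * X u / (1 - z * X u)) + z * (1 * of_real (ln p) * X u / (1 - 1 * X u))"
  let ?f'' = "\<lambda>u. - (- z * of_real (ln p) ^ 2 * X u / (1 - z * X u)\<^sup>2) + z * (- 1 * of_real (ln p) ^ 2 * X u / (1 - 1 * X u)\<^sup>2)"
  have "norm (?f (of_real u) - ?f 0 - of_real u * ?f' 0) \<le> 4000 * (ln p)\<^sup>2 / p\<^sup>2 * u\<^sup>2"
  proof (rule complex_Taylor2)
    fix t :: real assume t: "0 \<le> t" "t \<le> 1"
    have n: "norm (1 * X (of_real t)) \<le> norm (1::complex) / p" "norm (z * X (of_real t)) \<le> norm z / p"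
      unfolding X_def by (rule one_minus_euler_exp(1)[OF p1(1,2) t(1)], rule one_minus_euler_exp(1)[OF p1(1,3) t(1)])
    have nz: "1 - 1 * X (of_real t) \<noteq> 0" "1 - z * X (of_real t) \<noteq> 0"
      unfolding X_def by (rule one_minus_euler_exp(2)[OF p1(1,2) t(1)], rule one_minus_euler_exp(2)[OF p1(1,3) t(1)])
    have n1: "norm (X (of_real t)) \<le> 1 / p" using n(1) by simp
    also have p5: "1 / p \<le> 1 / 5" using p by simp
    finally have n1': "norm (X (of_real t)) \<le> 1 / 5" .
    have "norm z / p \<le> 4 / 5" by (rule frac_le) (use p z in auto)
    hence n2: "norm (z * X (of_real t)) \<le> 4 / 5" using n(2) by linarith
    let ?x = "X (of_real t)"
    have d1: "norm (1 - ?x) \<ge> 4 / 5" using n1' norm_triangle_ineq2[of 1 ?x] by simp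
    have d2: "norm (1 - z * ?x) \<ge> 1 / 5" using n2 norm_triangle_ineq2[of 1 "z * ?x"] by simp
    \<comment> \<open>Over the common denominator the numerator acquires the factor x (z - 1).
      Together with the x already present this gives x^2, hence 1/p^2.\<close>
    have eq: "?f'' (of_real t) = z * of_real (ln p) ^ 2 * ?x\<^sup>2 * (z - 1) * (2 - ?x - z * ?x) / ((1 - z * ?x)\<^sup>2 * (1 - ?x)\<^sup>2)"
    proof -
      have "?f'' (of_real t) = z * of_real (ln p) ^ 2 * ?x * (1 / (1 - z * ?x)\<^sup>2 - 1 / (1 - ?x)\<^sup>2)"
        by (simp add: algebra_simps)
      also have "1 / (1 - z * ?x)\<^sup>2 - 1 / (1 - ?x)\<^sup>2 = ((1 - ?x)\<^sup>2 - (1 - z * ?x)\<^sup>2) / ((1 - z * ?x)\<^sup>2 * (1 - ?x)\<^sup>2)"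
        using nz by (simp add: diff_frac_eq)
      also have "(1 - ?x)\<^sup>2 - (1 - z * ?x)\<^sup>2 = ?x * (z - 1) * (2 - ?x - z * ?x)"
        by (simp add: power2_eq_square algebra_simps)
      finally show ?thesis by (simp add: power2_eq_square algebra_simps)
    qed
    have "norm (z - 1) \<le> 5" using norm_triangle_ineq4[of z 1] z by simp
    moreover have "norm (2 - ?x - z * ?x) \<le> 3"
      using norm_triangle_ineq4[of "2 - ?x" "z * ?x"] norm_triangle_ineq4[of 2 ?x] n1' n2 by simp
    moreover have "norm ?x ^ 2 \<le> (1 / p) ^ 2" using n1 by (intro power_mono) auto
    moreover have "norm (1 - z * ?x) ^ 2 \<ge> (1 / 5) ^ 2" "norm (1 - ?x) ^ 2 \<ge> (4 / 5) ^ 2"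
      using d1 d2 by (intro power_mono; simp)+
    ultimately have "norm z * (ln p)\<^sup>2 * norm ?x ^ 2 * norm (z - 1) * norm (2 - ?x - z * ?x) / (norm (1 - z * ?x) ^ 2 * norm (1 - ?x) ^ 2)
       \<le> 4 * (ln p)\<^sup>2 * (1 / p) ^ 2 * 5 * 3 / ((1 / 5) ^ 2 * (4 / 5) ^ 2)"
      using z by (intro frac_le mult_mono) auto
    \<comment> \<open>The bounds 4, 5, 3 are those of |z|, |z - 1| and |2 - x - z x|; the
      denominators are squares of numbers at least 1/5 and 4/5. The value 2343.75 is rounded up to
      4000.\<close>
    also have "\<dots> = 60 * 625 / 16 * ((ln p)\<^sup>2 / p\<^sup>2)" by (simp add: power_divide)
    also have "\<dots> \<le> 4000 * ((ln p)\<^sup>2 / p\<^sup>2)" by (intro mult_right_mono) auto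
    finally show "norm (?f'' (of_real t)) \<le> 4000 * (ln p)\<^sup>2 / p\<^sup>2"
      unfolding eq by (simp add: norm_divide norm_mult norm_power)
    show "(?f has_field_derivative ?f' (of_real t)) (at (of_real t))"
      unfolding X_def
      by (intro DERIV_add DERIV_minus DERIV_cmult Ln_euler_deriv1[OF p1(1,2) t(1)] Ln_euler_deriv1[OF p1(1,3) t(1)])
    show "(?f' has_field_derivative ?f'' (of_real t)) (at (of_real t))"
      unfolding X_def
      by (intro DERIV_add DERIV_minus DERIV_cmult Ln_euler_deriv2[OF p1(1,2) t(1)] Ln_euler_deriv2[OF p1(1,3) t(1)])
  qed (use u in auto)
  moreover have "?f (of_real t) = prime_term p t z" for t
    by (simp only: prime_term_def X_real mult_1)
  from this[of u] this[of 0] have "?f (of_real u) = prime_term p u z" "?f 0 = prime_term p 0 z"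
    by simp_all
  moreover have "?f' 0 = prime_term_deriv p z"
  proof -
    have X0: "X 0 = 1 / of_real p" unfolding X_def by (rule euler_exp_0) (use p in auto)
    have nz: "complex_of_real p \<noteq> z" "complex_of_real p \<noteq> 1" "p \<noteq> 0" using p z by auto
    have "z * of_real (ln p) * (1 / of_real p) / (1 - z * (1 / of_real p)) = z * of_real (ln p) / (of_real p - z)"
      "1 * of_real (ln p) * (1 / of_real p) / (1 - 1 * (1 / of_real p)) = complex_of_real (ln p) / (of_real p - 1)"
      using nz by (simp_all add: divide_simps)
    thus ?thesis unfolding X0 prime_term_deriv_def by (simp add: algebra_simps)
  qed
  ultimately show ?thesis by simp
qed

text \<open>Once z x is removed from both logarithms, with x = p^(-(1+u)), each is of second order:
  at most 80 |x|^2 for the first and 5 |x|^2 for the second.\<close>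

lemma norm_prime_term_le:
  assumes u: "0 \<le> u"
  shows "norm (prime_term p u z) \<le> 100 / p\<^sup>2"
proof -
  define x where "x = complex_of_real (p powr (-(1 + u)))"
  have "p powr (-(1 + u)) \<le> p powr (-1)" using u p by (intro powr_mono) auto
  hence x: "norm x \<le> 1 / p" using p by (simp add: x_def powr_minus_divide)
  also have "\<dots> \<le> 1 / 5" using p by simp
  finally have x5: "norm x \<le> 1 / 5" .
  have zx: "norm (z * x) \<le> 4 * norm x" unfolding norm_mult using z by (intro mult_right_mono) auto
  have "norm (Ln (1 + (- (z * x))) - (- (z * x))) \<le> norm (- (z * x)) ^ 2 / (1 - norm (- (z * x)))"
    by (rule Ln_approx_linear) (use zx x5 in simp)
  also have "\<dots> \<le> (4 * norm x) ^ 2 / (1 / 5)"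
    by (intro frac_le power_mono) (use zx x5 in auto)
  finally have 1: "norm (Ln (1 - z * x) + z * x) \<le> 80 * norm x ^ 2" by (simp add: power_mult_distrib)
  have "norm (Ln (1 + (- x)) - (- x)) \<le> norm (- x) ^ 2 / (1 - norm (- x))"
    by (rule Ln_approx_linear) (use x5 in simp)
  also have "\<dots> \<le> norm x ^ 2 / (4 / 5)"
    by (intro frac_le power_mono) (use x5 in auto)
  finally have "norm (Ln (1 - x) + x) \<le> 5 / 4 * norm x ^ 2" by simp
  hence "norm z * norm (Ln (1 - x) + x) \<le> 4 * (5 / 4 * norm x ^ 2)" using z by (intro mult_mono) auto
  hence 2: "norm (z * (Ln (1 - x) + x)) \<le> 5 * norm x ^ 2" by (simp add: norm_mult)
  have "prime_term p u z = z * (Ln (1 - x) + x) - (Ln (1 - z * x) + z * x)"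
    unfolding prime_term_def x_def[symmetric] by (simp add: algebra_simps)
  hence "norm (prime_term p u z) \<le> 85 * norm x ^ 2"
    using norm_triangle_ineq4[of "z * (Ln (1 - x) + x)" "Ln (1 - z * x) + z * x"] 1 2 by simp
  also have "\<dots> \<le> 100 * (1 / p) ^ 2" by (intro mult_mono power_mono x) auto
  finally show ?thesis by (simp add: power_divide)
qed

text \<open>The same cancellation as before: 1/(p-1) - 1/(p-z) has numerator 1 - z and a denominator
  of size p^2. The constant is 20 divided by 4/25.\<close>

lemma norm_prime_term_deriv_le: "norm (prime_term_deriv p z) \<le> 125 * ln p / p\<^sup>2"
proof -
  have nz: "complex_of_real p \<noteq> z" "complex_of_real p \<noteq> 1" using p z by auto
  have "prime_term_deriv p z = z * (1 - z) * of_real (ln p) / ((of_real p - 1) * (of_real p - z))"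
    unfolding prime_term_deriv_def using nz by (simp add: diff_frac_eq)
  hence "norm (prime_term_deriv p z) = norm z * norm (1 - z) * ln p / (norm (complex_of_real p - 1) * norm (of_real p - z))"
    using p by (simp add: norm_mult norm_divide)
  also have "\<dots> \<le> 4 * 5 * ln p / (4 / 5 * p * (1 / 5 * p))"
  proof (intro frac_le mult_mono)
    show "norm (1 - z) \<le> 5" using norm_triangle_ineq4[of 1 z] z by simp
    show "4 / 5 * p \<le> norm (complex_of_real p - 1)"
      using norm_triangle_ineq2[of "complex_of_real p" 1] p by simp
    show "1 / 5 * p \<le> norm (complex_of_real p - z)"
      using norm_triangle_ineq2[of "complex_of_real p" z] p z by simp
  qed (use p z in auto)
  also have "\<dots> = 125 * ln p / p\<^sup>2" by (simp add: power2_eq_square)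
  finally show ?thesis .
qed

end

section \<open>The logarithm of the Euler product\<close>

text \<open>The exponent -3/2 leaves room for the powers of the logarithm in majorants such as (ln
  p)^2 / p^2.\<close>

lemma summable_on_nat_bigo:
  fixes f :: "nat \<Rightarrow> real"
  assumes "f \<in> O(\<lambda>n. real n powr (-3/2))"
  shows "f summable_on A"
proof -
  have "summable (\<lambda>n. norm (real n powr (-3/2)))" by (simp add: summable_real_powr_iff)
  moreover have "(\<lambda>n. norm (f n)) \<in> O(\<lambda>n. real n powr (-3/2))" using assms by simp
  ultimately have "summable (\<lambda>n. norm (f n))" by (rule summable_comparison_test_bigo)
  hence "f summable_on UNIV" by (rule norm_summable_imp_summable_on)
  thus ?thesis by (rule summable_on_subset_banach) simp
qed

lemma norm_infsum_le_infsum: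
  fixes f :: "'a \<Rightarrow> 'b :: banach"
  assumes "g summable_on A" "\<And>x. x \<in> A \<Longrightarrow> norm (f x) \<le> g x"
  shows "f summable_on A" "norm (infsum f A) \<le> infsum g A"
proof -
  show 1: "f summable_on A"
    by (rule abs_summable_summable[OF Infinite_Sum.abs_summable_on_comparison_test'[OF assms]])
  show "norm (infsum f A) \<le> infsum g A"
    by (rule norm_infsum_le[OF has_sum_infsum[OF 1] has_sum_infsum[OF assms(1)] assms(2)])
qed

lemma has_sum_diff:
  fixes f g :: "'a \<Rightarrow> 'b :: real_normed_vector"
  assumes "(f has_sum a) A" "(g has_sum b) A"
  shows "((\<lambda>x. f x - g x) has_sum (a - b)) A"
  using has_sum_add[OF assms(1), of "\<lambda>x. - g x" "- b"] assms(2) by (simp add: has_sum_uminus)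

definition prime_sum :: "nat set \<Rightarrow> real \<Rightarrow> complex \<Rightarrow> complex" where
  "prime_sum S u z = (\<Sum>\<^sub>\<infinity>p\<in>S. prime_term (real p) u z)"

definition prime_sum_deriv :: "nat set \<Rightarrow> complex \<Rightarrow> complex" where
  "prime_sum_deriv S z = (\<Sum>\<^sub>\<infinity>p\<in>S. prime_term_deriv (real p) z)"

context
  fixes S :: "nat set"
  assumes S: "\<And>p. p \<in> S \<Longrightarrow> p \<ge> 5"
begin

lemma prime_term_summable:
  assumes "norm z \<le> 4" "u \<ge> 0"
  shows "(\<lambda>p. prime_term (real p) u z) summable_on S"
    and "norm (prime_sum S u z) \<le> (\<Sum>\<^sub>\<infinity>p\<in>S. 100 / (real p)\<^sup>2)"
proof -
  have s: "(\<lambda>p::nat. 100 / (real p)\<^sup>2) summable_on S"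
    by (rule summable_on_nat_bigo) real_asymp
  have b: "norm (prime_term (real p) u z) \<le> 100 / (real p)\<^sup>2" if "p \<in> S" for p
    by (rule norm_prime_term_le) (use S[OF that] assms in auto)
  show "(\<lambda>p. prime_term (real p) u z) summable_on S" "norm (prime_sum S u z) \<le> (\<Sum>\<^sub>\<infinity>p\<in>S. 100 / (real p)\<^sup>2)"
    unfolding prime_sum_def using norm_infsum_le_infsum[OF s b] by simp_all
qed

lemma prime_term_deriv_summable:
  assumes "norm z \<le> 4"
  shows "(\<lambda>p. prime_term_deriv (real p) z) summable_on S"
    and "norm (prime_sum_deriv S z) \<le> (\<Sum>\<^sub>\<infinity>p\<in>S. 125 * ln (real p) / (real p)\<^sup>2)"
proof -
  have s: "(\<lambda>p::nat. 125 * ln (real p) / (real p)\<^sup>2) summable_on S"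
    by (rule summable_on_nat_bigo) real_asymp
  have b: "norm (prime_term_deriv (real p) z) \<le> 125 * ln (real p) / (real p)\<^sup>2" if "p \<in> S" for p
    by (rule norm_prime_term_deriv_le) (use S[OF that] assms in auto)
  show "(\<lambda>p. prime_term_deriv (real p) z) summable_on S"
    "norm (prime_sum_deriv S z) \<le> (\<Sum>\<^sub>\<infinity>p\<in>S. 125 * ln (real p) / (real p)\<^sup>2)"
    unfolding prime_sum_deriv_def using norm_infsum_le_infsum[OF s b] by simp_all
qed

lemma prime_sum_expansion:
  assumes z: "norm z \<le> 4" and u: "0 \<le> u" "u \<le> 1"
  shows "norm (prime_sum S u z - prime_sum S 0 z - of_real u * prime_sum_deriv S z)
           \<le> (\<Sum>\<^sub>\<infinity>p\<in>S. 4000 * (ln (real p))\<^sup>2 / (real p)\<^sup>2) * u\<^sup>2"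
proof -
  have "(\<lambda>p::nat. 4000 * (ln (real p))\<^sup>2 / (real p)\<^sup>2) summable_on S"
    by (rule summable_on_nat_bigo) real_asymp
  hence s: "((\<lambda>p::nat. 4000 * (ln (real p))\<^sup>2 / (real p)\<^sup>2 * u\<^sup>2) has_sum
              (\<Sum>\<^sub>\<infinity>p\<in>S. 4000 * (ln (real p))\<^sup>2 / (real p)\<^sup>2) * u\<^sup>2) S"
    by (intro has_sum_cmult_left has_sum_infsum)
  have b: "norm (prime_term (real p) u z - prime_term (real p) 0 z - of_real u * prime_term_deriv (real p) z)
             \<le> 4000 * (ln (real p))\<^sup>2 / (real p)\<^sup>2 * u\<^sup>2" if "p \<in> S" for p
    by (rule prime_term_expansion) (use S[OF that] z u in auto)
  have d: "((\<lambda>p. prime_term (real p) u z - prime_term (real p) 0 z - of_real u * prime_term_deriv (real p) z) has_sum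
          (prime_sum S u z - prime_sum S 0 z - of_real u * prime_sum_deriv S z)) S"
    unfolding prime_sum_def prime_sum_deriv_def
    by (intro has_sum_diff has_sum_cmult_right has_sum_infsum prime_term_summable prime_term_deriv_summable)
       (use z u in auto)
  show ?thesis by (rule norm_infsum_le[OF d s b])
qed

lemma prime_sum_holomorphic:
  assumes "u \<ge> 0"
  shows "prime_sum S u holomorphic_on ball 0 4"
  unfolding prime_sum_def
proof (rule holomorphic_on_infsum)
  show "(\<lambda>p::nat. 100 / (real p)\<^sup>2) summable_on S"
    by (rule summable_on_nat_bigo) real_asymp
  fix p assume p: "p \<in> S"
  show "norm (prime_term (real p) u z) \<le> 100 / (real p)\<^sup>2" if "z \<in> ball 0 4" for z
    by (rule norm_prime_term_le) (use S[OF p] that assms in auto)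
  have x: "real p powr (-(1 + u)) \<le> 1 / 5"
    using S[OF p] assms by (intro powr_neg_le_inverse) auto
  have "1 - z * complex_of_real (real p powr (-(1 + u))) \<notin> \<real>\<^sub>\<le>\<^sub>0" if "z \<in> ball 0 4" for z
  proof (rule complex_one_minus_notin_nonpos_Reals)
    have "norm z * real p powr (-(1 + u)) \<le> 4 * (1 / 5)"
      using that by (intro mult_mono x) auto
    thus "norm (z * complex_of_real (real p powr (-(1 + u)))) < 1" by (simp only: norm_mult norm_of_real abs_of_nonneg powr_ge_zero)
  qed
  thus "prime_term (real p) u holomorphic_on ball 0 4"
    unfolding prime_term_def[abs_def] by (intro holomorphic_intros) auto
qed auto

lemma prime_sum_deriv_holomorphic: "prime_sum_deriv S holomorphic_on ball 0 4"
  unfolding prime_sum_deriv_def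
proof (rule holomorphic_on_infsum)
  show "(\<lambda>p::nat. 125 * ln (real p) / (real p)\<^sup>2) summable_on S"
    by (rule summable_on_nat_bigo) real_asymp
  fix p assume p: "p \<in> S"
  show "norm (prime_term_deriv (real p) z) \<le> 125 * ln (real p) / (real p)\<^sup>2" if "z \<in> ball 0 4" for z
    by (rule norm_prime_term_deriv_le) (use S[OF p] that in auto)
  have "complex_of_real (real p) - z \<noteq> 0" if "z \<in> ball 0 4" for z
    using S[OF p] that by auto
  thus "prime_term_deriv (real p) holomorphic_on ball 0 4"
    unfolding prime_term_deriv_def[abs_def] by (intro holomorphic_intros) auto
qed auto

end

text \<open>The factor of z in log K_u(z), beside the sum over p > y in \<open>prime_sum\<close>. By
  Euler's product it equals ln u minus the sum of ln (1 - p^(-(1+u))) over p > y; it stays bounded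
  as u tends to 0 although both of these diverge.\<close>

definition small_prime_log :: "nat \<Rightarrow> real \<Rightarrow> real" where
  "small_prime_log y u = ln (u * real_zeta (1 + u)) + (\<Sum>p | prime p \<and> p \<le> y. ln (1 - real p powr (-(1 + u))))"

lemma small_prime_log_expansion:
  obtains C where "C \<ge> 0" "\<And>u. 0 < u \<Longrightarrow> u \<le> 1 \<Longrightarrow>
    \<bar>small_prime_log y u - (\<Sum>p | prime p \<and> p \<le> y. ln (1 - 1 / real p)) -
       u * (euler_mascheroni + (\<Sum>p | prime p \<and> p \<le> y. ln (real p) / (real p - 1)))\<bar> \<le> C * u\<^sup>2"
proof -
  obtain C where C: "\<And>u. 0 < u \<Longrightarrow> u \<le> 1 \<Longrightarrow> \<bar>ln (u * real_zeta (1 + u)) - euler_mascheroni * u\<bar> \<le> C * u\<^sup>2"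
    using ln_real_zeta_expansion by blast
  let ?P = "{p. prime p \<and> p \<le> y}"
  define D where "D = C + (\<Sum>p\<in>?P. 4 * (ln (real p))\<^sup>2)"
  have main: "\<bar>small_prime_log y u - (\<Sum>p\<in>?P. ln (1 - 1 / real p)) -
       u * (euler_mascheroni + (\<Sum>p\<in>?P. ln (real p) / (real p - 1)))\<bar> \<le> D * u\<^sup>2" if u: "0 < u" "u \<le> 1" for u
  proof -
    have "\<bar>(\<Sum>p\<in>?P. ln (1 - real p powr (-(1 + u))) - ln (1 - 1 / real p) - u * (ln (real p) / (real p - 1)))\<bar>
           \<le> (\<Sum>p\<in>?P. 4 * (ln (real p))\<^sup>2 * u\<^sup>2)"
      by (intro order_trans[OF sum_abs] sum_mono ln_euler_expansion) (use u prime_ge_2_nat in auto)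
    hence "\<bar>(\<Sum>p\<in>?P. ln (1 - real p powr (-(1 + u)))) - (\<Sum>p\<in>?P. ln (1 - 1 / real p)) - u * (\<Sum>p\<in>?P. ln (real p) / (real p - 1))\<bar>
           \<le> (\<Sum>p\<in>?P. 4 * (ln (real p))\<^sup>2) * u\<^sup>2"
      by (simp only: sum_subtractf sum_distrib_left sum_distrib_right)
    thus ?thesis using C[OF u] unfolding small_prime_log_def D_def distrib_left distrib_right mult.commute[of u euler_mascheroni]
      by linarith
  qed
  show ?thesis
  proof (rule that[of "max D 0"])
    fix u :: real assume u: "0 < u" "u \<le> 1"
    have "D * u\<^sup>2 \<le> max D 0 * u\<^sup>2" by (intro mult_right_mono) auto
    with main[OF u] show "\<bar>small_prime_log y u - (\<Sum>p\<in>?P. ln (1 - 1 / real p)) -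
       u * (euler_mascheroni + (\<Sum>p\<in>?P. ln (real p) / (real p - 1)))\<bar> \<le> max D 0 * u\<^sup>2" by linarith
  qed auto
qed


text \<open>Skipping 4 is what makes the disc of radius 4 available: |z|/p <= 4/5 for all primes in
  play.\<close>

lemma rough_prime_ge_5:
  assumes "prime (p::nat)" "p > 3" shows "p \<ge> 5"
proof -
  have "p \<noteq> 4" using assms(1) by auto
  with assms(2) show ?thesis by simp
qed

text \<open>Each -Ln (1 - z p^(-s)) is \<open>prime_term\<close> minus z ln (1 - p^(-s)). The sum of
  the second parts is known from zeta and supplies both u^(-z) and the exponent z
  \<open>small_prime_log\<close>.\<close>

lemma euler_fun_eq_exp_mult:
  assumes y: "y \<ge> 3" and u: "0 < u" and z: "norm z \<le> 4"
  shows "euler_fun {p. prime p \<and> p > y} (1 + u) z =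
           exp (of_real (- ln u) * z) * exp (z * of_real (small_prime_log y u) + prime_sum {p. prime p \<and> p > y} u z)"
proof -
  let ?S = "{p::nat. prime p \<and> p > y}" and ?P = "{p::nat. prime p \<and> p \<le> y}"
  let ?l = "\<lambda>p::nat. ln (1 - real p powr (-(1 + u)))"
  have S5: "p \<ge> 5" if "p \<in> ?S" for p using that y rough_prime_ge_5 by auto
  have sl: "?l summable_on A" if "\<And>p. p \<in> A \<Longrightarrow> prime p" for A
    using summable_on_ln_euler_factor[of "1 + u" A] that u by simp
  have "infsum ?l {p. prime p} = infsum ?l (?P \<union> ?S)"
    by (rule arg_cong[where f = "infsum ?l"]) auto
  also have "\<dots> = infsum ?l ?P + infsum ?l ?S"
    by (intro infsum_Un_disjoint sl) auto
  also have "infsum ?l ?P = sum ?l ?P"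
    by (rule infsum_finite) simp
  finally have "ln (real_zeta (1 + u)) = - sum ?l ?P - infsum ?l ?S"
    using ln_real_zeta[of "1 + u"] u by simp
  moreover have "real_zeta (1 + u) > 0"
  proof -
    obtain C where "\<And>u. u > 0 \<Longrightarrow> real_zeta (1 + u) \<ge> 1 / u" using real_zeta_expansion by blast
    from this[OF u] u show ?thesis by (smt (verit) divide_pos_pos)
  qed
  ultimately have key: "- infsum ?l ?S = - ln u + small_prime_log y u"
    using u by (simp add: small_prime_log_def ln_mult)
  have Ln1: "Ln (1 - of_real (real p powr (-(1 + u)))) = of_real (?l p)" if "p \<in> ?S" for p
  proof -
    have "real p powr (-(1 + u)) \<le> 1 / 5"
      by (rule powr_neg_le_inverse) (use S5[OF that] u in auto)
    hence "Ln (of_real (1 - real p powr (-(1 + u)))) = complex_of_real (?l p)"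
      by (intro Ln_of_real) auto
    thus ?thesis by (simp only: of_real_diff of_real_1)
  qed
  have "(\<Sum>\<^sub>\<infinity>p\<in>?S. Ln (1 - z * of_real (real p powr (-(1 + u))))) =
        (\<Sum>\<^sub>\<infinity>p\<in>?S. z * of_real (?l p) - prime_term (real p) u z)"
    by (rule infsum_cong) (simp add: prime_term_def Ln1 del: minus_add_distrib)
  also have "\<dots> = z * of_real (infsum ?l ?S) - prime_sum ?S u z"
    unfolding prime_sum_def
    by (intro infsumI has_sum_diff has_sum_cmult_right has_sum_of_real_iff[THEN iffD2] has_sum_infsum sl prime_term_summable)
       (use S5 z u in auto)
  finally have "- (\<Sum>\<^sub>\<infinity>p\<in>?S. Ln (1 - z * of_real (real p powr (-(1 + u))))) =
      z * of_real (- infsum ?l ?S) + prime_sum ?S u z" by simp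
  also have "\<dots> = of_real (- ln u) * z + (z * of_real (small_prime_log y u) + prime_sum ?S u z)"
    unfolding key by (simp add: algebra_simps)
  finally show ?thesis unfolding euler_fun_def exp_add[symmetric] by (rule arg_cong)
qed

text \<open>Any radius strictly between 3 and 4 would do in place of $7/2$.\<close>

lemma Cauchy_coeff_bound:
  assumes f: "f holomorphic_on ball 0 4" and B: "\<And>z. z \<in> ball 0 4 \<Longrightarrow> norm (f z) \<le> B"
  shows "norm ((deriv ^^ m) f 0 / fact m) \<le> B * (2 / 7) ^ m"
proof -
  have sub: "cball 0 (7/2) \<subseteq> ball (0::complex) 4" by auto
  have "norm ((deriv ^^ m) f 0) \<le> fact m * B / (7 / 2) ^ m"
    by (rule Cauchy_inequality)
       (use sub in \<open>auto intro!: B holomorphic_on_imp_continuous_on holomorphic_on_subset[OF f]\<close>)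
  thus ?thesis by (simp add: norm_divide field_simps power_divide)
qed

section \<open>Coefficients of the regular part\<close>

text \<open>\<open>kernel_log0\<close> is the limit of log K_u(z) as u tends to 0, and
  \<open>kernel_log1\<close> is the coefficient of u there. Hence A is exp of the first, and B is A
  times the second.\<close>

definition kernel_log0 :: "nat \<Rightarrow> complex \<Rightarrow> complex" where
  "kernel_log0 y z = z * of_real (\<Sum>p | prime p \<and> p \<le> y. ln (1 - 1 / real p)) + prime_sum {p. prime p \<and> p > y} 0 z"

definition kernel_log1 :: "nat \<Rightarrow> complex \<Rightarrow> complex" where
  "kernel_log1 y z = z * of_real (euler_mascheroni + (\<Sum>p | prime p \<and> p \<le> y. ln (real p) / (real p - 1))) +
     prime_sum_deriv {p. prime p \<and> p > y} z"

definition euler_kernel :: "nat \<Rightarrow> real \<Rightarrow> complex \<Rightarrow> complex" where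
  "euler_kernel y u z = exp (z * of_real (small_prime_log y u) + prime_sum {p. prime p \<and> p > y} u z)"

text \<open>Transfers an expansion of log K_u to K_u itself: \<alpha> is the logarithm at u = 0 and
  \<eta> its increment, and exp \<eta> = 1 + \<eta> + O(\<eta>^2) with \<eta> = O(u). The constant
  depends on the bounds alone, hence is uniform in z.\<close>

lemma exp_expansion:
  fixes \<alpha> \<beta> \<eta> :: complex and u a d r :: real
  assumes u: "0 \<le> u" "u \<le> 1"
    and \<alpha>: "norm \<alpha> \<le> a" and \<beta>: "norm \<beta> \<le> d" and \<eta>: "norm (\<eta> - of_real u * \<beta>) \<le> r * u\<^sup>2" and r: "r \<ge> 0"
  shows "norm (exp (\<alpha> + \<eta>) - exp \<alpha> - of_real u * (exp \<alpha> * \<beta>)) \<le> exp a * (exp (d + r) * (d + r)\<^sup>2 + r) * u\<^sup>2"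
proof -
  have d: "d \<ge> 0" using \<beta> norm_ge_zero[of \<beta>] by linarith
  have "norm \<eta> \<le> norm (of_real u * \<beta>) + norm (\<eta> - of_real u * \<beta>)"
    using norm_triangle_ineq[of "of_real u * \<beta>" "\<eta> - of_real u * \<beta>"] by simp
  also have "norm (of_real u * \<beta>) \<le> u * d" using u \<beta> by (simp add: norm_mult mult_left_mono)
  also have "norm (\<eta> - of_real u * \<beta>) \<le> r * u"
  proof -
    have "u\<^sup>2 \<le> u" using u by (simp add: power2_eq_square mult_left_le)
    hence "r * u\<^sup>2 \<le> r * u" using r by (intro mult_left_mono)
    thus ?thesis using \<eta> by linarith
  qed
  finally have n\<eta>: "norm \<eta> \<le> (d + r) * u" by (simp add: algebra_simps)
  also have "\<dots> \<le> d + r" using u d r by (simp add: mult_left_le)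
  finally have n\<eta>': "norm \<eta> \<le> d + r" .
  have "norm (exp \<eta> - (\<Sum>k\<le>1. \<eta> ^ k / fact k)) \<le> exp \<bar>Re \<eta>\<bar> * norm \<eta> ^ Suc 1 / fact 1"
    by (rule Taylor_exp)
  also have "\<dots> \<le> exp (d + r) * ((d + r) * u)\<^sup>2"
    using n\<eta> n\<eta>' abs_Re_le_cmod[of \<eta>] by (auto intro!: mult_mono power_mono simp: numeral_2_eq_2[symmetric] simp del: power_Suc)
  finally have "norm (exp \<eta> - (1 + \<eta>)) \<le> exp (d + r) * ((d + r) * u)\<^sup>2" by simp
  hence "norm (exp \<eta> - 1 - \<eta>) \<le> exp (d + r) * (d + r)\<^sup>2 * u\<^sup>2"
    by (simp only: power_mult_distrib mult.assoc diff_diff_eq)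
  hence *: "norm (exp \<eta> - 1 - of_real u * \<beta>) \<le> (exp (d + r) * (d + r)\<^sup>2 + r) * u\<^sup>2"
    using norm_triangle_ineq[of "exp \<eta> - 1 - \<eta>" "\<eta> - of_real u * \<beta>"] \<eta> by (simp add: algebra_simps)
  have "norm (exp \<alpha>) \<le> exp a" using \<alpha> abs_Re_le_cmod[of \<alpha>] by (auto simp: norm_exp_eq_Re)
  hence "norm (exp \<alpha>) * norm (exp \<eta> - 1 - of_real u * \<beta>) \<le> exp a * ((exp (d + r) * (d + r)\<^sup>2 + r) * u\<^sup>2)"
    using * by (intro mult_mono) auto
  moreover have "exp (\<alpha> + \<eta>) - exp \<alpha> - of_real u * (exp \<alpha> * \<beta>) = exp \<alpha> * (exp \<eta> - 1 - of_real u * \<beta>)"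
    by (simp add: exp_add algebra_simps)
  ultimately show ?thesis by (simp add: norm_mult)
qed

section \<open>Uniform expansion of the kernel for y >= 3\<close>

context
  fixes y :: nat
  assumes y: "y \<ge> 3"
begin

lemma rough_prime_ge_5': "p \<in> {p. prime p \<and> p > y} \<Longrightarrow> p \<ge> 5"
  using rough_prime_ge_5[of p] y by auto

lemma kernel_expansion:
  obtains C where "C \<ge> 0"
    "\<And>u z. 0 < u \<Longrightarrow> u \<le> 1 \<Longrightarrow> norm z \<le> 4 \<Longrightarrow>
       norm (euler_kernel y u z - exp (kernel_log0 y z) - of_real u * (exp (kernel_log0 y z) * kernel_log1 y z)) \<le> C * u\<^sup>2"
    "\<And>z. norm z \<le> 4 \<Longrightarrow> norm (exp (kernel_log0 y z)) \<le> C"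
    "\<And>z. norm z \<le> 4 \<Longrightarrow> norm (exp (kernel_log0 y z) * kernel_log1 y z) \<le> C"
proof -
  let ?S = "{p. prime p \<and> p > y}"
  let ?w0 = "\<Sum>p | prime p \<and> p \<le> y. ln (1 - 1 / real p)"
  let ?w1 = "euler_mascheroni + (\<Sum>p | prime p \<and> p \<le> y. ln (real p) / (real p - 1))"
  obtain C1 where C1: "C1 \<ge> 0" "\<And>u. 0 < u \<Longrightarrow> u \<le> 1 \<Longrightarrow> \<bar>small_prime_log y u - ?w0 - u * ?w1\<bar> \<le> C1 * u\<^sup>2"
    using small_prime_log_expansion[of y] by blast
  define M0 where "M0 = (\<Sum>\<^sub>\<infinity>p\<in>?S. 100 / (real p)\<^sup>2)"
  define M1 where "M1 = (\<Sum>\<^sub>\<infinity>p\<in>?S. 125 * ln (real p) / (real p)\<^sup>2)"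
  define M2 where "M2 = (\<Sum>\<^sub>\<infinity>p\<in>?S. 4000 * (ln (real p))\<^sup>2 / (real p)\<^sup>2)"
  have M2: "M2 \<ge> 0" unfolding M2_def by (rule infsum_nonneg) auto
  define a where "a = 4 * \<bar>?w0\<bar> + M0"
  define d where "d = 4 * \<bar>?w1\<bar> + M1"
  define r where "r = 4 * C1 + M2"
  have r: "r \<ge> 0" using C1 M2 by (simp add: r_def)
  have A: "norm (kernel_log0 y z) \<le> a" if z: "norm z \<le> 4" for z
  proof -
    have "norm (kernel_log0 y z) \<le> norm (z * of_real ?w0) + norm (prime_sum ?S 0 z)"
      unfolding kernel_log0_def by (rule norm_triangle_ineq)
    also have "norm (prime_sum ?S 0 z) \<le> M0"
      unfolding M0_def by (rule prime_term_summable(2)[OF rough_prime_ge_5']) (use z in auto)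
    also have "norm (z * of_real ?w0) \<le> 4 * \<bar>?w0\<bar>"
      unfolding norm_mult norm_of_real using z by (intro mult_right_mono) auto
    finally show ?thesis by (simp add: a_def)
  qed
  have B: "norm (kernel_log1 y z) \<le> d" if z: "norm z \<le> 4" for z
  proof -
    have "norm (kernel_log1 y z) \<le> norm (z * of_real ?w1) + norm (prime_sum_deriv ?S z)"
      unfolding kernel_log1_def by (rule norm_triangle_ineq)
    also have "norm (prime_sum_deriv ?S z) \<le> M1"
      unfolding M1_def by (rule prime_term_deriv_summable(2)[OF rough_prime_ge_5']) (use z in auto)
    also have "norm (z * of_real ?w1) \<le> 4 * \<bar>?w1\<bar>"
      unfolding norm_mult norm_of_real using z by (intro mult_right_mono) auto
    finally show ?thesis by (simp add: d_def)
  qed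
  have d: "d \<ge> 0" using B[of 0] norm_ge_zero[of "kernel_log1 y 0"] by (simp del: norm_ge_zero)
  \<comment> \<open>The sum of three bounds, so that one constant serves all three
    estimates.\<close>
  define C where "C = exp a * (exp (d + r) * (d + r)\<^sup>2 + r) + exp a + exp a * d"
  show ?thesis
  proof (rule that[of C])
    show "C \<ge> 0" using d r by (simp add: C_def)
    fix z :: complex assume z: "norm z \<le> 4"
    have E: "norm (exp (kernel_log0 y z)) \<le> exp a"
      using A[OF z] abs_Re_le_cmod[of "kernel_log0 y z"] by (auto simp: norm_exp_eq_Re)
    show "norm (exp (kernel_log0 y z)) \<le> C"
      by (rule order_trans[OF E]) (use d r in \<open>simp add: C_def\<close>)
    have "norm (exp (kernel_log0 y z) * kernel_log1 y z) \<le> exp a * d"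
      unfolding norm_mult by (intro mult_mono E B z) auto
    thus "norm (exp (kernel_log0 y z) * kernel_log1 y z) \<le> C"
      by (rule order_trans) (use d r in \<open>simp add: C_def\<close>)
    fix u :: real assume u: "0 < u" "u \<le> 1"
    define \<eta> where "\<eta> = z * of_real (small_prime_log y u - ?w0) + (prime_sum ?S u z - prime_sum ?S 0 z)"
    have eq: "\<eta> - of_real u * kernel_log1 y z = z * of_real (small_prime_log y u - ?w0 - u * ?w1) +
             (prime_sum ?S u z - prime_sum ?S 0 z - of_real u * prime_sum_deriv ?S z)"
      by (simp add: \<eta>_def kernel_log1_def algebra_simps)
    have "norm (\<eta> - of_real u * kernel_log1 y z) \<le> norm (z * of_real (small_prime_log y u - ?w0 - u * ?w1)) +
        norm (prime_sum ?S u z - prime_sum ?S 0 z - of_real u * prime_sum_deriv ?S z)"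
      unfolding eq by (rule norm_triangle_ineq)
    also have "norm (prime_sum ?S u z - prime_sum ?S 0 z - of_real u * prime_sum_deriv ?S z) \<le> M2 * u\<^sup>2"
      unfolding M2_def by (rule prime_sum_expansion[OF rough_prime_ge_5']) (use z u in auto)
    also have "norm (z * of_real (small_prime_log y u - ?w0 - u * ?w1)) \<le> 4 * (C1 * u\<^sup>2)"
      unfolding norm_mult norm_of_real by (intro mult_mono C1 u z) auto
    finally have "norm (\<eta> - of_real u * kernel_log1 y z) \<le> r * u\<^sup>2"
      by (simp add: r_def algebra_simps)
    from exp_expansion[OF _ u(2) A[OF z] B[OF z] this r] u
    have "norm (exp (kernel_log0 y z + \<eta>) - exp (kernel_log0 y z) - of_real u * (exp (kernel_log0 y z) * kernel_log1 y z))
            \<le> exp a * (exp (d + r) * (d + r)\<^sup>2 + r) * u\<^sup>2" by simp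
    also have "\<dots> \<le> C * u\<^sup>2" using d by (intro mult_right_mono) (auto simp: C_def)
    also have "kernel_log0 y z + \<eta> = z * of_real (small_prime_log y u) + prime_sum ?S u z"
      by (simp add: kernel_log0_def \<eta>_def algebra_simps)
    finally show "norm (euler_kernel y u z - exp (kernel_log0 y z) - of_real u * (exp (kernel_log0 y z) * kernel_log1 y z)) \<le> C * u\<^sup>2"
      by (simp add: euler_kernel_def)
  qed
qed

lemma kernel_holomorphic: "0 \<le> u \<Longrightarrow> euler_kernel y u holomorphic_on ball 0 4"
  unfolding euler_kernel_def[abs_def] by (intro holomorphic_intros prime_sum_holomorphic rough_prime_ge_5')

lemma kernel_log0_holomorphic: "kernel_log0 y holomorphic_on ball 0 4"
  unfolding kernel_log0_def[abs_def] by (intro holomorphic_intros prime_sum_holomorphic rough_prime_ge_5') auto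

lemma kernel_log1_holomorphic: "kernel_log1 y holomorphic_on ball 0 4"
  unfolding kernel_log1_def[abs_def] by (intro holomorphic_intros prime_sum_deriv_holomorphic rough_prime_ge_5')

end

text \<open>Here $\kappa_m(u)$ is the coefficient of $z^m$ in $K_u(z)$; the factor $u^{-z}$ appears as \<^term>\<open>fps_exp (- ln u)\<close>.\<close>

definition log_expansion :: "(nat \<Rightarrow> real \<Rightarrow> real) \<Rightarrow> (nat \<Rightarrow> real) \<Rightarrow> (nat \<Rightarrow> real) \<Rightarrow> (nat \<Rightarrow> real) \<Rightarrow> bool" where
  "log_expansion P a b e \<longleftrightarrow> (\<exists>\<kappa>. \<forall>u. 0 < u \<longrightarrow> u \<le> 1 \<longrightarrow>
     Abs_fps (\<lambda>m. P m (1 + u)) = fps_exp (- ln u) * Abs_fps (\<kappa> u) \<and>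
     (\<forall>m. \<bar>\<kappa> u m - a m - b m * u\<bar> \<le> e m * u\<^sup>2))"

text \<open>Cauchy's inequality is applied to the remainder K_u - A - u B as a whole, which is
  holomorphic in z and O(u^2) on the disc. So the factor u^2 and the geometric decay in m come
  together. The value A(2) is recorded for y = 2, where the factor of the prime 3 carries it into
  the new B(2).\<close>

lemma almost_prime_log_expansion:
  assumes y: "y \<ge> 3"
  obtains a b C where "C \<ge> 0"
    "log_expansion (almost_prime_sum {p. prime p \<and> p > y}) a b (\<lambda>m. C * (2 / 7) ^ m)"
    "\<And>m. \<bar>a m\<bar> \<le> C * (2 / 7) ^ m" "\<And>m. \<bar>b m\<bar> \<le> C * (2 / 7) ^ m"
    "a sums Re (exp (kernel_log0 y 1))" "(\<lambda>m. a m * 2 ^ m) sums Re (exp (kernel_log0 y 2))"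
    "(\<lambda>m. b m * 2 ^ m) sums Re (exp (kernel_log0 y 2) * kernel_log1 y 2)"
proof -
  let ?S = "{p. prime p \<and> p > y}"
  define A where "A = (\<lambda>z. exp (kernel_log0 y z))"
  define B where "B = (\<lambda>z. exp (kernel_log0 y z) * kernel_log1 y z)"
  have holo: "A holomorphic_on ball 0 4" "B holomorphic_on ball 0 4"
    unfolding A_def B_def by (intro holomorphic_intros kernel_log0_holomorphic kernel_log1_holomorphic y)+
  obtain C where C: "C \<ge> 0"
    "\<And>u z. 0 < u \<Longrightarrow> u \<le> 1 \<Longrightarrow> norm z \<le> 4 \<Longrightarrow> norm (euler_kernel y u z - A z - of_real u * B z) \<le> C * u\<^sup>2"
    "\<And>z. norm z \<le> 4 \<Longrightarrow> norm (A z) \<le> C" "\<And>z. norm z \<le> 4 \<Longrightarrow> norm (B z) \<le> C"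
    using kernel_expansion[OF y] unfolding A_def B_def by metis
  define coef :: "(complex \<Rightarrow> complex) \<Rightarrow> nat \<Rightarrow> complex" where "coef = (\<lambda>f m. (deriv ^^ m) f 0 / fact m)"
  have fps: "f has_fps_expansion fps_expansion f 0" "fps_nth (fps_expansion f 0) m = coef f m"
    if "f holomorphic_on ball 0 4" for f m
  proof -
    show 1: "f has_fps_expansion fps_expansion f 0"
      using has_fps_expansion_fps_expansion[OF _ _ that] by simp
    show "fps_nth (fps_expansion f 0) m = coef f m"
      using fps_nth_fps_expansion[OF 1] by (simp add: coef_def)
  qed
  \<comment> \<open>The sequences are taken as real parts of complex Taylor coefficients. All
    multipliers, namely (-ln u)^i / i!, u and powers of real x, are real, so every identity survives
    taking real parts.\<close>
  have Re_of_real_mult: "Re (of_real r * z) = r * Re z" for r z by simp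
  have coef_sums: "(\<lambda>m. Re (coef f m) * x ^ m) sums Re (f (of_real x))"
    if "f holomorphic_on ball 0 4" "\<bar>x\<bar> < 4" for f x
  proof -
    have "(\<lambda>m. (deriv ^^ m) f 0 / fact m * (of_real x - 0) ^ m) sums f (of_real x)"
      by (rule holomorphic_power_series[OF that(1)]) (use that in auto)
    hence "(\<lambda>m. of_real (x ^ m) * coef f m) sums f (of_real x)"
      by (simp add: coef_def mult.commute)
    from sums_Re[OF this] have "(\<lambda>m. x ^ m * Re (coef f m)) sums Re (f (of_real x))"
      by (simp only: Re_of_real_mult)
    thus ?thesis by (simp only: mult.commute)
  qed
  show ?thesis
  proof (rule that[of C "\<lambda>m. Re (coef A m)" "\<lambda>m. Re (coef B m)"])
    show "(\<lambda>m. Re (coef A m)) sums Re (exp (kernel_log0 y 1))"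
      using coef_sums[OF holo(1), of 1] by (simp add: A_def)
    show "(\<lambda>m. Re (coef A m) * 2 ^ m) sums Re (exp (kernel_log0 y 2))"
      using coef_sums[OF holo(1), of 2] by (simp add: A_def)
    show "(\<lambda>m. Re (coef B m) * 2 ^ m) sums Re (exp (kernel_log0 y 2) * kernel_log1 y 2)"
      using coef_sums[OF holo(2), of 2] by (simp add: B_def)
    show "\<bar>Re (coef A m)\<bar> \<le> C * (2 / 7) ^ m" for m
      using Cauchy_coeff_bound[OF holo(1), of C m] C(3) abs_Re_le_cmod[of "coef A m"] by (simp add: coef_def)
    show "\<bar>Re (coef B m)\<bar> \<le> C * (2 / 7) ^ m" for m
      using Cauchy_coeff_bound[OF holo(2), of C m] C(4) abs_Re_le_cmod[of "coef B m"] by (simp add: coef_def)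
    show "log_expansion (almost_prime_sum ?S) (\<lambda>m. Re (coef A m)) (\<lambda>m. Re (coef B m)) (\<lambda>m. C * (2 / 7) ^ m)"
      unfolding log_expansion_def
    proof (intro exI[of _ "\<lambda>u m. Re (coef (euler_kernel y u) m)"] allI impI conjI)
      fix u :: real assume u: "0 < u" "u \<le> 1"
      have hK: "euler_kernel y u holomorphic_on ball 0 4" by (rule kernel_holomorphic[OF y]) (use u in simp)
      have prem: "0 < (4::real)" "(4::real) < 5" "1 \<le> (5::real)" by auto
      have ge5: "real p \<ge> 5" if "p \<in> ?S" for p using rough_prime_ge_5'[OF y that] by simp
      have u1: "1 + u > 1" using u by simp
      have hE: "euler_fun ?S (1 + u) holomorphic_on ball 0 4"
        by (rule euler_fun_holomorphic[OF _ ge5 prem u1]) auto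
      have prod: "(\<lambda>z. exp (of_real (- ln u) * z) * euler_kernel y u z) has_fps_expansion fps_exp (of_real (- ln u)) * fps_expansion (euler_kernel y u) 0"
        by (intro has_fps_expansion_mult has_fps_expansion_exp fps hK)
      have ev: "eventually (\<lambda>z. euler_fun ?S (1 + u) z = exp (of_real (- ln u) * z) * euler_kernel y u z) (nhds 0)"
      proof (rule eventually_mono[OF eventually_nhds_in_open[of "ball 0 4"]])
        fix z :: complex assume "z \<in> ball 0 4"
        thus "euler_fun ?S (1 + u) z = exp (of_real (- ln u) * z) * euler_kernel y u z"
          unfolding euler_kernel_def by (intro euler_fun_eq_exp_mult y u) auto
      qed auto
      have fE: "euler_fun ?S (1 + u) has_fps_expansion fps_exp (of_real (- ln u)) * fps_expansion (euler_kernel y u) 0"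
        by (rule iffD2[OF has_fps_expansion_cong[OF ev refl] prod])
      show "Abs_fps (\<lambda>m. almost_prime_sum ?S m (1 + u)) = fps_exp (- ln u) * Abs_fps (\<lambda>m. Re (coef (euler_kernel y u) m))"
      proof (rule fps_ext)
        fix m
        have "complex_of_real (almost_prime_sum ?S m (1 + u)) = (deriv ^^ m) (euler_fun ?S (1 + u)) 0 / fact m"
          by (rule euler_fun_coeff[OF _ ge5 prem u1, symmetric]) auto
        also have "\<dots> = fps_nth (fps_exp (of_real (- ln u)) * fps_expansion (euler_kernel y u) 0) m"
          by (rule fps_nth_fps_expansion[OF fE, symmetric])
        also have "\<dots> = (\<Sum>i=0..m. of_real ((- ln u) ^ i / fact i) * coef (euler_kernel y u) (m - i))"
          by (simp add: fps_mult_nth fps(2)[OF hK])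
        finally have "Re (complex_of_real (almost_prime_sum ?S m (1 + u))) =
            Re (\<Sum>i=0..m. of_real ((- ln u) ^ i / fact i) * coef (euler_kernel y u) (m - i))" by (rule arg_cong)
        hence "almost_prime_sum ?S m (1 + u) = (\<Sum>i=0..m. (- ln u) ^ i / fact i * Re (coef (euler_kernel y u) (m - i)))"
          by (simp only: Re_sum Re_complex_of_real Re_of_real_mult)
        thus "fps_nth (Abs_fps (\<lambda>m. almost_prime_sum ?S m (1 + u))) m =
              fps_nth (fps_exp (- ln u) * Abs_fps (\<lambda>m. Re (coef (euler_kernel y u) m))) m"
          by (simp add: fps_mult_nth)
      qed
      fix m
      let ?R = "\<lambda>z. euler_kernel y u z - A z - of_real u * B z"
      have hR: "?R holomorphic_on ball 0 4" by (intro holomorphic_intros hK holo)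
      have "?R has_fps_expansion fps_expansion (euler_kernel y u) 0 - fps_expansion A 0 - fps_const (of_real u) * fps_expansion B 0"
        by (intro fps_expansion_intros fps hK holo)
      from fps_nth_fps_expansion[OF this, of m]
      have "coef ?R m = coef (euler_kernel y u) m - coef A m - of_real u * coef B m"
        by (simp add: fps(2)[OF hK] fps(2)[OF holo(1)] fps(2)[OF holo(2)]) (simp add: coef_def)
      moreover have "norm (coef ?R m) \<le> C * u\<^sup>2 * (2 / 7) ^ m"
        unfolding coef_def by (rule Cauchy_coeff_bound[OF hR]) (use C(2) u in auto)
      ultimately have "\<bar>Re (coef (euler_kernel y u) m - coef A m - of_real u * coef B m)\<bar> \<le> C * u\<^sup>2 * (2 / 7) ^ m"
        using abs_Re_le_cmod order_trans by metis
      thus "\<bar>Re (coef (euler_kernel y u) m) - Re (coef A m) - Re (coef B m) * u\<bar> \<le> C * (2 / 7) ^ m * u\<^sup>2"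
        by (simp add: mult_ac)
    qed
  qed (use C in auto)
qed

section \<open>Values at 1 and 2\<close>

lemma d_factor_pos: "d_factor p > 0"
proof (cases "prime p \<and> p > 2")
  case True
  hence "real p > 2" by simp
  thus ?thesis by (simp add: d_factor_def)
qed (auto simp: d_factor_def)

text \<open>(1 - 1/p)^2 exceeds 1 - 2/p, so the logarithms are nonnegative. The ordered convergence
  of the product then yields unordered summability, which allows the primes to be split at
  y.\<close>

lemma ln_d_factor_summable: "(\<lambda>p. ln (d_factor p)) summable_on UNIV"
proof -
  have "ln (d_factor p) \<ge> 0" for p
  proof (cases "prime p \<and> p > 2")
    case True
    hence p: "real p > 2" by simp
    have "1 - 2 / real p \<le> (1 - 1 / real p)\<^sup>2" by (simp add: power2_eq_square algebra_simps)
    hence "d_factor p \<ge> 1" using True p by (simp add: d_factor_def field_simps)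
    thus ?thesis by simp
  qed (auto simp: d_factor_def)
  moreover have "summable (\<lambda>p. ln (d_factor p))"
    by (rule summable_ln_real[OF d_base_product_convergent d_factor_pos])
  ultimately show ?thesis by (subst summable_on_UNIV_nonneg_real_iff)
qed

lemma prodinf_d_factor: "(\<Prod>p. d_factor p) = exp (\<Sum>\<^sub>\<infinity>p. ln (d_factor p))"
proof -
  have "(\<lambda>p. ln (d_factor p)) sums (\<Sum>\<^sub>\<infinity>p. ln (d_factor p))"
    by (rule has_sum_imp_sums[OF has_sum_infsum[OF ln_d_factor_summable]])
  thus ?thesis
    using prodinf_exp_real[OF d_base_product_convergent d_factor_pos] by (simp add: sums_iff)
qed

lemma exp_sum_ln_small_primes:
  "exp (\<Sum>p | prime p \<and> p \<le> (y::nat). ln (1 - 1 / real p)) = (\<Prod>p | prime p \<and> p \<le> y. 1 - 1 / real p)"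
proof -
  have "0 < 1 - 1 / real p" if "prime p" for p :: nat
    using prime_gt_1_nat[OF that] by simp
  thus ?thesis by (subst exp_sum) (auto intro!: prod.cong)
qed

context
  fixes y :: nat
  assumes y: "y \<ge> 3"
begin

text \<open>At z = 1 the two logarithms in \<open>prime_term\<close> cancel, so only the primes up
  to y contribute.\<close>

lemma exp_kernel_log0_1: "exp (kernel_log0 y 1) = of_real (\<Prod>p | prime p \<and> p \<le> y. 1 - 1 / real p)"
proof -
  have "prime_sum {p. prime p \<and> p > y} 0 1 = 0"
    unfolding prime_sum_def by (simp add: prime_term_def)
  thus ?thesis
    by (simp add: kernel_log0_def exp_of_real exp_sum_ln_small_primes del: of_real_sum of_real_prod)
qed

text \<open>The origin of the product in the constant d: at u = 0 the exponential of
  \<open>prime_term\<close> is (1 - 1/p)^z / (1 - z/p).\<close>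

lemma prime_term_0_2:
  assumes "prime p" "p > y"
  shows "prime_term (real p) 0 2 = of_real (ln (d_factor p))"
proof -
  have p: "real p \<ge> 5" "p > 2" using rough_prime_ge_5[of p] assms y by auto
  have x: "real p powr (-(1 + 0)) = 1 / real p" using p by (simp add: powr_minus_divide)
  have pos: "1 - 2 / real p > 0" "1 - 1 / real p > 0" using p by auto
  have "Ln (of_real (1 - 2 / real p)) = complex_of_real (ln (1 - 2 / real p))"
       "Ln (of_real (1 - 1 / real p)) = complex_of_real (ln (1 - 1 / real p))"
    using pos by (intro Ln_of_real; simp)+
  hence "prime_term (real p) 0 2 = of_real (- ln (1 - 2 / real p) + 2 * ln (1 - 1 / real p))"
    unfolding prime_term_def x by simp
  also have "- ln (1 - 2 / real p) + 2 * ln (1 - 1 / real p) = ln (d_factor p)"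
    using assms p pos by (simp add: d_factor_def ln_mult ln_inverse ln_realpow)
  finally show ?thesis .
qed

text \<open>The kernel gives the square of the product of 1 - 1/p over p <= y, times
  \<open>d_factor\<close> over p > y. For 2 < p <= y the square (1 - 1/p)^2 is
  \<open>d_factor p\<close> times 1 - 2/p, and the prime 2 leaves (1/2)^2, the 1/4 in
  \<open>d_base\<close>.\<close>

lemma exp_kernel_log0_2: "exp (kernel_log0 y 2) = of_real (d_const y)"
proof -
  let ?S = "{p. prime p \<and> p > y}" and ?P = "{p. prime p \<and> p \<le> y}" and ?Q = "{p. prime p \<and> 2 < p \<and> p \<le> y}"
  let ?l = "\<lambda>p. ln (d_factor p)"
  have sl: "?l summable_on A" for A
    by (rule summable_on_subset_banach[OF ln_d_factor_summable]) simp
  have "(\<Sum>\<^sub>\<infinity>p. ?l p) = infsum ?l (?Q \<union> ?S)"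
    by (rule infsum_cong_neutral) (use y in \<open>auto simp: d_factor_def\<close>)
  also have "\<dots> = infsum ?l ?Q + infsum ?l ?S"
    by (rule infsum_Un_disjoint[OF sl sl]) auto
  also have "infsum ?l ?Q = sum ?l ?Q" by simp
  finally have 1: "(\<Prod>p. d_factor p) = (\<Prod>p\<in>?Q. d_factor p) * exp (infsum ?l ?S)"
    by (simp add: prodinf_d_factor exp_add exp_sum d_factor_pos)
  have P: "?P = insert 2 ?Q"
    using y prime_ge_2_nat by (auto simp: le_less)
  have 2: "(\<Prod>p\<in>?P. 1 - 1 / real p) = 1 / 2 * (\<Prod>p\<in>?Q. 1 - 1 / real p)"
    unfolding P by (subst prod.insert) auto
  have 3: "(\<Prod>p\<in>?Q. d_factor p) * (\<Prod>p\<in>?Q. 1 - 2 / real p) = (\<Prod>p\<in>?Q. 1 - 1 / real p)\<^sup>2"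
    unfolding prod.distrib[symmetric] prod_power_distrib
    by (rule prod.cong) (auto simp: d_factor_def)
  have "prime_sum ?S 0 2 = (\<Sum>\<^sub>\<infinity>p\<in>?S. complex_of_real (?l p))"
    unfolding prime_sum_def by (rule infsum_cong) (use prime_term_0_2 in auto)
  also have "\<dots> = of_real (infsum ?l ?S)"
    by (intro infsumI has_sum_of_real_iff[THEN iffD2] has_sum_infsum sl)
  finally have "kernel_log0 y 2 = of_real ((\<Sum>p\<in>?P. ln (1 - 1 / real p)) + (\<Sum>p\<in>?P. ln (1 - 1 / real p)) + infsum ?l ?S)"
    by (simp add: kernel_log0_def)
  hence "exp (kernel_log0 y 2) = of_real ((\<Prod>p\<in>?P. 1 - 1 / real p)\<^sup>2 * exp (infsum ?l ?S))"
    by (simp only: exp_of_real exp_add exp_sum_ln_small_primes power2_eq_square)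
  also have "(\<Prod>p\<in>?P. 1 - 1 / real p)\<^sup>2 * exp (infsum ?l ?S) = d_const y"
  proof -
    have "d_const y = 1 / 4 * ((\<Prod>p\<in>?Q. d_factor p) * (\<Prod>p\<in>?Q. 1 - 2 / real p)) * exp (infsum ?l ?S)"
      by (simp add: d_const_def d_base_def 1)
    also have "\<dots> = (\<Prod>p\<in>?P. 1 - 1 / real p)\<^sup>2 * exp (infsum ?l ?S)"
      unfolding 3 2 by (simp add: power_mult_distrib power2_eq_square)
    finally show ?thesis ..
  qed
  finally show ?thesis .
qed

text \<open>The series in c_y arises because 1/(p-1) - 1/(p-2) = -1/((p-1)(p-2)); the overall factor
  2 is z.\<close>

lemma kernel_log1_2: "kernel_log1 y 2 = of_real (2 * c_const y)"
proof -
  let ?S = "{p. prime p \<and> p > y}"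
  let ?t = "\<lambda>p. ln (real p) / ((real p - 1) * (real p - 2))"
  have "prime_sum_deriv ?S 2 = (\<Sum>\<^sub>\<infinity>p\<in>?S. complex_of_real (- 2 * ?t p))"
    unfolding prime_sum_deriv_def
  proof (rule infsum_cong)
    fix p assume "p \<in> ?S"
    hence p: "real p \<ge> 5" using rough_prime_ge_5[of p] y by auto
    have "1 / (real p - 1) - 1 / (real p - 2) = - 1 / ((real p - 1) * (real p - 2))"
      using p by (simp add: divide_simps)
    hence "2 * ln (real p) * (1 / (real p - 1) - 1 / (real p - 2)) = - 2 * ?t p" by simp
    hence "complex_of_real (2 * ln (real p) * (1 / (real p - 1) - 1 / (real p - 2))) = of_real (- 2 * ?t p)"
      by (rule arg_cong)
    thus "prime_term_deriv (real p) 2 = of_real (- 2 * ?t p)"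
      unfolding prime_term_deriv_def by simp
  qed
  also have "\<dots> = of_real (- 2 * infsum ?t ?S)"
    by (intro infsumI has_sum_of_real_iff[THEN iffD2] has_sum_cmult_right has_sum_infsum c_const_series_summable)
  finally show ?thesis
    unfolding kernel_log1_def c_const_def by (simp add: algebra_simps)
qed

end

text \<open>Lowering y from 3 to 2 multiplies the generating function by (1 - z 3^(-1-u))^(-1). At u
  = 0 its value is 3/2 for z = 1 and 3 for z = 2, and its logarithmic u-derivative at z = 2 is -2 ln
  3, the change of 2 c_y.\<close>

lemma constants_2_conv_3:
  shows "(\<Prod>p | prime p \<and> p \<le> (2::nat). 1 - 1 / real p) = (\<Prod>p | prime p \<and> p \<le> (3::nat). 1 - 1 / real p) / (1 - 1 / 3)"
    and "d_const 2 = 3 * d_const 3" and "c_const 2 = c_const 3 - ln 3"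
proof -
  have p3: "prime (3::nat)" by simp
  have P2: "{p::nat. prime p \<and> p \<le> 2} = {2}"
  proof -
    have "p = 2" if "prime p" "p \<le> 2" for p :: nat using that prime_ge_2_nat[of p] by auto
    thus ?thesis by auto
  qed
  have P3: "{p::nat. prime p \<and> p \<le> 3} = {2, 3}"
  proof -
    have "p = 2 \<or> p = 3" if "prime p" "p \<le> 3" for p :: nat using that prime_ge_2_nat[of p] by auto
    thus ?thesis using p3 by auto
  qed
  have Q2: "{p::nat. prime p \<and> 2 < p \<and> p \<le> 2} = {}" by auto
  have Q3: "{p::nat. prime p \<and> 2 < p \<and> p \<le> 3} = {3}"
  proof -
    have "p = 3" if "2 < p" "p \<le> 3" for p :: nat using that by auto
    thus ?thesis using p3 by auto
  qed
  show "(\<Prod>p | prime p \<and> p \<le> (2::nat). 1 - 1 / real p) = (\<Prod>p | prime p \<and> p \<le> (3::nat). 1 - 1 / real p) / (1 - 1 / 3)"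
    unfolding P2 P3 by simp
  show "d_const 2 = 3 * d_const 3" unfolding d_const_def Q2 Q3 by simp
  let ?t = "\<lambda>p. ln (real p) / ((real p - 1) * (real p - 2))"
  have "{p::nat. prime p \<and> p > 2} = insert 3 {p. prime p \<and> p > 3}"
  proof -
    have "p = 3 \<or> p > 3" if "p > 2" for p :: nat using that by auto
    thus ?thesis using p3 by auto
  qed
  hence "infsum ?t {p. prime p \<and> p > 2} = ?t 3 + infsum ?t {p. prime p \<and> p > 3}"
    using infsum_insert[OF c_const_series_summable[of 3], of 3] by simp
  thus "c_const 2 = c_const 3 - ln 3"
    unfolding c_const_def P2 P3 by simp
qed

section \<open>Reinserting the prime 3\<close>

lemma fps_geometric_mult:
  fixes x :: real
  shows "(1 - fps_const x * fps_X) * Abs_fps (\<lambda>i. x ^ i) = 1"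
proof (rule fps_ext)
  fix n
  have "(1 - fps_const x * fps_X) * Abs_fps (\<lambda>i. x ^ i) = Abs_fps (\<lambda>i. x ^ i) - fps_const x * (fps_X * Abs_fps (\<lambda>i. x ^ i))"
    by (simp add: algebra_simps)
  thus "fps_nth ((1 - fps_const x * fps_X) * Abs_fps (\<lambda>i. x ^ i)) n = fps_nth 1 n"
    by (cases n) simp_all
qed

lemma Abs_fps_almost_prime_sum_insert:
  assumes "prime p" "p \<notin> S" "s > 1"
  shows "Abs_fps (\<lambda>m. almost_prime_sum (insert p S) m s) =
           Abs_fps (\<lambda>i. (real p powr (-s)) ^ i) * Abs_fps (\<lambda>m. almost_prime_sum S m s)"
proof -
  let ?P = "\<lambda>S. Abs_fps (\<lambda>m. almost_prime_sum S m s)" and ?x = "real p powr (-s)"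
  have "(1 - fps_const ?x * fps_X) * ?P (insert p S) = ?P S"
  proof (rule fps_ext)
    fix n
    have "(1 - fps_const ?x * fps_X) * ?P (insert p S) = ?P (insert p S) - fps_const ?x * (fps_X * ?P (insert p S))"
      by (simp add: algebra_simps)
    thus "fps_nth ((1 - fps_const ?x * fps_X) * ?P (insert p S)) n = fps_nth (?P S) n"
      by (cases n) (simp_all add: almost_prime_sum_0 almost_prime_sum_insert[OF assms])
  qed
  moreover have "?P (insert p S) = ((1 - fps_const ?x * fps_X) * Abs_fps (\<lambda>i. ?x ^ i)) * ?P (insert p S)"
    by (simp only: fps_geometric_mult mult_1)
  ultimately show ?thesis by (simp only: mult.assoc mult.left_commute)
qed

text \<open>Stated for all t >= 0 because t = i u ln 3 grows with the coefficient index i.\<close>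

lemma exp_minus_bounds:
  fixes t :: real
  assumes "t \<ge> 0"
  shows "\<bar>exp (-t) - 1\<bar> \<le> t" "\<bar>exp (-t) - 1 + t\<bar> \<le> t\<^sup>2"
proof -
  have "1 - t \<le> exp (-t)" using exp_ge_add_one_self[of "-t"] by simp
  moreover have "exp (-t) \<le> 1" using assms by simp
  ultimately show "\<bar>exp (-t) - 1\<bar> \<le> t" by simp
  \<comment> \<open>The product with 1 + t <= exp t is 1 + t^3, hence at least 1; dividing by exp t
    gives the upper bound.\<close>
  have "(1 - t + t\<^sup>2) * exp t \<ge> (1 - t + t\<^sup>2) * (1 + t)"
  proof (rule mult_left_mono)
    have "0 \<le> (t - 1 / 2)\<^sup>2 + 3 / 4" by simp
    thus "0 \<le> 1 - t + t\<^sup>2" by (simp add: power2_eq_square algebra_simps)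
  qed simp
  also have "(1 - t + t\<^sup>2) * (1 + t) = 1 + t ^ 3" by (simp add: power2_eq_square power3_eq_cube algebra_simps)
  finally have "1 \<le> (1 - t + t\<^sup>2) * exp t" using assms by (smt (verit) zero_le_power)
  hence "exp (-t) \<le> 1 - t + t\<^sup>2" by (simp add: exp_minus field_simps)
  with \<open>1 - t \<le> exp (-t)\<close> show "\<bar>exp (-t) - 1 + t\<bar> \<le> t\<^sup>2" by simp
qed

text \<open>Second-order expansion in u of 3^(-i(1+u)) = 3^(-i) exp (-t) with t = i u ln 3. The
  constants 2 and 4 come from ln 3 <= 2.\<close>

lemma geometric_expansion:
  fixes u :: real
  assumes u: "0 \<le> u" "u \<le> 1"
  defines "x \<equiv> 3 powr (-(1 + u))"
  shows "\<bar>x ^ i\<bar> \<le> (1/3) ^ i" "\<bar>x ^ i - (1/3) ^ i\<bar> \<le> 2 * real i * (1/3) ^ i * u"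
    "\<bar>x ^ i - (1/3) ^ i - (- real i * ln 3 * (1/3) ^ i) * u\<bar> \<le> 4 * (real i)\<^sup>2 * (1/3) ^ i * u\<^sup>2"
proof -
  define t where "t = real i * ln 3 * u"
  have ln3: "0 < ln (3::real)" "ln (3::real) \<le> 2" using ln_le_minus_one[of 3] by auto
  have t: "0 \<le> t" "t \<le> 2 * real i * u"
  proof -
    show "0 \<le> t" using u ln3 by (simp add: t_def)
    have "real i * ln 3 * u \<le> real i * 2 * u" using u ln3 by (intro mult_left_mono mult_right_mono) auto
    thus "t \<le> 2 * real i * u" by (simp add: t_def mult_ac)
  qed
  have xi: "x ^ i = (1/3) ^ i * exp (-t)"
  proof -
    have "x ^ i = exp (real i * (-(1 + u) * ln 3))"
      unfolding x_def powr_def by (simp add: exp_of_nat_mult[symmetric])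
    also have "real i * (-(1 + u) * ln 3) = real i * (- ln 3) + (- t)" by (simp add: t_def algebra_simps)
    also have "exp \<dots> = exp (- ln 3) ^ i * exp (-t)" by (simp only: exp_add exp_of_nat_mult)
    also have "exp (- ln 3 :: real) = 1 / 3" by (simp add: exp_minus)
    finally show ?thesis .
  qed
  have "exp (-t) \<le> 1" using t by simp
  thus "\<bar>x ^ i\<bar> \<le> (1/3) ^ i" unfolding xi by (simp add: mult_left_le)
  have "x ^ i - (1/3) ^ i = (1/3) ^ i * (exp (-t) - 1)" unfolding xi by (simp add: algebra_simps)
  hence "\<bar>x ^ i - (1/3) ^ i\<bar> = (1/3) ^ i * \<bar>exp (-t) - 1\<bar>" by (simp add: abs_mult)
  also have "\<dots> \<le> (1/3) ^ i * (2 * real i * u)"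
    using exp_minus_bounds(1)[OF t(1)] t by (intro mult_left_mono) auto
  finally show "\<bar>x ^ i - (1/3) ^ i\<bar> \<le> 2 * real i * (1/3) ^ i * u" by (simp add: mult_ac)
  have "x ^ i - (1/3) ^ i - (- real i * ln 3 * (1/3) ^ i) * u = (1/3) ^ i * (exp (-t) - 1 + t)"
    unfolding xi by (simp add: t_def algebra_simps)
  hence "\<bar>x ^ i - (1/3) ^ i - (- real i * ln 3 * (1/3) ^ i) * u\<bar> = (1/3) ^ i * \<bar>exp (-t) - 1 + t\<bar>" by (simp only: abs_mult) simp
  also have "\<dots> \<le> (1/3) ^ i * (2 * real i * u)\<^sup>2"
    using order_trans[OF exp_minus_bounds(2)[OF t(1)] power_mono[OF t(2) t(1)]] by (intro mult_left_mono) auto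
  finally show "\<bar>x ^ i - (1/3) ^ i - (- real i * ln 3 * (1/3) ^ i) * u\<bar> \<le> 4 * (real i)\<^sup>2 * (1/3) ^ i * u\<^sup>2"
    by (simp add: power_mult_distrib mult_ac)
qed

text \<open>Since 2/7 < 1/3 the slower decay wins: (1/3)^i (2/7)^(m-i) = (1/3)^m (6/7)^(m-i), and
  the geometric series of ratio 6/7 sums to 7.\<close>

lemma convolution_bound:
  fixes C :: real
  assumes C: "C \<ge> 0" and h: "\<And>i. i \<le> m \<Longrightarrow> \<bar>h i\<bar> \<le> (real i + 1)\<^sup>2 * (1/3) ^ i * (C * (2/7) ^ (m - i))"
  shows "\<bar>\<Sum>i=0..m. h i\<bar> \<le> 7 * C * (real m + 1)\<^sup>2 * (1/3) ^ m"
proof -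
  have "\<bar>\<Sum>i=0..m. h i\<bar> \<le> (\<Sum>i=0..m. (real m + 1)\<^sup>2 * (1/3) ^ m * C * (6/7) ^ (m - i))"
  proof (intro order_trans[OF sum_abs] sum_mono)
    fix i assume i: "i \<in> {0..m}"
    have e: "(1/3) ^ i * (2/7) ^ (m - i) = (1/3) ^ m * (6/7 :: real) ^ (m - i)"
    proof -
      have "(2/7 :: real) = 1/3 * (6/7)" by simp
      hence "(1/3) ^ i * (2/7 :: real) ^ (m - i) = ((1/3) ^ i * (1/3) ^ (m - i)) * (6/7) ^ (m - i)"
        by (simp only: power_mult_distrib mult.assoc)
      also have "(1/3 :: real) ^ i * (1/3) ^ (m - i) = (1/3) ^ m"
        using i by (simp only: power_add[symmetric]) simp
      finally show ?thesis .
    qed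
    have "\<bar>h i\<bar> \<le> (real i + 1)\<^sup>2 * (C * ((1/3) ^ i * (2/7) ^ (m - i)))" using h[of i] i by (simp add: mult_ac)
    also have "\<dots> \<le> (real m + 1)\<^sup>2 * (C * ((1/3) ^ i * (2/7) ^ (m - i)))"
      using i C by (intro mult_right_mono power_mono) auto
    finally show "\<bar>h i\<bar> \<le> (real m + 1)\<^sup>2 * (1/3) ^ m * C * (6/7) ^ (m - i)" unfolding e by (simp add: mult_ac)
  qed
  also have "\<dots> = (real m + 1)\<^sup>2 * (1/3) ^ m * C * (\<Sum>i=0..m. (6/7) ^ (m - i))" by (simp add: sum_distrib_left)
  also have "(\<Sum>i=0..m. (6/7 :: real) ^ (m - i)) = (\<Sum>i\<le>m. (6/7) ^ i)"
    using sum.atLeastAtMost_rev[of "\<lambda>i. (6/7::real) ^ i" 0 m] by (simp add: atLeast0AtMost)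
  also have "(\<Sum>i\<le>m. (6/7 :: real) ^ i) \<le> 7"
    using sum_le_suminf[of "\<lambda>i. (6/7::real) ^ i" "{..m}"] by (simp add: suminf_geometric)
  finally show ?thesis using C by (simp add: mult_right_mono mult_ac)
qed

lemma log_expansionE:
  assumes "log_expansion P a b e"
  obtains \<kappa> where
    "\<And>u. 0 < u \<Longrightarrow> u \<le> 1 \<Longrightarrow> Abs_fps (\<lambda>m. P m (1 + u)) = fps_exp (- ln u) * Abs_fps (\<kappa> u)"
    "\<And>u m. 0 < u \<Longrightarrow> u \<le> 1 \<Longrightarrow> \<bar>\<kappa> u m - a m - b m * u\<bar> \<le> e m * u\<^sup>2"
  using assms unfolding log_expansion_def by blast

lemma rough_log_expansion:
  assumes "y \<ge> 2"
  obtains a b C where "C \<ge> 0"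
    "log_expansion (almost_prime_sum {p. prime p \<and> p > y}) a b (\<lambda>m. C * (real m + 1)\<^sup>2 * (1/3) ^ m)"
    "\<And>m. \<bar>a m\<bar> \<le> C * (real m + 1)\<^sup>2 * (1/3) ^ m" "\<And>m. \<bar>b m\<bar> \<le> C * (real m + 1)\<^sup>2 * (1/3) ^ m"
    "a sums (\<Prod>p | prime p \<and> p \<le> y. 1 - 1 / real p)"
    "(\<lambda>m. b m * 2 ^ m) sums (2 * c_const y * d_const y)"
proof (cases "y \<ge> 3")
  case True
  obtain a b C where abC: "C \<ge> 0"
    "log_expansion (almost_prime_sum {p. prime p \<and> p > y}) a b (\<lambda>m. C * (2 / 7) ^ m)"
    "\<And>m. \<bar>a m\<bar> \<le> C * (2 / 7) ^ m" "\<And>m. \<bar>b m\<bar> \<le> C * (2 / 7) ^ m"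
    "a sums Re (exp (kernel_log0 y 1))" "(\<lambda>m. a m * 2 ^ m) sums Re (exp (kernel_log0 y 2))"
    "(\<lambda>m. b m * 2 ^ m) sums Re (exp (kernel_log0 y 2) * kernel_log1 y 2)"
    by (rule almost_prime_log_expansion[OF True], rule that)
  \<comment> \<open>For y >= 3 the decay (2/7)^m is weakened to the shape that y = 2 dictates, so
    that both cases end alike.\<close>
  have le: "C * (2/7) ^ m \<le> C * (real m + 1)\<^sup>2 * (1/3) ^ m" for m
  proof -
    have "(2/7::real) ^ m \<le> (1/3) ^ m" by (rule power_mono) auto
    moreover have "1 \<le> (real m + 1)\<^sup>2" by (rule one_le_power) simp
    ultimately have "1 * (2/7) ^ m \<le> (real m + 1)\<^sup>2 * (1/3) ^ m" by (intro mult_mono) auto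
    thus ?thesis using abC(1) by (simp add: mult_left_mono mult.assoc)
  qed
  show ?thesis
  proof (rule that[OF abC(1)])
    obtain \<kappa> where \<kappa>: "\<And>u. 0 < u \<Longrightarrow> u \<le> 1 \<Longrightarrow>
       Abs_fps (\<lambda>m. almost_prime_sum {p. prime p \<and> p > y} m (1 + u)) = fps_exp (- ln u) * Abs_fps (\<kappa> u)"
       "\<And>u m. 0 < u \<Longrightarrow> u \<le> 1 \<Longrightarrow> \<bar>\<kappa> u m - a m - b m * u\<bar> \<le> C * (2 / 7) ^ m * u\<^sup>2"
      by (rule log_expansionE[OF abC(2)], rule that)
    have "\<bar>\<kappa> u m - a m - b m * u\<bar> \<le> C * (real m + 1)\<^sup>2 * (1/3) ^ m * u\<^sup>2" if "0 < u" "u \<le> 1" for u m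
      by (rule order_trans[OF \<kappa>(2)[OF that] mult_right_mono[OF le]]) simp
    thus "log_expansion (almost_prime_sum {p. prime p \<and> p > y}) a b (\<lambda>m. C * (real m + 1)\<^sup>2 * (1/3) ^ m)"
      unfolding log_expansion_def using \<kappa>(1) by blast
    show "\<bar>a m\<bar> \<le> C * (real m + 1)\<^sup>2 * (1/3) ^ m" "\<bar>b m\<bar> \<le> C * (real m + 1)\<^sup>2 * (1/3) ^ m" for m
      using abC(3,4)[of m] le[of m] by linarith+
    show "a sums (\<Prod>p | prime p \<and> p \<le> y. 1 - 1 / real p)"
      using abC(5) unfolding exp_kernel_log0_1[OF True] by (simp only: Re_complex_of_real)
    show "(\<lambda>m. b m * 2 ^ m) sums (2 * c_const y * d_const y)"
      using abC(7) unfolding exp_kernel_log0_2[OF True] kernel_log1_2[OF True] of_real_mult[symmetric]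
      by (simp only: Re_complex_of_real mult.commute mult.left_commute)
  qed
next
  case False
  with assms have y2: "y = 2" by simp
  define S where "S = {p::nat. prime p \<and> p > 3}"
  have p3: "prime (3::nat)" by simp
  have S2: "{p::nat. prime p \<and> p > 2} = insert 3 S"
  proof -
    have "p = 3 \<or> p > 3" if "p > 2" for p :: nat using that by auto
    thus ?thesis using p3 by (auto simp: S_def)
  qed
  have S3: "3 \<notin> S" by (simp add: S_def)
  obtain a b C where abC0: "C \<ge> 0"
    "log_expansion (almost_prime_sum {p. prime p \<and> p > 3}) a b (\<lambda>m. C * (2 / 7) ^ m)"
    "\<And>m. \<bar>a m\<bar> \<le> C * (2 / 7) ^ m" "\<And>m. \<bar>b m\<bar> \<le> C * (2 / 7) ^ m"
    "a sums Re (exp (kernel_log0 3 1))" "(\<lambda>m. a m * 2 ^ m) sums Re (exp (kernel_log0 3 2))"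
    "(\<lambda>m. b m * 2 ^ m) sums Re (exp (kernel_log0 3 2) * kernel_log1 3 2)"
    by (rule almost_prime_log_expansion[of 3], simp, rule that)
  note abC = abC0[folded S_def]
  obtain \<kappa> where \<kappa>: "\<And>u. 0 < u \<Longrightarrow> u \<le> 1 \<Longrightarrow>
       Abs_fps (\<lambda>m. almost_prime_sum S m (1 + u)) = fps_exp (- ln u) * Abs_fps (\<kappa> u)"
       "\<And>u m. 0 < u \<Longrightarrow> u \<le> 1 \<Longrightarrow> \<bar>\<kappa> u m - a m - b m * u\<bar> \<le> C * (2 / 7) ^ m * u\<^sup>2"
    by (rule log_expansionE[OF abC(2)], rule that)
  \<comment> \<open>\<open>g0\<close> and \<open>g1\<close> are the Taylor coefficients in u of
    3^(-i(1+u)). \<open>a'\<close> and \<open>b'\<close> are the order 0 and order 1 parts of the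
    product with K_u, and \<open>\<kappa>'\<close> is the exact convolution.\<close>
  define g0 g1 :: "nat \<Rightarrow> real" where "g0 = (\<lambda>i. (1/3) ^ i)" and "g1 = (\<lambda>i. - real i * ln 3 * (1/3) ^ i)"
  define a' where "a' = (\<lambda>m. \<Sum>i=0..m. g0 i * a (m - i))"
  define b' where "b' = (\<lambda>m. \<Sum>i=0..m. g0 i * b (m - i) + g1 i * a (m - i))"
  define \<kappa>' where "\<kappa>' = (\<lambda>u m. \<Sum>i=0..m. (3 powr (-(1 + u))) ^ i * \<kappa> u (m - i))"
  have ln3: "0 < ln (3::real)" "ln (3::real) \<le> 2" using ln_le_minus_one[of 3] by auto
  have g0: "\<bar>g0 i\<bar> = (1/3) ^ i" for i by (simp add: g0_def)
  have g1: "\<bar>g1 i\<bar> \<le> 2 * real i * (1/3) ^ i" for i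
  proof -
    have "real i * ln 3 * (1/3) ^ i \<le> real i * 2 * (1/3) ^ i" using ln3 by (intro mult_right_mono mult_left_mono) auto
    thus ?thesis using ln3 by (simp add: g1_def abs_mult mult_ac)
  qed
  show ?thesis
  \<comment> \<open>28 is 7 from \<open>convolution_bound\<close> times 4 from 1 + 2i + 4i^2 <=
    4(i+1)^2, where the left side adds up the three parts of the remainder.\<close>
  proof (rule that[of "28 * C"])
    show "28 * C \<ge> 0" using abC(1) by simp
    have C2: "2 * C \<ge> 0" "4 * C \<ge> 0" using abC(1) by auto
    have up: "7 * (4 * C) = 28 * C" by simp
    have sq: "1 + 2 * real i \<le> (real i + 1)\<^sup>2" "1 \<le> (real i + 1)\<^sup>2"
      "1 + 2 * real i + 4 * (real i)\<^sup>2 \<le> 4 * (real i + 1)\<^sup>2" for i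
      by (simp_all add: power2_eq_square algebra_simps)
    have P0: "0 \<le> (1/3) ^ i * (C * (2/7) ^ j)" for i j using abC(1) by simp
    show "\<bar>a' m\<bar> \<le> (28 * C) * (real m + 1)\<^sup>2 * (1/3) ^ m" for m
      unfolding a'_def up[symmetric]
    proof (rule convolution_bound[OF C2(2)])
      fix i
      have "\<bar>g0 i * a (m - i)\<bar> \<le> (1/3) ^ i * (C * (2/7) ^ (m - i))"
        unfolding abs_mult g0 by (intro mult_left_mono abC) auto
      also have "\<dots> \<le> (4 * (real i + 1)\<^sup>2) * ((1/3) ^ i * (C * (2/7) ^ (m - i)))"
        using mult_right_mono[OF _ P0[of i "m - i"], of 1 "4 * (real i + 1)\<^sup>2"] sq(2)[of i] by simp
      finally show "\<bar>g0 i * a (m - i)\<bar> \<le> (real i + 1)\<^sup>2 * (1/3) ^ i * (4 * C * (2/7) ^ (m - i))" by (simp add: mult_ac)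
    qed
    show "\<bar>b' m\<bar> \<le> (28 * C) * (real m + 1)\<^sup>2 * (1/3) ^ m" for m
      unfolding b'_def up[symmetric]
    proof (rule convolution_bound[OF C2(2)])
      fix i
      have "\<bar>g0 i * b (m - i)\<bar> \<le> (1/3) ^ i * (C * (2/7) ^ (m - i))"
        unfolding abs_mult g0 by (intro mult_left_mono abC) auto
      moreover have "\<bar>g1 i * a (m - i)\<bar> \<le> (2 * real i * (1/3) ^ i) * (C * (2/7) ^ (m - i))"
        unfolding abs_mult by (intro mult_mono abC g1) auto
      ultimately have "\<bar>g0 i * b (m - i) + g1 i * a (m - i)\<bar> \<le>
          (1/3) ^ i * (C * (2/7) ^ (m - i)) + (2 * real i * (1/3) ^ i) * (C * (2/7) ^ (m - i))" by linarith
      also have "\<dots> = (1 + 2 * real i) * ((1/3) ^ i * (C * (2/7) ^ (m - i)))" by (simp add: algebra_simps)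
      also have "\<dots> \<le> (4 * (real i + 1)\<^sup>2) * ((1/3) ^ i * (C * (2/7) ^ (m - i)))"
        using sq(1)[of i] zero_le_power2[of "real i + 1"] by (intro mult_right_mono P0) linarith
      finally show "\<bar>g0 i * b (m - i) + g1 i * a (m - i)\<bar> \<le> (real i + 1)\<^sup>2 * (1/3) ^ i * (4 * C * (2/7) ^ (m - i))" by (simp add: mult_ac)
    qed
    show "log_expansion (almost_prime_sum {p. prime p \<and> p > y}) a' b' (\<lambda>m. (28 * C) * (real m + 1)\<^sup>2 * (1/3) ^ m)"
      unfolding log_expansion_def y2 S2
    proof (intro exI[of _ \<kappa>'] allI impI conjI)
      fix u :: real assume u: "0 < u" "u \<le> 1"
      let ?x = "3 powr (-(1 + u)) :: real"
      have "Abs_fps (\<lambda>m. almost_prime_sum (insert 3 S) m (1 + u)) =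
              Abs_fps (\<lambda>i. ?x ^ i) * (fps_exp (- ln u) * Abs_fps (\<kappa> u))"
        using Abs_fps_almost_prime_sum_insert[OF p3 S3, of "1 + u"] u \<kappa>(1)[OF u] by simp
      also have "\<dots> = fps_exp (- ln u) * (Abs_fps (\<lambda>i. ?x ^ i) * Abs_fps (\<kappa> u))" by (rule mult.left_commute)
      also have "Abs_fps (\<lambda>i. ?x ^ i) * Abs_fps (\<kappa> u) = Abs_fps (\<kappa>' u)"
        by (rule fps_ext) (simp add: fps_mult_nth \<kappa>'_def)
      finally show "Abs_fps (\<lambda>m. almost_prime_sum (insert 3 S) m (1 + u)) = fps_exp (- ln u) * Abs_fps (\<kappa>' u)" .
      fix m
      \<comment> \<open>Three contributions, each O(u^2): the remainder of \<open>\<kappa>\<close>,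
        the second-order remainder of the geometric coefficient times a, and its first-order change
        times b u.\<close>
      let ?h = "\<lambda>i. ?x ^ i * (\<kappa> u (m - i) - a (m - i) - b (m - i) * u) + (?x ^ i - g0 i - g1 i * u) * a (m - i) + (?x ^ i - g0 i) * (b (m - i) * u)"
      have eq: "\<kappa>' u m - a' m - b' m * u = (\<Sum>i=0..m. ?h i)"
        unfolding \<kappa>'_def a'_def b'_def sum_distrib_right sum_subtractf[symmetric]
        by (rule sum.cong) (simp_all add: algebra_simps)
      have "\<bar>\<Sum>i=0..m. ?h i\<bar> \<le> 7 * (4 * C * u\<^sup>2) * (real m + 1)\<^sup>2 * (1/3) ^ m"
      proof (rule convolution_bound)
        show "0 \<le> 4 * C * u\<^sup>2" using abC(1) by simp
        fix i
        note ge = geometric_expansion[of u i, OF less_imp_le[OF u(1)] u(2)]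
        have "\<bar>?x ^ i * (\<kappa> u (m - i) - a (m - i) - b (m - i) * u)\<bar> \<le> (1/3) ^ i * (C * (2/7) ^ (m - i) * u\<^sup>2)"
          unfolding abs_mult[of "?x ^ i"] by (intro mult_mono \<kappa>(2) u ge(1)) auto
        moreover have "\<bar>(?x ^ i - g0 i - g1 i * u) * a (m - i)\<bar> \<le> (4 * (real i)\<^sup>2 * (1/3) ^ i * u\<^sup>2) * (C * (2/7) ^ (m - i))"
          unfolding abs_mult[of _ "a (m - i)"] g0_def g1_def by (intro mult_mono ge(3) abC) auto
        moreover have "\<bar>(?x ^ i - g0 i) * (b (m - i) * u)\<bar> \<le> (2 * real i * (1/3) ^ i * u) * (C * (2/7) ^ (m - i) * u)"
          unfolding abs_mult g0_def using u abC(1) by (intro mult_mono ge(2) abC) auto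
        ultimately have "\<bar>?h i\<bar> \<le> (1/3) ^ i * (C * (2/7) ^ (m - i) * u\<^sup>2) + (4 * (real i)\<^sup>2 * (1/3) ^ i * u\<^sup>2) * (C * (2/7) ^ (m - i)) +
             (2 * real i * (1/3) ^ i * u) * (C * (2/7) ^ (m - i) * u)" by linarith
        also have "\<dots> = (1 + 2 * real i + 4 * (real i)\<^sup>2) * ((1/3) ^ i * (C * (2/7) ^ (m - i))) * u\<^sup>2"
          by (simp add: algebra_simps power2_eq_square)
        also have "\<dots> \<le> (4 * (real i + 1)\<^sup>2) * ((1/3) ^ i * (C * (2/7) ^ (m - i))) * u\<^sup>2"
          by (intro mult_right_mono P0 sq) auto
        finally show "\<bar>?h i\<bar> \<le> (real i + 1)\<^sup>2 * (1/3) ^ i * (4 * C * u\<^sup>2 * (2/7) ^ (m - i))" by (simp add: mult_ac)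
      qed
      thus "\<bar>\<kappa>' u m - a' m - b' m * u\<bar> \<le> (28 * C) * (real m + 1)\<^sup>2 * (1/3) ^ m * u\<^sup>2"
        unfolding eq by (simp add: algebra_simps)
    qed
    have sum27: "summable (\<lambda>m. C * (2/7::real) ^ m)" "summable (\<lambda>m. C * (4/7::real) ^ m)"
      by (intro summable_mult summable_geometric; simp)+
    have sa: "summable (\<lambda>m. norm (a m))"
      by (rule summable_comparison_test'[OF sum27(1), of 0]) (use abC(3) in auto)
    have b47: "\<bar>c m * 2 ^ m\<bar> \<le> C * (4/7) ^ m" if "\<And>m. \<bar>c m\<bar> \<le> C * (2/7) ^ m" for c :: "nat \<Rightarrow> real" and m
    proof -
      have "\<bar>c m * 2 ^ m\<bar> \<le> C * (2/7) ^ m * 2 ^ m" unfolding abs_mult using that[of m] by (intro mult_mono) (use abC(1) in auto)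
      also have "\<dots> = C * ((2/7) * 2) ^ m" by (simp only: power_mult_distrib mult.assoc)
      finally show ?thesis by simp
    qed
    have sa2: "summable (\<lambda>m. norm (a m * 2 ^ m))"
      by (rule summable_comparison_test'[OF sum27(2), of 0]) (use b47[OF abC(3)] in auto)
    have sb2: "summable (\<lambda>m. norm (b m * 2 ^ m))"
      by (rule summable_comparison_test'[OF sum27(2), of 0]) (use b47[OF abC(4)] in auto)
    have s13: "(\<lambda>i. (1/3::real) ^ i) sums (3/2)" using geometric_sums[of "1/3::real"] by simp
    have s23: "(\<lambda>i. (2/3::real) ^ i) sums 3" using geometric_sums[of "2/3::real"] by simp
    \<comment> \<open>The series of \<open>g1\<close> at z = 2. The value 6 is x/(1-x)^2 at x =
      2/3.\<close>
    have s23': "(\<lambda>i. - real i * ln 3 * (2/3::real) ^ i) sums (- ln 3 * 6)"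
    proof -
      have "(\<lambda>n. of_nat (Suc n) * (2/3::real) ^ n) sums (1 / (1 - 2/3)\<^sup>2)" by (rule geometric_deriv_sums) simp
      from sums_mult[OF this, of "2/3"] have "(\<lambda>n. real (Suc n) * (2/3) ^ Suc n) sums 6"
        by (simp add: power2_eq_square mult_ac)
      hence "(\<lambda>n. real n * (2/3) ^ n) sums 6" by (subst (asm) sums_Suc_iff) simp
      from sums_mult[OF this, of "- ln 3"] show ?thesis by (simp add: mult_ac)
    qed
    have sn: "summable (\<lambda>i. norm ((1/3::real) ^ i))" "summable (\<lambda>i. norm ((2/3::real) ^ i))"
      by (simp_all add: norm_power summable_geometric)
    have sn': "summable (\<lambda>i. norm (- real i * ln 3 * (2/3::real) ^ i))"
    proof -
      have "(\<lambda>i. norm (- real i * ln 3 * (2/3::real) ^ i)) = (\<lambda>i. - (- real i * ln 3 * (2/3::real) ^ i))"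
        using ln3 by (auto simp: abs_mult)
      thus ?thesis using summable_minus[OF sums_summable[OF s23']] by simp
    qed
    have A1: "a sums (\<Prod>p | prime p \<and> p \<le> (3::nat). 1 - 1 / real p)"
      using abC(5) unfolding exp_kernel_log0_1[OF order_refl] by (simp only: Re_complex_of_real)
    have A2: "(\<lambda>m. a m * 2 ^ m) sums d_const 3"
      using abC(6) unfolding exp_kernel_log0_2[OF order_refl] by (simp only: Re_complex_of_real)
    have B2: "(\<lambda>m. b m * 2 ^ m) sums (d_const 3 * (2 * c_const 3))"
      using abC(7) unfolding exp_kernel_log0_2[OF order_refl] kernel_log1_2[OF order_refl] of_real_mult[symmetric]
      by (simp only: Re_complex_of_real)
    have "(\<lambda>m. \<Sum>i\<le>m. (1/3) ^ i * a (m - i)) sums ((\<Sum>i. (1/3) ^ i) * (\<Sum>i. a i))"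
      by (rule Cauchy_product_sums[OF sn(1) sa])
    thus "a' sums (\<Prod>p | prime p \<and> p \<le> y. 1 - 1 / real p)"
      unfolding y2 constants_2_conv_3(1) a'_def g0_def sums_unique[OF s13, symmetric] sums_unique[OF A1, symmetric]
      by (simp add: atLeast0AtMost mult.commute)
    \<comment> \<open>With A and B belonging to y = 3, the new B(2) is 3 B(2) - 6 ln 3 A(2) = 6 d_3
      (c_3 - ln 3), which is 2 c_2 d_2.\<close>
    have "(\<lambda>m. (\<Sum>i\<le>m. (2/3) ^ i * (b (m - i) * 2 ^ (m - i))) + (\<Sum>i\<le>m. (- real i * ln 3 * (2/3) ^ i) * (a (m - i) * 2 ^ (m - i))))
       sums ((\<Sum>i. (2/3) ^ i) * (\<Sum>i. b i * 2 ^ i) + (\<Sum>i. - real i * ln 3 * (2/3) ^ i) * (\<Sum>i. a i * 2 ^ i))"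
      by (intro sums_add Cauchy_product_sums sn sn' sa2 sb2)
    also have "(\<Sum>i. (2/3) ^ i) * (\<Sum>i. b i * 2 ^ i) + (\<Sum>i. - real i * ln 3 * (2/3) ^ i) * (\<Sum>i. a i * 2 ^ i) =
        2 * c_const 2 * d_const 2"
      unfolding sums_unique[OF s23, symmetric] sums_unique[OF s23', symmetric] sums_unique[OF A2, symmetric]
        sums_unique[OF B2, symmetric] constants_2_conv_3(2,3) by (simp add: algebra_simps)
    also have "(\<lambda>m. (\<Sum>i\<le>m. (2/3) ^ i * (b (m - i) * 2 ^ (m - i))) + (\<Sum>i\<le>m. (- real i * ln 3 * (2/3) ^ i) * (a (m - i) * 2 ^ (m - i)))) =
        (\<lambda>m. b' m * 2 ^ m)"
    proof (rule ext)
      fix m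
      have e: "(2/3::real) ^ i * 2 ^ (m - i) = (1/3) ^ i * 2 ^ m" if "i \<le> m" for i
      proof -
        have "(2/3::real) ^ i * 2 ^ (m - i) = (1/3) ^ i * (2 ^ i * 2 ^ (m - i))" by (simp add: power_divide)
        thus ?thesis using that by (simp add: power_add[symmetric])
      qed
      show "(\<Sum>i\<le>m. (2/3) ^ i * (b (m - i) * 2 ^ (m - i))) + (\<Sum>i\<le>m. (- real i * ln 3 * (2/3) ^ i) * (a (m - i) * 2 ^ (m - i))) = b' m * 2 ^ m"
        unfolding b'_def sum_distrib_right sum.distrib[symmetric] atLeast0AtMost
      proof (rule sum.cong)
        fix i assume "i \<in> {..m}"
        hence i: "i \<le> m" by simp
        have "(2/3) ^ i * (b (m - i) * 2 ^ (m - i)) + (- real i * ln 3 * (2/3) ^ i) * (a (m - i) * 2 ^ (m - i)) =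
              (b (m - i) - real i * ln 3 * a (m - i)) * ((2/3) ^ i * 2 ^ (m - i))" by (simp add: algebra_simps)
        also have "\<dots> = (g0 i * b (m - i) + g1 i * a (m - i)) * 2 ^ m"
          unfolding e[OF i] by (simp add: g0_def g1_def algebra_simps)
        finally show "(2/3) ^ i * (b (m - i) * 2 ^ (m - i)) + (- real i * ln 3 * (2/3) ^ i) * (a (m - i) * 2 ^ (m - i)) =
              (g0 i * b (m - i) + g1 i * a (m - i)) * 2 ^ m" .
      qed simp
    qed
    finally show "(\<lambda>m. b' m * 2 ^ m) sums (2 * c_const y * d_const y)" unfolding y2 .
  qed
qed

section \<open>Integrals and tails\<close>

text \<open>The factor u tames the logarithm: at u = 0 the value is 0 whatever \<open>ln 0\<close>
  is, and this is also the limit.\<close>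

lemma continuous_on_mult_ln_power: "continuous_on {0..1} (\<lambda>u::real. u * (- ln u) ^ j)"
proof -
  have "((\<lambda>u::real. u * (- ln u) ^ j) \<longlongrightarrow> u * (- ln u) ^ j) (at u within {0..1})" if u: "u \<in> {0..1}" for u
  proof (cases "u = 0")
    case True
    have "((\<lambda>u::real. u * (- ln u) ^ j) \<longlongrightarrow> 0) (at_right 0)" by real_asymp
    moreover have "at 0 within {0..1} = at_right (0::real)" by (rule at_within_Icc_at_right) simp
    ultimately show ?thesis using True by simp
  next
    case False
    thus ?thesis using u by (intro tendsto_intros) auto
  qed
  thus ?thesis by (simp add: continuous_on_def)
qed

text \<open>Integration by parts, by induction on j. The function u^(a+1) (-ln u)^(j+1) / (j+1)!
  vanishes at both ends, and its derivative is a+1 times the integrand for j+1 minus the integrand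
  for j.\<close>

lemma has_integral_power_mult_ln_power:
  "((\<lambda>u::real. u ^ a * (- ln u) ^ j / fact j) has_integral 1 / (real a + 1) ^ Suc j) {0<..<1}"
proof (induction j)
  case 0
  have "((\<lambda>u::real. u ^ a) has_integral (1 ^ Suc a / (real a + 1) - 0 ^ Suc a / (real a + 1))) {0..1}"
  proof (rule fundamental_theorem_of_calculus)
    fix x :: real
    have "((\<lambda>u. u ^ Suc a / (real a + 1)) has_real_derivative real (Suc a) * x ^ (Suc a - Suc 0) / (real a + 1)) (at x within {0..1})"
      by (intro DERIV_cdivide DERIV_pow)
    moreover have "real (Suc a) * x ^ (Suc a - Suc 0) / (real a + 1) = x ^ a" by (simp add: field_simps)
    ultimately show "((\<lambda>u. u ^ Suc a / (real a + 1)) has_vector_derivative x ^ a) (at x within {0..1})"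
      by (simp only: has_real_derivative_iff_has_vector_derivative)
  qed simp
  thus ?case by (simp add: has_integral_Icc_iff_Ioo)
next
  case (Suc j)
  let ?F = "\<lambda>u::real. u ^ Suc a * (- ln u) ^ Suc j / fact (Suc j)"
  let ?F' = "\<lambda>u::real. (real a + 1) * (u ^ a * (- ln u) ^ Suc j / fact (Suc j)) - u ^ a * (- ln u) ^ j / fact j"
  have "(?F' has_integral (?F 1 - ?F 0)) {0..1}"
  proof (rule fundamental_theorem_of_calculus_interior)
    have "continuous_on {0..1} (\<lambda>u::real. u ^ a * (u * (- ln u) ^ Suc j) / fact (Suc j))"
      by (intro continuous_on_mult continuous_on_divide continuous_on_power continuous_on_id continuous_on_const continuous_on_mult_ln_power) auto
    thus "continuous_on {0..1} ?F" by (simp add: mult_ac)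
    fix x :: real assume x: "x \<in> {0<..<1}"
    have "(?F has_real_derivative (x ^ Suc a * (real (Suc j) * (- (1 / x) * (- ln x) ^ (Suc j - Suc 0))) +
             real (Suc a) * x ^ (Suc a - Suc 0) * (- ln x) ^ Suc j) / fact (Suc j)) (at x)"
      by (intro DERIV_cdivide DERIV_mult' DERIV_pow DERIV_power DERIV_minus DERIV_ln_divide) (use x in auto)
    moreover have "(x ^ Suc a * (real (Suc j) * (- (1 / x) * (- ln x) ^ (Suc j - Suc 0))) +
             real (Suc a) * x ^ (Suc a - Suc 0) * (- ln x) ^ Suc j) / fact (Suc j) = ?F' x"
    proof -
      have "x ^ Suc a * (real (Suc j) * (- (1 / x) * (- ln x) ^ (Suc j - Suc 0))) / fact (Suc j) =
            (x * (1 / x)) * (real (Suc j) / fact (Suc j)) * (- (x ^ a * (- ln x) ^ j))" by simp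
      also have "real (Suc j) / fact (Suc j) = 1 / fact j" by simp
      also have "x * (1 / x) = 1" using x by simp
      finally have "x ^ Suc a * (real (Suc j) * (- (1 / x) * (- ln x) ^ (Suc j - Suc 0))) / fact (Suc j) =
        1 * (1 / fact j) * (- (x ^ a * (- ln x) ^ j))" .
      moreover have "real (Suc a) * x ^ (Suc a - Suc 0) * (- ln x) ^ Suc j / fact (Suc j) =
        (real a + 1) * (x ^ a * (- ln x) ^ Suc j / fact (Suc j))"
        by (simp only: diff_Suc_Suc diff_zero of_nat_Suc times_divide_eq_right mult.assoc add.commute)
      ultimately show ?thesis unfolding add_divide_distrib by (simp del: power_Suc fact_Suc)
    qed
    ultimately show "(?F has_vector_derivative ?F' x) (at x)"
      by (simp only: has_real_derivative_iff_has_vector_derivative)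
  qed auto
  hence "(?F' has_integral 0) {0<..<1}" by (simp add: has_integral_Icc_iff_Ioo)
  from has_integral_add[OF this Suc.IH]
  have "((\<lambda>u::real. (real a + 1) * (u ^ a * (- ln u) ^ Suc j / fact (Suc j))) has_integral 1 / (real a + 1) ^ Suc j) {0<..<1}"
    by simp
  from has_integral_mult_right[OF this, of "1 / (real a + 1)"]
  have "((\<lambda>u::real. 1 / (real a + 1) * ((real a + 1) * (u ^ a * (- ln u) ^ Suc j / fact (Suc j)))) has_integral 1 / (real a + 1) * (1 / (real a + 1) ^ Suc j)) {0<..<1}" .
  moreover have "1 / (real a + 1) * ((real a + 1) * v) = v" for v :: real by simp
  moreover have "1 / (real a + 1) * (1 / (real a + 1) ^ Suc j) = 1 / (real a + 1) ^ Suc (Suc j)" by simp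
  ultimately show ?case by (simp only:)
qed

section \<open>Termwise integration over 0 < u < 1, and tails of series\<close>

lemma has_integral_powr_neg:
  fixes n :: nat
  assumes n: "n \<ge> 2"
  shows "((\<lambda>u. real n powr (-(1 + u))) has_integral (1 / real n - 1 / (real n)\<^sup>2) / ln (real n)) {0<..<1}"
proof -
  have ln0: "ln (real n) \<noteq> 0" using n by simp
  have "((\<lambda>u. real n powr (-(1 + u))) has_integral
          (- (real n powr (-(1 + 1))) / ln (real n) - (- (real n powr (-(1 + 0))) / ln (real n)))) {0..1}"
  proof (rule fundamental_theorem_of_calculus)
    fix u :: real
    have "((\<lambda>u. - (real n powr (-(1 + u))) / ln (real n)) has_real_derivative real n powr (-(1 + u))) (at u within {0..1})"
    proof -
      have "((\<lambda>u. - exp (- (1 + u) * ln (real n)) / ln (real n)) has_real_derivative exp (- (1 + u) * ln (real n))) (at u within {0..1})"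
        using ln0 by (auto intro!: derivative_eq_intros)
      thus ?thesis using n by (simp add: powr_def)
    qed
    thus "((\<lambda>u. - (real n powr (-(1 + u))) / ln (real n)) has_vector_derivative real n powr (-(1 + u))) (at u within {0..1})"
      by (simp only: has_real_derivative_iff_has_vector_derivative)
  qed auto
  moreover have "real n powr (-(1 + 1)) = 1 / (real n)\<^sup>2" "real n powr (-(1 + 0)) = 1 / real n"
    using n by (simp_all add: powr_minus_divide)
  ultimately show ?thesis by (simp add: has_integral_Icc_iff_Ioo diff_divide_distrib)
qed

lemma has_sum_iff_has_sum_if: "(f has_sum s) A \<longleftrightarrow> ((\<lambda>x. if x \<in> A then f x else 0) has_sum s) UNIV"
  by (rule has_sum_cong_neutral) auto

text \<open>The partial sums increase, so monotone convergence asks only for a bound on their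
  integrals, which the integrable majorant \<open>G\<close> supplies. The subtracted 1/n^2 is the
  endpoint u = 1.\<close>

lemma powr_sum_eq_integral_plus:
  fixes A :: "nat set" and G :: "real \<Rightarrow> real"
  assumes A: "\<And>n. n \<in> A \<Longrightarrow> n \<ge> 2"
    and G: "(G has_integral I) {0<..<1}" "\<And>u. u \<in> {0<..<1} \<Longrightarrow> (\<Sum>\<^sub>\<infinity>n\<in>A. real n powr (-(1 + u))) \<le> G u"
  defines "P \<equiv> \<lambda>u. \<Sum>\<^sub>\<infinity>n\<in>A. real n powr (-(1 + u))"
  shows "P integrable_on {0<..<1}"
    and "((\<lambda>n. (1 / real n - 1 / (real n)\<^sup>2) / ln (real n)) has_sum integral {0<..<1} P) A"
proof -
  let ?t = "\<lambda>n u. if n \<in> A then real n powr (-(1 + u)) else 0"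
  let ?i = "\<lambda>n. if n \<in> A then (1 / real n - 1 / (real n)\<^sup>2) / ln (real n) else 0"
  have t: "(?t n has_integral ?i n) {0<..<1}" for n
    using has_integral_powr_neg[of n] A[of n] by (cases "n \<in> A") auto
  have f: "((\<lambda>u. \<Sum>n<N. ?t n u) has_integral (\<Sum>n<N. ?i n)) {0<..<1}" for N
    by (intro has_integral_sum t) auto
  have int_f: "integral {0<..<1} (\<lambda>u. \<Sum>n<N. ?t n u) = (\<Sum>n<N. ?i n)" for N
    using f by (rule integral_unique)
  have hs: "((\<lambda>n. ?t n u) has_sum P u) UNIV" if u: "u \<in> {0<..<1}" for u
  proof -
    have "((\<lambda>n. real n powr (-(1 + u))) has_sum P u) A"
      unfolding P_def by (intro has_sum_infsum summable_on_powr_nat) (use u in auto)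
    thus ?thesis by (rule iffD1[OF has_sum_iff_has_sum_if])
  qed
  have lim: "(\<lambda>N. \<Sum>n<N. ?t n u) \<longlonglongrightarrow> P u" if u: "u \<in> {0<..<1}" for u
    using has_sum_imp_sums[OF hs[OF u]] by (simp add: sums_def)
  have i0: "?i n \<ge> 0" for n
  proof (cases "n \<in> A")
    case True
    hence "real n * 1 \<le> real n * real n" using A[OF True] by (intro mult_left_mono) auto
    hence "1 / (real n)\<^sup>2 \<le> 1 / real n" using A[OF True] by (intro frac_le) (auto simp: power2_eq_square)
    thus ?thesis using A[OF True] by auto
  qed auto
  have le: "(\<Sum>n<N. ?i n) \<le> I" for N
  proof (rule has_integral_le[OF f G(1)])
    fix u :: real assume u: "u \<in> {0<..<1}"
    have "(\<Sum>n<N. ?t n u) \<le> P u"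
      by (rule finite_sum_le_has_sum[OF hs[OF u]]) auto
    thus "(\<Sum>n<N. ?t n u) \<le> G u" using G(2)[OF u] by (simp add: P_def)
  qed
  have "P integrable_on {0<..<1} \<and> (\<lambda>N. integral {0<..<1} (\<lambda>u. \<Sum>n<N. ?t n u)) \<longlonglongrightarrow> integral {0<..<1} P"
  proof (rule monotone_convergence_increasing)
    show "bounded (range (\<lambda>N. integral {0<..<1} (\<lambda>u. \<Sum>n<N. ?t n u)))"
      unfolding int_f by (rule boundedI[of _ I]) (use le i0 in \<open>auto simp: sum_nonneg abs_of_nonneg\<close>)
  qed (use f lim in auto)
  thus "P integrable_on {0<..<1}" and "((\<lambda>n. (1 / real n - 1 / (real n)\<^sup>2) / ln (real n)) has_sum integral {0<..<1} P) A"
  proof -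
    assume *: "P integrable_on {0<..<1} \<and> (\<lambda>N. integral {0<..<1} (\<lambda>u. \<Sum>n<N. ?t n u)) \<longlonglongrightarrow> integral {0<..<1} P"
    thus "P integrable_on {0<..<1}" by simp
    have "?i sums integral {0<..<1} P" using * unfolding int_f by (simp add: sums_def)
    hence "(?i has_sum integral {0<..<1} P) UNIV" by (rule sums_nonneg_imp_has_sum) (rule i0)
    thus "((\<lambda>n. (1 / real n - 1 / (real n)\<^sup>2) / ln (real n)) has_sum integral {0<..<1} P) A"
      by (rule iffD2[OF has_sum_iff_has_sum_if])
  qed
qed

text \<open>The inequality i + k + 2 <= (k+1)(i+2) separates the tail index from k, so the tail
  keeps the shape (k+1)^2 r^k times a convergent series in i.\<close>

lemma sums_tail_bound:
  fixes c :: "nat \<Rightarrow> real"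
  assumes s: "c sums s" and c: "\<And>m. \<bar>c m\<bar> \<le> C * (real m + 1)\<^sup>2 * r ^ m" and C: "C \<ge> 0" and r: "0 \<le> r" "r \<le> 1"
    and sr: "summable (\<lambda>i. (real i + 2)\<^sup>2 * r ^ i)"
  shows "\<bar>s - (\<Sum>m\<le>k. c m)\<bar> \<le> C * (\<Sum>i. (real i + 2)\<^sup>2 * r ^ i) * (real k + 1)\<^sup>2 * r ^ k"
proof -
  have "(\<lambda>i. c (i + Suc k)) sums (s - (\<Sum>m<Suc k. c m))" using s by (rule sums_split_initial_segment)
  hence 1: "(\<lambda>i. c (i + Suc k)) sums (s - (\<Sum>m\<le>k. c m))" by (simp only: lessThan_Suc_atMost)
  have 2: "(\<lambda>i. C * (real k + 1)\<^sup>2 * r ^ k * ((real i + 2)\<^sup>2 * r ^ i)) sums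
     (C * (real k + 1)\<^sup>2 * r ^ k * (\<Sum>i. (real i + 2)\<^sup>2 * r ^ i))"
    by (intro sums_mult summable_sums sr)
  have "norm (\<Sum>i. c (i + Suc k)) \<le> (\<Sum>i. C * (real k + 1)\<^sup>2 * r ^ k * ((real i + 2)\<^sup>2 * r ^ i))"
  proof (rule norm_suminf_le)
    fix i
    have "real (i + Suc k) + 1 \<le> (real k + 1) * (real i + 2)" by (simp add: algebra_simps)
    hence "(real (i + Suc k) + 1)\<^sup>2 \<le> ((real k + 1) * (real i + 2))\<^sup>2" by (intro power_mono) auto
    moreover have "r ^ (i + Suc k) \<le> r ^ k * r ^ i"
      using r by (simp add: power_add mult_left_le_one_le mult.commute)
    ultimately have "(real (i + Suc k) + 1)\<^sup>2 * r ^ (i + Suc k) \<le> ((real k + 1) * (real i + 2))\<^sup>2 * (r ^ k * r ^ i)"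
      using r by (intro mult_mono) auto
    from mult_left_mono[OF this C] c[of "i + Suc k"]
    have "\<bar>c (i + Suc k)\<bar> \<le> C * (((real k + 1) * (real i + 2))\<^sup>2 * (r ^ k * r ^ i))" by (simp only: mult.assoc)
    thus "norm (c (i + Suc k)) \<le> C * (real k + 1)\<^sup>2 * r ^ k * ((real i + 2)\<^sup>2 * r ^ i)"
      by (simp add: power_mult_distrib mult_ac)
  qed (rule sums_summable[OF 2])
  thus ?thesis using sums_unique[OF 1] sums_unique[OF 2] by (simp add: mult_ac)
qed

section \<open>Summation of the expansion\<close>

lemma summable_square_mult_power:
  "summable (\<lambda>i. (real i + 2)\<^sup>2 * (1/3) ^ i)" "summable (\<lambda>i. (real i + 2)\<^sup>2 * (2/3) ^ i)"
proof -
  \<comment> \<open>A ratio strictly between 2/3 and 1 absorbs the polynomial factor in both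
    series.\<close>
  have s: "summable (\<lambda>i. norm ((5/6::real) ^ i))" by (simp add: norm_power summable_geometric)
  show "summable (\<lambda>i. (real i + 2)\<^sup>2 * (1/3) ^ i)"
    by (rule summable_comparison_test_bigo[OF s]) real_asymp
  show "summable (\<lambda>i. (real i + 2)\<^sup>2 * (2/3) ^ i)"
    by (rule summable_comparison_test_bigo[OF s]) real_asymp
qed

lemma rough_numbers_eq: "rough_numbers k y = almost_primes {p. prime p \<and> p > y} k"
  by (auto simp: rough_numbers_def almost_primes_def)

context
  fixes S :: "nat set" and a b :: "nat \<Rightarrow> real" and C :: real
  assumes C: "C \<ge> 0"
    and expansion: "log_expansion (almost_prime_sum S) a b (\<lambda>m. C * (real m + 1)\<^sup>2 * (1/3) ^ m)"
begin

lemma has_integral_log_polynomial: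
  "((\<lambda>u. \<Sum>j=0..k. c (k - j) * (u ^ d * (- ln u) ^ j / fact j)) has_integral
     (\<Sum>j=0..k. c (k - j) * (1 / (real d + 1) ^ Suc j))) {0<..<1}"
  by (intro has_integral_sum has_integral_mult_right has_integral_power_mult_ln_power) auto

text \<open>Extraction of the coefficient of z^k in u^(-z) K_u(z). The powers u^0, u^1, u^2 stay
  unsimplified to match \<open>has_integral_log_polynomial\<close>.\<close>

lemma almost_prime_sum_approx:
  assumes u: "0 < u" "u \<le> 1"
  shows "\<bar>almost_prime_sum S k (1 + u) - ((\<Sum>j=0..k. a (k - j) * (u ^ 0 * (- ln u) ^ j / fact j)) +
             (\<Sum>j=0..k. b (k - j) * (u ^ 1 * (- ln u) ^ j / fact j)))\<bar>
         \<le> (\<Sum>j=0..k. C * (real (k - j) + 1)\<^sup>2 * (1/3) ^ (k - j) * (u ^ 2 * (- ln u) ^ j / fact j))"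
proof -
  obtain \<kappa> where \<kappa>: "Abs_fps (\<lambda>m. almost_prime_sum S m (1 + u)) = fps_exp (- ln u) * Abs_fps \<kappa>"
    "\<And>m. \<bar>\<kappa> m - a m - b m * u\<bar> \<le> C * (real m + 1)\<^sup>2 * (1/3) ^ m * u\<^sup>2"
    using expansion u unfolding log_expansion_def by blast
  have L: "- ln u \<ge> 0" using u by simp
  have "almost_prime_sum S k (1 + u) = fps_nth (fps_exp (- ln u) * Abs_fps \<kappa>) k"
    unfolding \<kappa>(1)[symmetric] by simp
  also have "\<dots> = (\<Sum>j=0..k. (- ln u) ^ j / fact j * \<kappa> (k - j))" by (simp add: fps_mult_nth)
  finally have "almost_prime_sum S k (1 + u) - ((\<Sum>j=0..k. a (k - j) * (u ^ 0 * (- ln u) ^ j / fact j)) +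
             (\<Sum>j=0..k. b (k - j) * (u ^ 1 * (- ln u) ^ j / fact j))) =
        (\<Sum>j=0..k. (- ln u) ^ j / fact j * (\<kappa> (k - j) - a (k - j) - b (k - j) * u))"
    by (simp add: sum_subtractf[symmetric] sum.distrib[symmetric] algebra_simps)
  also have "\<bar>\<dots>\<bar> \<le> (\<Sum>j=0..k. C * (real (k - j) + 1)\<^sup>2 * (1/3) ^ (k - j) * (u ^ 2 * (- ln u) ^ j / fact j))"
  proof (intro order_trans[OF sum_abs] sum_mono)
    fix j
    have l: "0 \<le> (- ln u) ^ j / fact j" using L by simp
    have "\<bar>(- ln u) ^ j / fact j * (\<kappa> (k - j) - a (k - j) - b (k - j) * u)\<bar> \<le>
          (- ln u) ^ j / fact j * (C * (real (k - j) + 1)\<^sup>2 * (1/3) ^ (k - j) * u\<^sup>2)"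
      unfolding abs_mult abs_of_nonneg[OF l] by (intro mult_left_mono \<kappa>(2) l)
    thus "\<bar>(- ln u) ^ j / fact j * (\<kappa> (k - j) - a (k - j) - b (k - j) * u)\<bar> \<le>
          C * (real (k - j) + 1)\<^sup>2 * (1/3) ^ (k - j) * (u ^ 2 * (- ln u) ^ j / fact j)" by (simp add: mult_ac)
  qed
  finally show ?thesis .
qed

lemma almost_prime_integral:
  assumes k: "k \<ge> 1"
  defines "P \<equiv> \<lambda>u. almost_prime_sum S k (1 + u)"
  shows "((\<lambda>n. (1 / real n - 1 / (real n)\<^sup>2) / ln (real n)) has_sum integral {0<..<1} P) (almost_primes S k)"
    and "\<bar>integral {0<..<1} P - ((\<Sum>m\<le>k. a m) + (\<Sum>m\<le>k. b m * 2 ^ m) / 2 ^ Suc k)\<bar> \<le> C * (real k + 1) ^ 3 / 3 ^ k"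
proof -
  let ?M = "\<lambda>u. (\<Sum>j=0..k. a (k - j) * (u ^ 0 * (- ln u) ^ j / fact j)) + (\<Sum>j=0..k. b (k - j) * (u ^ 1 * (- ln u) ^ j / fact j))"
  let ?E = "\<lambda>u. \<Sum>j=0..k. C * (real (k - j) + 1)\<^sup>2 * (1/3) ^ (k - j) * (u ^ 2 * (- ln u) ^ j / fact j)"
  define IM where "IM = (\<Sum>j=0..k. a (k - j) * (1 / (real 0 + 1) ^ Suc j)) + (\<Sum>j=0..k. b (k - j) * (1 / (real 1 + 1) ^ Suc j))"
  define IE where "IE = (\<Sum>j=0..k. C * (real (k - j) + 1)\<^sup>2 * (1/3) ^ (k - j) * (1 / (real 2 + 1) ^ Suc j))"
  have M: "(?M has_integral IM) {0<..<1}" unfolding IM_def by (intro has_integral_add has_integral_log_polynomial)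
  have E: "(?E has_integral IE) {0<..<1}"
    unfolding IE_def by (rule has_integral_log_polynomial[of "\<lambda>m. C * (real m + 1)\<^sup>2 * (1/3) ^ m"])
  have approx: "\<bar>P u - ?M u\<bar> \<le> ?E u" if "u \<in> {0<..<1}" for u
    unfolding P_def by (rule almost_prime_sum_approx) (use that in auto)
  \<comment> \<open>k >= 1 excludes n = 1, where ln n vanishes.\<close>
  have A: "n \<ge> 2" if "n \<in> almost_primes S k" for n
  proof -
    have "n > 0" "n \<noteq> 1" using that k by (auto simp: almost_primes_def big_omega_def)
    thus ?thesis by simp
  qed
  have P_eq: "P = (\<lambda>u. \<Sum>\<^sub>\<infinity>n\<in>almost_primes S k. real n powr (-(1 + u)))"
    by (simp add: P_def almost_prime_sum_def)
  have le: "(\<Sum>\<^sub>\<infinity>n\<in>almost_primes S k. real n powr (-(1 + u))) \<le> ?M u + ?E u" if "u \<in> {0<..<1}" for u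
    using approx[OF that] unfolding P_eq by (simp only: abs_le_iff) linarith
  \<comment> \<open>Main part plus error bound serve as the integrable majorant, so the expansion
    itself proves that \<open>P\<close> is integrable.\<close>
  note int = powr_sum_eq_integral_plus[OF A has_integral_add[OF M E] le, folded P_eq]
  show "((\<lambda>n. (1 / real n - 1 / (real n)\<^sup>2) / ln (real n)) has_sum integral {0<..<1} P) (almost_primes S k)"
    by (rule int(2))
  have hP: "(P has_integral integral {0<..<1} P) {0<..<1}" by (rule integrable_integral[OF int(1)])
  have "norm (integral {0<..<1} P - IM) \<le> IE"
  proof -
    have hD: "((\<lambda>u. P u - ?M u) has_integral (integral {0<..<1} P - IM)) {0<..<1}" by (rule has_integral_diff[OF hP M])
    have "integral {0<..<1} P - IM \<le> IE"
      by (rule has_integral_le[OF hD E]) (use approx in \<open>force simp: abs_le_iff\<close>)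
    moreover have "- IE \<le> integral {0<..<1} P - IM"
      by (rule has_integral_le[OF has_integral_neg[OF E] hD]) (use approx in \<open>force simp: abs_le_iff\<close>)
    ultimately show ?thesis by (simp add: abs_le_iff)
  qed
  moreover have "IM = (\<Sum>m\<le>k. a m) + (\<Sum>m\<le>k. b m * 2 ^ m) / 2 ^ Suc k"
  proof -
    have "(\<Sum>j=0..k. a (k - j) * (1 / (real 0 + 1) ^ Suc j)) = (\<Sum>m\<le>k. a m)"
      using sum.atLeastAtMost_rev[of a 0 k] by (simp add: atLeast0AtMost)
    moreover have "(\<Sum>j=0..k. b (k - j) * (1 / (real 1 + 1) ^ Suc j)) = (\<Sum>m\<le>k. b m * 2 ^ m) / 2 ^ Suc k"
    proof -
      have "(\<Sum>m\<le>k. b m * 2 ^ m) = (\<Sum>j=0..k. b (k - j) * 2 ^ (k - j))"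
        using sum.atLeastAtMost_rev[of "\<lambda>m. b m * 2 ^ m" 0 k] by (simp add: atLeast0AtMost)
      hence "(\<Sum>m\<le>k. b m * 2 ^ m) / 2 ^ Suc k = (\<Sum>j=0..k. b (k - j) * 2 ^ (k - j) / 2 ^ Suc k)"
        by (simp only: sum_divide_distrib)
      also have "\<dots> = (\<Sum>j=0..k. b (k - j) * (1 / (real 1 + 1) ^ Suc j))"
      proof (rule sum.cong)
        fix j assume "j \<in> {0..k}"
        hence "(2::real) ^ Suc k = 2 ^ (k - j) * 2 ^ Suc j" by (simp only: power_add[symmetric]) simp
        thus "b (k - j) * 2 ^ (k - j) / 2 ^ Suc k = b (k - j) * (1 / (real 1 + 1) ^ Suc j)" by (simp del: power_Suc)
      qed simp
      finally show ?thesis ..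
    qed
    ultimately show ?thesis unfolding IM_def by simp
  qed
  moreover have "IE \<le> C * (real k + 1) ^ 3 / 3 ^ k"
  proof -
    \<comment> \<open>Each of the k + 1 terms is at most C (k+1)^2 / 3^k; this produces the
      cube.\<close>
    have "IE \<le> (\<Sum>j=0..k. C * (real k + 1)\<^sup>2 / 3 ^ k)"
      unfolding IE_def
    proof (rule sum_mono)
      fix j assume j: "j \<in> {0..k}"
      have "(1/3::real) ^ (k - j) * (1 / (real 2 + 1) ^ Suc j) = 1 / (3 ^ (k - j) * 3 ^ Suc j)"
        by (simp add: power_divide)
      also have "3 ^ (k - j) * 3 ^ Suc j = (3::real) ^ Suc k" using j by (simp only: power_add[symmetric]) simp
      also have "1 / (3::real) ^ Suc k \<le> 1 / 3 ^ k" by (intro frac_le) auto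
      finally have "(1/3::real) ^ (k - j) * (1 / (real 2 + 1) ^ Suc j) \<le> 1 / 3 ^ k" .
      moreover have "C * (real (k - j) + 1)\<^sup>2 \<le> C * (real k + 1)\<^sup>2" using C by (intro mult_left_mono power_mono) auto
      ultimately have "(C * (real (k - j) + 1)\<^sup>2) * ((1/3) ^ (k - j) * (1 / (real 2 + 1) ^ Suc j)) \<le> (C * (real k + 1)\<^sup>2) * (1 / 3 ^ k)"
        using C by (intro mult_mono) auto
      thus "C * (real (k - j) + 1)\<^sup>2 * (1/3) ^ (k - j) * (1 / (real 2 + 1) ^ Suc j) \<le> C * (real k + 1)\<^sup>2 / 3 ^ k"
        by (simp only: mult.assoc times_divide_eq_right mult_1_right)
    qed
    also have "\<dots> = C * (real k + 1) ^ 3 / 3 ^ k" by (simp add: power2_eq_square power3_eq_cube add.commute mult_ac)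
    finally show ?thesis .
  qed
  ultimately show "\<bar>integral {0<..<1} P - ((\<Sum>m\<le>k. a m) + (\<Sum>m\<le>k. b m * 2 ^ m) / 2 ^ Suc k)\<bar> \<le> C * (real k + 1) ^ 3 / 3 ^ k"
    by simp
qed

text \<open>At u = 1 the factor u^(-z) is 1, so the sum at s = 2 is the coefficient \<kappa>_k(1)
  itself. The bounds for a_k, b_k and the error add up to the factor 3.\<close>

lemma almost_prime_sum_2_bound:
  assumes "\<bar>a k\<bar> \<le> C * (real k + 1)\<^sup>2 * (1/3) ^ k" "\<bar>b k\<bar> \<le> C * (real k + 1)\<^sup>2 * (1/3) ^ k"
  shows "almost_prime_sum S k 2 \<le> 3 * (C * (real k + 1)\<^sup>2 * (1/3) ^ k)"
proof -
  obtain \<kappa> where \<kappa>: "\<And>u. 0 < u \<Longrightarrow> u \<le> 1 \<Longrightarrow>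
       Abs_fps (\<lambda>m. almost_prime_sum S m (1 + u)) = fps_exp (- ln u) * Abs_fps (\<kappa> u)"
    "\<And>u m. 0 < u \<Longrightarrow> u \<le> 1 \<Longrightarrow> \<bar>\<kappa> u m - a m - b m * u\<bar> \<le> C * (real m + 1)\<^sup>2 * (1/3) ^ m * u\<^sup>2"
    by (rule log_expansionE[OF expansion], rule that)
  have "almost_prime_sum S k 2 = fps_nth (Abs_fps (\<lambda>m. almost_prime_sum S m (1 + 1))) k" by simp
  also have "\<dots> = \<kappa> 1 k" by (subst \<kappa>(1)) simp_all
  finally show ?thesis using \<kappa>(2)[of 1 k] assms by (simp add: abs_le_iff)
qed

text \<open>Adds the range s >= 2: the integral of n^(-s) from 2 to infinity is 1/(n^2 ln n), at
  most n^(-2) / ln 2.\<close>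

lemma almost_prime_inverse_ln_sum:
  assumes k: "k \<ge> 1"
  shows "(\<lambda>n. 1 / (real n * ln (real n))) summable_on almost_primes S k"
    and "\<bar>(\<Sum>\<^sub>\<infinity>n\<in>almost_primes S k. 1 / (real n * ln (real n))) - integral {0<..<1} (\<lambda>u. almost_prime_sum S k (1 + u))\<bar>
           \<le> almost_prime_sum S k 2 / ln 2"
proof -
  let ?A = "almost_primes S k"
  let ?I = "integral {0<..<1} (\<lambda>u. almost_prime_sum S k (1 + u))"
  let ?t = "\<lambda>n. 1 / (real n)\<^sup>2 / ln (real n)"
  have A: "n \<ge> 2" if "n \<in> ?A" for n
  proof -
    have "n > 0" "n \<noteq> 1" using that k by (auto simp: almost_primes_def big_omega_def)
    thus ?thesis by simp
  qed
  have s2: "((\<lambda>n. real n powr (-2) / ln 2) has_sum almost_prime_sum S k 2 / ln 2) ?A"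
    unfolding almost_prime_sum_def divide_inverse
    by (intro has_sum_cmult_left has_sum_infsum summable_on_powr_nat) simp
  have le: "norm (?t n) \<le> real n powr (-2) / ln 2" if "n \<in> ?A" for n
  proof -
    have n: "real n \<ge> 2" using A[OF that] by simp
    have "norm (?t n) = 1 / (real n)\<^sup>2 / ln (real n)" using n by simp
    also have "\<dots> \<le> 1 / (real n)\<^sup>2 / ln 2" using n by (intro divide_left_mono) auto
    finally show ?thesis using n by (simp add: powr_minus_divide)
  qed
  note t = norm_infsum_le_infsum[OF has_sum_imp_summable[OF s2] le]
  have tail: "(?t has_sum infsum ?t ?A) ?A" by (rule has_sum_infsum[OF t(1)])
  from has_sum_add[OF almost_prime_integral(1)[OF k] tail]
  have hs: "((\<lambda>n. 1 / (real n * ln (real n))) has_sum (?I + infsum ?t ?A)) ?A"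
  proof (rule has_sum_cong[THEN iffD1, rotated])
    fix n assume "n \<in> ?A"
    hence "ln (real n) \<noteq> 0" using A[of n] by simp
    thus "(1 / real n - 1 / (real n)\<^sup>2) / ln (real n) + ?t n = 1 / (real n * ln (real n))"
      by (simp add: diff_divide_distrib)
  qed
  show "(\<lambda>n. 1 / (real n * ln (real n))) summable_on ?A" by (rule has_sum_imp_summable[OF hs])
  show "\<bar>(\<Sum>\<^sub>\<infinity>n\<in>?A. 1 / (real n * ln (real n))) - ?I\<bar> \<le> almost_prime_sum S k 2 / ln 2"
    using t(2) unfolding infsumI[OF hs] infsumI[OF s2] by simp
qed

end

text \<open>\<open>infsum\<close> takes the value 0 on families that are not summable, so
  summability of the series behind \<open>f_sum\<close> is part of the claim. The constant C is
  chosen after y and before k, which expresses O_y together with uniformity in k.\<close>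

theorem theorem1p3:
  fixes y :: nat
  assumes "y \<ge> 2"
  shows "(\<forall>k\<ge>1. (\<lambda>n. 1 / (real n * ln (real n))) summable_on rough_numbers k y) \<and>
         (\<exists>C. \<forall>k\<ge>1.
            \<bar>f_sum k y - ((\<Prod>p | prime p \<and> p \<le> y. 1 - 1 / real p) + c_const y * d_const y / 2 ^ k)\<bar>
              \<le> C * (real k ^ 3 / 3 ^ k))"
proof -
  let ?S = "{p. prime p \<and> p > y}"
  let ?A1 = "\<Prod>p | prime p \<and> p \<le> y. 1 - 1 / real p"
  obtain a b C where abC: "C \<ge> 0"
    "log_expansion (almost_prime_sum ?S) a b (\<lambda>m. C * (real m + 1)\<^sup>2 * (1/3) ^ m)"
    "\<And>m. \<bar>a m\<bar> \<le> C * (real m + 1)\<^sup>2 * (1/3) ^ m" "\<And>m. \<bar>b m\<bar> \<le> C * (real m + 1)\<^sup>2 * (1/3) ^ m"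
    "a sums ?A1" "(\<lambda>m. b m * 2 ^ m) sums (2 * c_const y * d_const y)"
    by (rule rough_log_expansion[OF assms], rule that)
  note loc = abC(1,2)
  define T1 T2 where "T1 = (\<Sum>i. (real i + 2)\<^sup>2 * (1/3) ^ i)" and "T2 = (\<Sum>i. (real i + 2)\<^sup>2 * (2/3) ^ i)"
  have T: "T1 \<ge> 0" "T2 \<ge> 0"
    unfolding T1_def T2_def by (intro suminf_nonneg summable_square_mult_power; simp)+
  \<comment> \<open>The four errors in turn: the integrated remainder, the tail of the a_m, the tail
    of the b_m 2^m, and the range s >= 2.\<close>
  define D where "D = C + C * T1 + C * T2 + 3 * C / ln 2"
  have D: "D \<ge> 0" using abC(1) T by (simp add: D_def)
  show ?thesis
  proof (intro conjI allI impI exI[of _ "8 * D"])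
    fix k :: nat assume k: "k \<ge> 1"
    show "(\<lambda>n. 1 / (real n * ln (real n))) summable_on rough_numbers k y"
      unfolding rough_numbers_eq by (rule almost_prime_inverse_ln_sum(1)[OF loc k])
    define I where "I = integral {0<..<1} (\<lambda>u. almost_prime_sum ?S k (1 + u))"
    define x where "x = (real k + 1) ^ 3 / 3 ^ k"
    have sq: "(real k + 1)\<^sup>2 / 3 ^ k \<le> x"
      unfolding x_def by (intro divide_right_mono power_increasing) auto
    have e0: "\<bar>I - ((\<Sum>m\<le>k. a m) + (\<Sum>m\<le>k. b m * 2 ^ m) / 2 ^ Suc k)\<bar> \<le> C * x"
      using almost_prime_integral(2)[OF loc k] by (simp add: I_def x_def)
    have "\<bar>f_sum k y - I\<bar> \<le> almost_prime_sum ?S k 2 / ln 2"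
      unfolding f_sum_def rough_numbers_eq I_def by (rule almost_prime_inverse_ln_sum(2)[OF loc k])
    also have "\<dots> \<le> 3 * (C * (real k + 1)\<^sup>2 * (1/3) ^ k) / ln 2"
      by (intro divide_right_mono almost_prime_sum_2_bound[OF loc] abC) auto
    also have "\<dots> = 3 * C / ln 2 * ((real k + 1)\<^sup>2 / 3 ^ k)" by (simp add: power_divide mult_ac)
    also have "\<dots> \<le> 3 * C / ln 2 * x" using abC(1) by (intro mult_left_mono sq) auto
    finally have e1: "\<bar>f_sum k y - I\<bar> \<le> 3 * C / ln 2 * x" .
    have "\<bar>?A1 - (\<Sum>m\<le>k. a m)\<bar> \<le> C * T1 * (real k + 1)\<^sup>2 * (1/3) ^ k"
      unfolding T1_def by (rule sums_tail_bound) (use abC summable_square_mult_power in auto)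
    also have "\<dots> = C * T1 * ((real k + 1)\<^sup>2 / 3 ^ k)" by (simp add: power_divide)
    also have "\<dots> \<le> C * T1 * x" using abC(1) T by (intro mult_left_mono sq) auto
    finally have e2: "\<bar>?A1 - (\<Sum>m\<le>k. a m)\<bar> \<le> C * T1 * x" .
    \<comment> \<open>b_m 2^m decays only like m^2 (2/3)^m, but the tail is later divided by
      2^(k+1), which restores 3^(-k).\<close>
    have "\<bar>2 * c_const y * d_const y - (\<Sum>m\<le>k. b m * 2 ^ m)\<bar> \<le> C * T2 * (real k + 1)\<^sup>2 * (2/3) ^ k"
      unfolding T2_def
    proof (rule sums_tail_bound[OF abC(6) _ abC(1) _ _ summable_square_mult_power(2)])
      fix m
      have "\<bar>b m * 2 ^ m\<bar> \<le> C * (real m + 1)\<^sup>2 * (1/3) ^ m * 2 ^ m"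
        unfolding abs_mult using abC(4)[of m] by (intro mult_mono) (use abC(1) in auto)
      also have "\<dots> = C * (real m + 1)\<^sup>2 * (2/3) ^ m" by (simp add: power_divide)
      finally show "\<bar>b m * 2 ^ m\<bar> \<le> C * (real m + 1)\<^sup>2 * (2/3) ^ m" .
    qed auto
    also have "\<dots> = C * T2 * ((real k + 1)\<^sup>2 / 3 ^ k) * 2 ^ k" by (simp add: power_divide)
    also have "\<dots> \<le> C * T2 * x * 2 ^ k" using abC(1) T by (intro mult_right_mono mult_left_mono sq) auto
    finally have "\<bar>2 * c_const y * d_const y - (\<Sum>m\<le>k. b m * 2 ^ m)\<bar> / 2 ^ Suc k \<le> C * T2 * x * 2 ^ k / 2 ^ Suc k"
      by (rule divide_right_mono) simp
    also have "\<dots> = C * T2 * x / 2" by simp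
    also have "\<bar>2 * c_const y * d_const y - (\<Sum>m\<le>k. b m * 2 ^ m)\<bar> / 2 ^ Suc k =
       \<bar>c_const y * d_const y / 2 ^ k - (\<Sum>m\<le>k. b m * 2 ^ m) / 2 ^ Suc k\<bar>"
    proof -
      have "c_const y * d_const y / 2 ^ k = 2 * c_const y * d_const y / 2 ^ Suc k" by simp
      thus ?thesis by (simp only: diff_divide_distrib[symmetric] abs_divide) simp
    qed
    finally have e3: "\<bar>c_const y * d_const y / 2 ^ k - (\<Sum>m\<le>k. b m * 2 ^ m) / 2 ^ Suc k\<bar> \<le> C * T2 * x / 2" .
    have "x \<ge> 0" by (simp add: x_def)
    hence "C * T2 * x / 2 \<le> C * T2 * x" using abC(1) T by simp
    hence "\<bar>f_sum k y - (?A1 + c_const y * d_const y / 2 ^ k)\<bar> \<le> C * x + C * T1 * x + C * T2 * x + 3 * C / ln 2 * x"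
      using e0 e1 e2 e3 by linarith
    also have "\<dots> = D * x" by (simp add: D_def algebra_simps)
    also have "\<dots> \<le> D * (8 * (real k ^ 3 / 3 ^ k))"
    proof (rule mult_left_mono[OF _ D])
      \<comment> \<open>k + 1 <= 2k for k >= 1; cubing gives the 8 in the final constant.\<close>
      have "(real k + 1) ^ 3 \<le> (2 * real k) ^ 3" using k by (intro power_mono) auto
      hence "(real k + 1) ^ 3 \<le> 8 * real k ^ 3" by (simp add: power_mult_distrib)
      thus "x \<le> 8 * (real k ^ 3 / 3 ^ k)" unfolding x_def by (simp add: divide_right_mono)
    qed
    finally show "\<bar>f_sum k y - (?A1 + c_const y * d_const y / 2 ^ k)\<bar> \<le> 8 * D * (real k ^ 3 / 3 ^ k)" by (simp add: mult_ac)
  qed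
qed

end
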